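(* Let $n \ge 3$ and $\varepsilon > 0$. Then there exist a piecewise smooth branched cover $f \colon \mathbb{R}^n \to \mathbb{R}^n$ of finite distortion and a constant $C \ge 1$ such that $$K_O(x,f) \le C \max\{1, \log^{1+\varepsilon}(|x|)\} \quad \text{for all } x \in \mathbb{R}^n,$$ and such that the branch set of $f$ is homeomorphic to the $(n-2)$-dimensional torus $(\mathbb{S}^1)^{n-2} \times \{0\} = \mathbb{S}^1 \times \cdots \times \mathbb{S}^1 \times \{0\}$.
   Context: A mapping $f \colon \mathbb{R}^n \to \mathbb{R}^n$ is a branched cover if it is continuous, open (maps open sets to open sets) and discrete (for every $y \in \mathbb{R}^n$ the set $f^{-1}(y)$ is a discrete set). The branch set $B_f$ is the set of points $x$ at which $f$ fails to be a local homeomorphism, i.e. for every open $U$ containing $x$, $f|_U \colon U \to f(U)$ is not a homeomorphism. A mapping $f \in W^{1,1}_{\mathrm{loc}}(\mathbb{R}^n, \mathbb{R}^n)$ is a mapping of finite distortion if $J_f \in L^1_{\mathrm{loc}}$ and $J_f > 0$ a.e. on the set where $|Df(x)| > 0$. Here $Df$ is the differential, $|Df(x)| = \sup_{|v|=1}|Df(x)v|$ is its operator norm and $J_f(x) = \det Df(x)$. Its outer distortion function is $K_O(x,f) = |Df(x)|^n / J_f(x)$ if $J_f(x) > 0$, and $K_O(x,f) = 1$ otherwise (in particular at points where $Df$ does not exist). Piecewise smooth means here that $f$ is continuously differentiable outside a finite union of closed $(n-1)$-dimensional rectifiable hypersurfaces. For $|x| \le 1$ the quantity $\max\{1,\log^{1+\varepsilon}(|x|)\}$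 is understood to be $1$. *)

theory Defs
  imports "HOL-Analysis.Analysis"
begin

definition branched_cover :: "(real^'n \<Rightarrow> real^'n) \<Rightarrow> bool" where
  "branched_cover f \<longleftrightarrow>
     continuous_on UNIV f \<and>
     (\<forall>U. open U \<longrightarrow> open (f ` U)) \<and>
     (\<forall>y. discrete (f -` {y}))"

definition branch_set :: "(real^'n \<Rightarrow> real^'n) \<Rightarrow> (real^'n) set" where
  "branch_set f = {x. \<forall>U. open U \<and> x \<in> U \<longrightarrow> \<not> (\<exists>g. homeomorphism U (f ` U) f g)}"

fun C_k :: "nat \<Rightarrow> (real^'n \<Rightarrow> real) \<Rightarrow> bool" where
  "C_k 0 \<phi> \<longleftrightarrow> continuous_on UNIV \<phi>"
| "C_k (Suc k) \<phi> \<longleftrightarrow>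
     \<phi> differentiable_on UNIV \<and> (\<forall>v. C_k k (\<lambda>x. frechet_derivative \<phi> (at x) v))"

definition test_function :: "(real^'n \<Rightarrow> real) \<Rightarrow> bool" where
  "test_function \<phi> \<longleftrightarrow> (\<forall>k. C_k k \<phi>) \<and> compact (closure {x. \<phi> x \<noteq> 0})"

definition locally_integrable :: "(real^'n \<Rightarrow> 'b::euclidean_space) \<Rightarrow> bool" where
  "locally_integrable f \<longleftrightarrow> (\<forall>K. compact K \<longrightarrow> f absolutely_integrable_on K)"

text \<open>The matrix field \<open>D\<close> is a weak differential of \<open>f\<close>: the entry \<open>D x $ i $ j\<close>
  is the weak \<open>j\<close>-th partial derivative of the \<open>i\<close>-th component of \<open>f\<close>. A map belongs to
  \<open>W\<^sup>1\<^sup>,\<^sup>1\<close>-loc iff it has such a \<open>D\<close>, which is then unique up to null sets.\<close>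

definition weak_differential ::
    "(real^'n \<Rightarrow> real^'n) \<Rightarrow> (real^'n \<Rightarrow> real^'n^'n) \<Rightarrow> bool" where
  "weak_differential f D \<longleftrightarrow>
     locally_integrable f \<and> locally_integrable D \<and>
     (\<forall>\<phi> i j. test_function \<phi> \<longrightarrow>
        (LINT x|lebesgue. f x $ i * frechet_derivative \<phi> (at x) (axis j 1)) =
        - (LINT x|lebesgue. D x $ i $ j * \<phi> x))"

definition finite_distortion :: "(real^'n \<Rightarrow> real^'n) \<Rightarrow> bool" where
  "finite_distortion f \<longleftrightarrow>
     (\<exists>D. weak_differential f D \<and>
          locally_integrable (\<lambda>x. det (D x)) \<and>
          (AE x in lebesgue. onorm ((*v) (D x)) > 0 \<longrightarrow> det (D x) > 0))"

text \<open>The outer distortion is a pointwise quantity, so it is formed with the classical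
  differential, and it is \<open>1\<close> where that does not exist. If \<open>f\<close> has a weak differential and
  is \<open>C\<^sup>1\<close> off a closed null set, as for the piecewise smooth maps below, the classical and
  the weak differential agree almost everywhere.\<close>

definition outer_distortion :: "(real^'n \<Rightarrow> real^'n) \<Rightarrow> real^'n \<Rightarrow> real" where
  "outer_distortion f x =
     (if f differentiable (at x) \<and> det (jacobian f (at x)) > 0
      then onorm (frechet_derivative f (at x)) ^ CARD('n) / det (jacobian f (at x))
      else 1)"

text \<open>A topological manifold of dimension \<open>CARD('n) - 1\<close>, possibly with boundary. For
  \<open>a \<noteq> b\<close>, the set \<open>{y. y $ a = 0 \<and> 0 \<le> y $ b}\<close> is a closed half-space in a copy of
  Euclidean space of dimension \<open>CARD('n) - 1\<close>.\<close>

definition hypersurface :: "(real^'n) set \<Rightarrow> bool" where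
  "hypersurface S \<longleftrightarrow>
     (\<forall>x\<in>S. \<exists>U W a b. a \<noteq> b \<and> x \<in> U \<and> openin (top_of_set S) U \<and>
        openin (top_of_set {y::real^'n. y $ a = 0 \<and> 0 \<le> y $ b}) W \<and> U homeomorphic W)"

text \<open>Federer's notion of an \<open>m\<close>-rectifiable set (a Lipschitz image of a bounded subset of
  \<open>m\<close>-dimensional space) for \<open>m = CARD('n) - 1\<close>, applied to the compact pieces of \<open>S\<close>,
  since \<open>S\<close> may be unbounded. The hyperplane \<open>{y. y $ a = 0}\<close> stands for \<open>m\<close>-dimensional
  space.\<close>

definition locally_rectifiable :: "(real^'n) set \<Rightarrow> bool" where
  "locally_rectifiable S \<longleftrightarrow>
     (\<forall>K. compact K \<longrightarrow>
        (\<exists>a A g L. bounded A \<and> A \<subseteq> {y::real^'n. y $ a = 0} \<and>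
           L-lipschitz_on A g \<and> S \<inter> K = g ` A))"

definition piecewise_smooth :: "(real^'n \<Rightarrow> real^'n) \<Rightarrow> bool" where
  "piecewise_smooth f \<longleftrightarrow>
     (\<exists>\<S>. finite \<S> \<and>
        (\<forall>S\<in>\<S>. closed S \<and> hypersurface S \<and> locally_rectifiable S) \<and>
        f differentiable_on (- \<Union>\<S>) \<and>
        continuous_on (- \<Union>\<S>) (\<lambda>x. jacobian f (at x)))"

text \<open>The torus \<open>(S\<^sup>1)\<^sup>k \<times> {0}\<close> with the product topology.\<close>

definition torus_topology :: "nat \<Rightarrow> ((nat \<Rightarrow> complex) \<times> real) topology" where
  "torus_topology k =
     prod_topology
       (product_topology (\<lambda>i. top_of_set (sphere 0 1)) {..<k})
       (top_of_set {0})"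

text \<open>For \<open>norm x \<le> 1\<close> the maximum of \<open>1\<close> and the power of the logarithm is read as \<open>1\<close>; the
  library's \<open>powr\<close> would give another value for a negative logarithm.\<close>

definition log_growth :: "real \<Rightarrow> real^'n \<Rightarrow> real" where
  "log_growth \<epsilon> x = (if norm x \<le> 1 then 1 else max 1 (ln (norm x) powr (1 + \<epsilon>)))"

end

theory Submission
  imports Defs
begin

text \<open>
  The map is a composition \<open>G \<circ> h\<close>. Here \<open>h\<close> is a radial diffeomorphism of the whole space onto a ball
  of radius \<open>R\<close>; the ratio of its tangential to its radial stretch grows only like \<open>ln r powr (1 + \<epsilon>)\<close>,
  which is possible because \<open>1 / (r * ln r powr (1 + \<epsilon>))\<close> is integrable at infinity. All distortion
  that is not bounded comes from \<open>h\<close>.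

  The map \<open>G\<close> is the identity outside a tube \<open>T \<times> disc\<close>, where \<open>T\<close> is a torus of codimension two in the
  hyperplane \<open>x $ b = 0\<close>. On each disc it sends the point with polar coordinates \<open>(r, \<theta>)\<close>,
  \<open>-pi < \<theta> \<le> pi\<close>, to \<open>(r, (1 + twist r) * \<theta>)\<close>, with \<open>twist r = 1\<close> for \<open>r \<le> 1/2\<close> and
  \<open>twist r = 0\<close> for \<open>r \<ge> 1\<close>. Near the centre this doubles the angle, so it is a winding map that branches exactly along \<open>T\<close>; at the rim of
  the disc it is the identity. It is discontinuous only across the slit \<open>\<theta> = pi, r \<ge> 1/2\<close>, and the tube is
  stretched in the direction of \<open>x $ b\<close> so that the slit lies outside the ball. Away from \<open>T\<close>,
  \<open>G\<close> is then a locally bi-Lipschitz \<open>C\<^sup>1\<close> map with uniform constants.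

  The tube comes from a composition of complex exponentials, each acting on one coordinate plane. It is a
  local diffeomorphism, periodic in \<open>n - 2\<close> angles, which takes a coordinate subspace onto \<open>T\<close>.
\<close>

section \<open>Continuously differentiable maps\<close>

text \<open>The tear in \<open>G\<close> is forced: circles near the centre of a disc are wrapped
  twice and the rim once, and no continuous modulus-preserving map joins degree two to degree one. A
  ball can avoid the tear, but the whole space is not quasiconformally equivalent to a ball, so
  \<open>h\<close> must have unbounded distortion. The loss stays small because the radial direction
  is the weak one: with tangential stretch t and radial stretch t / q, q \<ge> 1, the outer
  distortion is t^n / (t^(n-1) * (t / q)) = q. The ratio enters to the first power, whatever the
  dimension.

  The doubling near \<open>T\<close> is z^2 / |z| and not z^2. The remaining coordinates are carried
  along unchanged, so the disc directions may be neither collapsed nor blown up; z^2 would have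
  unbounded distortion at \<open>T\<close>. The price is that the map is Lipschitz but not
  differentiable on \<open>T\<close>. Hence the weak differential is obtained from Lipschitz
  continuity, and the pointwise distortion at branch points needs an argument of its own, which
  rests on the evenness of z^2 / |z|.\<close>

definition C1_deriv :: "(real^'n) set \<Rightarrow> (real^'n \<Rightarrow> real^'n) \<Rightarrow> (real^'n \<Rightarrow> real^'n^'n) \<Rightarrow> bool" where
  "C1_deriv U f M \<longleftrightarrow>
     open U \<and> continuous_on U M \<and> (\<forall>x\<in>U. (f has_derivative (*v) (M x)) (at x))"

lemma C1_deriv_subset: "C1_deriv U f M \<Longrightarrow> open V \<Longrightarrow> V \<subseteq> U \<Longrightarrow> C1_deriv V f M"
  unfolding C1_deriv_def by (meson continuous_on_subset subsetD)

lemma C1_deriv_continuous_on: "C1_deriv U f M \<Longrightarrow> continuous_on U f"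
  unfolding C1_deriv_def
  by (meson continuous_at_imp_continuous_on has_derivative_continuous)

lemma C1_deriv_cong:
  assumes "C1_deriv U f M" "\<And>x. x \<in> U \<Longrightarrow> f x = g x"
  shows "C1_deriv U g M"
  using assms has_derivative_transform_within_open[of f _ _ UNIV U g]
  unfolding C1_deriv_def by auto

lemma continuous_on_matrix_mul:
  fixes A B :: "'a::topological_space \<Rightarrow> real^'n^'n"
  assumes "continuous_on U A" "continuous_on U B"
  shows "continuous_on U (\<lambda>x. A x ** B x)"
  unfolding matrix_matrix_mult_def using assms
  by (intro continuous_intros)

lemma continuous_on_det:
  fixes A :: "'a::topological_space \<Rightarrow> real^'n^'n"
  assumes "continuous_on U A"
  shows "continuous_on U (\<lambda>x. det (A x))"
  unfolding det_def using assms by (intro continuous_intros)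

lemma C1_deriv_compose:
  assumes f: "C1_deriv U f M" and g: "C1_deriv V g N" and UV: "f ` U \<subseteq> V"
  shows "C1_deriv U (\<lambda>x. g (f x)) (\<lambda>x. N (f x) ** M x)"
  unfolding C1_deriv_def
proof (intro conjI ballI)
  show "open U" using f by (simp add: C1_deriv_def)
  have "continuous_on U (\<lambda>x. N (f x))"
    using continuous_on_compose2[OF _ C1_deriv_continuous_on[OF f] UV, of N] g
    by (simp add: C1_deriv_def)
  then show "continuous_on U (\<lambda>x. N (f x) ** M x)"
    using f continuous_on_matrix_mul unfolding C1_deriv_def by blast
  fix x assume x: "x \<in> U"
  have "(f has_derivative (*v) (M x)) (at x)" "(g has_derivative (*v) (N (f x))) (at (f x))"
    using f g x UV by (auto simp: C1_deriv_def)
  from diff_chain_at[OF this]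
  show "((\<lambda>x. g (f x)) has_derivative (*v) (N (f x) ** M x)) (at x)"
    by (simp add: o_def matrix_vector_mul_assoc)
qed

lemma C1_deriv_jacobian:
  assumes "C1_deriv U f M" "x \<in> U"
  shows "f differentiable (at x)" "frechet_derivative f (at x) = (*v) (M x)" "jacobian f (at x) = M x"
proof -
  have d: "(f has_derivative (*v) (M x)) (at x)" using assms by (simp add: C1_deriv_def)
  show "f differentiable (at x)" using d by (rule differentiableI)
  show "frechet_derivative f (at x) = (*v) (M x)" by (rule frechet_derivative_at[OF d, symmetric])
  then show "jacobian f (at x) = M x" by (simp add: jacobian_def)
qed

lemma matrix_inv_det_nz:
  fixes A :: "real^'n^'n"
  assumes "det A \<noteq> 0"
  shows "A ** matrix_inv A = mat 1" "matrix_inv A ** A = mat 1"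
proof -
  have "\<exists>B. A ** B = mat 1 \<and> B ** A = mat 1"
    using assms by (simp add: invertible_def flip: invertible_det_nz)
  from someI_ex[OF this] show "A ** matrix_inv A = mat 1" "matrix_inv A ** A = mat 1"
    by (simp_all add: matrix_inv_def)
qed

text \<open>\<open>matrix_inv\<close> is defined by choice, so continuity cannot be read off its
  definition. Cramer's rule turns each entry into a quotient of determinants, which are polynomials
  in the entries of \<open>A x\<close>.\<close>

lemma continuous_on_matrix_inv:
  fixes A :: "'a::topological_space \<Rightarrow> real^'n^'n"
  assumes A: "continuous_on U A" and nz: "\<And>x. x \<in> U \<Longrightarrow> det (A x) \<noteq> 0"
  shows "continuous_on U (\<lambda>x. matrix_inv (A x))"
proof -
  \<comment> \<open>Entry (k, j) is Cramer's value for the k-th unknown when the right-hand side is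
    the j-th unit vector, whose solution is column j of the inverse.\<close>
  let ?C = "\<lambda>x. \<chi> k j. det (\<chi> i l. if l = k then axis j 1 $ i else A x $ i $ l) / det (A x)"
  have "continuous_on U (\<lambda>x. if l = k then axis j 1 $ i else A x $ i $ l)" for i j k l :: 'n
    using A by (cases "l = k") (auto intro!: continuous_intros)
  then have "continuous_on U (\<lambda>x. det (\<chi> i l. if l = k then axis j 1 $ i else A x $ i $ l))"
    for j k :: 'n
    by (intro continuous_on_det continuous_on_vec_lambda)
  then have "continuous_on U ?C"
    using continuous_on_det[OF A] nz by (intro continuous_on_vec_lambda continuous_on_divide) auto
  moreover have "matrix_inv (A x) = ?C x" if "x \<in> U" for x
  proof -
    have inv: "A x ** matrix_inv (A x) = mat 1"
      using matrix_inv_det_nz nz[OF that] by blast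
    have "column j (matrix_inv (A x)) = column j (?C x)" for j
    proof -
      have "A x *v column j (matrix_inv (A x)) = axis j 1"
        by (metis inv matrix_vector_mul_assoc matrix_vector_mul_lid matrix_vector_mult_basis)
      then show ?thesis using cramer[OF nz[OF that]]
        by (auto simp: column_def vec_eq_iff)
    qed
    then show ?thesis by (simp add: column_def vec_eq_iff)
  qed
  ultimately show ?thesis by (simp cong: continuous_on_cong)
qed

text \<open>The inverse function theorem, with the derivative of the inverse in matrix form, so that
  inverse charts can be fed to \<open>C1_deriv_compose\<close> like any other map.\<close>

lemma C1_deriv_local_inverse:
  assumes f: "C1_deriv U f M" and x0: "x0 \<in> U" and det: "det (M x0) \<noteq> 0"
  obtains U' V g where "open U'" "U' \<subseteq> U" "x0 \<in> U'" "open V" "homeomorphism U' V f g"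
    "C1_deriv V g (\<lambda>y. matrix_inv (M (g y)))"
proof -
  \<comment> \<open>Cutting down to invertible derivatives first keeps the image of the local
    inverse in \<open>W\<close>, and along it \<open>matrix_inv\<close> is continuous.\<close>
  define W where "W = {x \<in> U. det (M x) \<noteq> 0}"
  have U: "open U" "continuous_on U M"
    and df: "\<And>x. x \<in> U \<Longrightarrow> (f has_derivative (*v) (M x)) (at x)"
    using f by (auto simp: C1_deriv_def)
  have "W = U \<inter> (\<lambda>x. det (M x)) -` (- {0})" by (auto simp: W_def)
  then have W: "open W" "W \<subseteq> U" "x0 \<in> W"
    using continuous_on_det[OF U(2)] U(1) x0 det
    by (auto simp: W_def intro!: continuous_open_preimage)
  let ?F = "\<lambda>x. Blinfun ((*v) (M x))"
  have ap: "blinfun_apply (?F x) = (*v) (M x)" for x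
    by (simp add: bounded_linear_Blinfun_apply)
  have cont: "continuous_on W ?F"
    using continuous_on_subset[OF U(2) W(2)]
    by (intro continuous_on_blinfun_componentwise)
       (auto simp: ap matrix_vector_mult_def intro!: continuous_intros)
  have inv: "Blinfun ((*v) (matrix_inv (M x0))) o\<^sub>L ?F x0 = id_blinfun"
    by (rule blinfun_eqI)
       (simp add: bounded_linear_Blinfun_apply matrix_vector_mul_assoc det matrix_inv_det_nz)
  obtain U' V g g' where 1: "open U'" "U' \<subseteq> W" "x0 \<in> U'" "open V" "f x0 \<in> V" "homeomorphism U' V f g"
    and dg: "\<And>y. y \<in> V \<Longrightarrow> (g has_derivative (g' y)) (at y)"
    and g': "\<And>y. y \<in> V \<Longrightarrow> g' y = inv (blinfun_apply (?F (g y)))"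
    by (rule inverse_function_theorem[where f = f, OF W(1) _ cont W(3) inv]) (use df W(2) ap in auto)
  have gU: "g y \<in> W" if "y \<in> V" for y
    using 1 that by (metis (no_types, opaque_lifting) homeomorphism_image2 image_eqI subsetD)
  have "g' y = (*v) (matrix_inv (M (g y)))" if "y \<in> V" for y
  proof -
    have *: "det (M (g y)) \<noteq> 0" using gU[OF that] by (simp add: W_def)
    show ?thesis unfolding g'[OF that] ap
      by (intro inv_unique_comp ext)
         (simp_all add: matrix_vector_mul_assoc * matrix_inv_det_nz)
  qed
  moreover have "continuous_on V (\<lambda>y. matrix_inv (M (g y)))"
  proof (rule continuous_on_matrix_inv)
    show "continuous_on V (\<lambda>y. M (g y))"
      using continuous_on_compose2[OF U(2) homeomorphism_cont2[OF 1(6)]] gU W(2) by blast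
    show "det (M (g y)) \<noteq> 0" if "y \<in> V" for y using gU[OF that] by (simp add: W_def)
  qed
  ultimately have "C1_deriv V g (\<lambda>y. matrix_inv (M (g y)))"
    using 1(4) dg by (simp add: C1_deriv_def)
  then show thesis using that 1 W(2) by blast
qed

section \<open>Matrices bounded together with their inverses\<close>

definition bilip :: "real \<Rightarrow> real^'n^'n \<Rightarrow> bool" where
  "bilip L A \<longleftrightarrow> det A > 0 \<and> (\<forall>v. norm v \<le> L * norm (A *v v) \<and> norm (A *v v) \<le> L * norm v)"

lemma bilip_mono: "bilip L A \<Longrightarrow> L \<le> L' \<Longrightarrow> bilip L' A"
  unfolding bilip_def by (meson mult_right_mono norm_ge_zero order_trans)

lemma bilip_mult:
  assumes "bilip L A" "bilip K B" "L \<ge> 0" "K \<ge> 0"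
  shows "bilip (L * K) (A ** B)"
  unfolding bilip_def
proof (intro conjI allI)
  show "det (A ** B) > 0" using assms by (simp add: bilip_def det_mul)
  fix v
  have "norm v \<le> K * norm (B *v v)" using assms by (simp add: bilip_def)
  also have "\<dots> \<le> K * (L * norm (A *v (B *v v)))"
    using assms by (intro mult_left_mono) (auto simp: bilip_def)
  finally show "norm v \<le> L * K * norm (A ** B *v v)"
    by (simp add: matrix_vector_mul_assoc mult_ac)
  have "norm (A *v (B *v v)) \<le> L * norm (B *v v)" using assms by (simp add: bilip_def)
  also have "\<dots> \<le> L * (K * norm v)"
    using assms by (intro mult_left_mono) (auto simp: bilip_def)
  finally show "norm (A ** B *v v) \<le> L * K * norm v"
    by (simp add: matrix_vector_mul_assoc mult_ac)
qed

lemma bilip_matrix_inv: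
  assumes "bilip L A"
  shows "bilip L (matrix_inv A)"
proof -
  have inv: "A ** matrix_inv A = mat 1"
    using assms by (simp add: bilip_def matrix_inv_det_nz)
  have "det A * det (matrix_inv A) = 1" by (metis inv det_I det_mul)
  then have "det (matrix_inv A) > 0"
    using assms by (metis bilip_def zero_less_mult_pos zero_less_one)
  moreover have "A *v (matrix_inv A *v v) = v" for v
    by (simp add: matrix_vector_mul_assoc inv)
  ultimately show ?thesis using assms unfolding bilip_def by metis
qed

lemma bilip_mat_1: "bilip 1 (mat 1)"
  by (simp add: bilip_def)

text \<open>The Leibniz formula has n! products of n entries, each entry at most \<open>L\<close> in
  absolute value. The bound is crude, but it only feeds into a constant.\<close>

lemma det_le_of_norm_le:
  fixes A :: "real^'n^'n"
  assumes "\<And>v. norm (A *v v) \<le> L * norm v"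
  shows "\<bar>det A\<bar> \<le> fact CARD('n) * L ^ CARD('n)"
proof -
  have e: "\<bar>A $ i $ j\<bar> \<le> L" for i j
  proof -
    have "\<bar>A $ i $ j\<bar> = \<bar>(A *v axis j 1) $ i\<bar>" by (simp add: matrix_vector_mult_basis column_def)
    also have "\<dots> \<le> norm (A *v axis j 1)" by (rule component_le_norm_cart)
    also have "\<dots> \<le> L" using assms[of "axis j 1"] by simp
    finally show ?thesis .
  qed
  have "\<bar>det A\<bar> \<le> (\<Sum>p\<in>{p. p permutes (UNIV::'n set)}. \<bar>of_int (sign p) * (\<Prod>i\<in>UNIV. A $ i $ p i)\<bar>)"
    unfolding det_def by (rule sum_abs)
  also have "\<dots> \<le> (\<Sum>p\<in>{p. p permutes (UNIV::'n set)}. L ^ CARD('n))"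
  proof (rule sum_mono)
    fix p :: "'n \<Rightarrow> 'n"
    have "\<bar>of_int (sign p) * (\<Prod>i\<in>UNIV. A $ i $ p i)\<bar> = (\<Prod>i\<in>UNIV. \<bar>A $ i $ p i\<bar>)"
      by (simp add: abs_mult abs_prod sign_def)
    also have "\<dots> \<le> (\<Prod>i\<in>(UNIV::'n set). L)" by (intro prod_mono) (simp add: e)
    finally show "\<bar>of_int (sign p) * (\<Prod>i\<in>UNIV. A $ i $ p i)\<bar> \<le> L ^ CARD('n)" by simp
  qed
  also have "\<dots> = fact CARD('n) * L ^ CARD('n)" by (simp add: card_permutations)
  finally show ?thesis .
qed

text \<open>The inverse matrix obeys the same two-sided estimate, so the upper bound for its
  determinant bounds \<open>det A\<close> away from zero.\<close>

lemma bilip_det_ge: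
  fixes A :: "real^'n^'n"
  assumes "bilip L A"
  shows "1 \<le> fact CARD('n) * L ^ CARD('n) * det A"
proof -
  have inv: "A ** matrix_inv A = mat 1"
    using assms by (simp add: bilip_def matrix_inv_det_nz)
  have 1: "det (matrix_inv A) * det A = 1" by (metis inv det_I det_mul mult.commute)
  have "det (matrix_inv A) \<le> fact CARD('n) * L ^ CARD('n)"
    using det_le_of_norm_le[of "matrix_inv A" L] bilip_matrix_inv[OF assms]
    unfolding bilip_def by force
  then show ?thesis using 1 assms unfolding bilip_def by (metis mult_right_mono less_imp_le)
qed

text \<open>The distortion of a bi-Lipschitz matrix is bounded in terms of \<open>L\<close> and the
  dimension alone. In this form the contribution of \<open>G\<close> enters the final
  estimate.\<close>

lemma bilip_onorm_power_le:
  fixes A :: "real^'n^'n"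
  assumes "bilip L A" "L \<ge> 0"
  shows "onorm ((*v) A) ^ CARD('n) \<le> fact CARD('n) * (L ^ CARD('n) * L ^ CARD('n)) * det A"
proof -
  have "onorm ((*v) A) \<le> L" using assms by (intro onorm_bound) (auto simp: bilip_def)
  then have "onorm ((*v) A) ^ CARD('n) \<le> L ^ CARD('n) * 1"
    by (simp add: onorm_pos_le power_mono)
  also have "\<dots> \<le> L ^ CARD('n) * (fact CARD('n) * L ^ CARD('n) * det A)"
    using bilip_det_ge[OF assms(1)] assms(2) by (intro mult_left_mono) auto
  finally show ?thesis by (simp add: mult_ac)
qed

section \<open>Complex maps acting on a coordinate plane\<close>

definition plane :: "'n \<Rightarrow> 'n \<Rightarrow> real^'n \<Rightarrow> complex" where
  "plane p q y = Complex (y $ p) (y $ q)"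

definition lift :: "'n \<Rightarrow> 'n \<Rightarrow> (complex \<Rightarrow> complex) \<Rightarrow> real^'n \<Rightarrow> real^'n" where
  "lift p q w y = (\<chi> i. if i = p then Re (w (plane p q y)) else if i = q then Im (w (plane p q y)) else y $ i)"

lemma plane_simps [simp]: "Re (plane p q y) = y $ p" "Im (plane p q y) = y $ q"
  by (simp_all add: plane_def)

lemma plane_lift [simp]: "p \<noteq> q \<Longrightarrow> plane p q (lift p q w y) = w (plane p q y)"
  by (simp add: complex_eq_iff lift_def)

lemma lift_nth_other [simp]: "i \<noteq> p \<Longrightarrow> i \<noteq> q \<Longrightarrow> lift p q w y $ i = y $ i"
  by (simp add: lift_def)

lemma lift_nth: "p \<noteq> q \<Longrightarrow> lift p q w y $ p = Re (w (plane p q y))"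
  "p \<noteq> q \<Longrightarrow> lift p q w y $ q = Im (w (plane p q y))"
  by (simp_all add: lift_def)

lemma vec_nth_has_derivative: "((\<lambda>y::real^'n. y $ i) has_derivative (\<lambda>v. v $ i)) (at y)"
  by (rule bounded_linear_imp_has_derivative[OF bounded_linear_vec_nth])

lemma plane_has_derivative: "(plane p q has_derivative plane p q) (at y)"
  unfolding plane_def[abs_def] Complex_eq
  by (auto intro!: derivative_eq_intros vec_nth_has_derivative)

lemma bounded_linear_plane: "bounded_linear (plane p q)"
  using has_derivative_bounded_linear plane_has_derivative by blast

text \<open>Coordinates outside the plane are copied, and copying is its own derivative. So the same
  operator \<open>lift\<close> serves for a plane map and for its differential.\<close>

lemma lift_has_derivative:
  assumes "(w has_derivative w') (at (plane p q y))"
  shows "(lift p q w has_derivative lift p q w') (at y)"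
proof -
  have w: "((\<lambda>y. w (plane p q y)) has_derivative (\<lambda>y. w' (plane p q y))) (at y)"
    using diff_chain_at[OF plane_has_derivative assms] by (simp add: o_def)
  have *: "((\<lambda>y. lift p q w y $ i) has_derivative (\<lambda>v. lift p q w' v $ i)) (at y)" for i
    using w unfolding lift_def vec_lambda_beta
    by (cases "i = p"; cases "i = q")
       (auto intro!: vec_nth_has_derivative
        bounded_linear.has_derivative[OF bounded_linear_Re] bounded_linear.has_derivative[OF bounded_linear_Im])
  show ?thesis
    using * by (intro iffD2[OF has_derivative_componentwise_within])
      (auto simp: Basis_vec_def inner_axis)
qed

lemma linear_lift:
  assumes "linear w'"
  shows "linear (lift p q w')"
proof -
  have "(w' has_derivative w') (at (plane p q 0))"
    using assms by (simp add: bounded_linear_imp_has_derivative linear_conv_bounded_linear)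
  from lift_has_derivative[OF this] show ?thesis by (rule has_derivative_linear)
qed

lemma matrix_lift: "linear w' \<Longrightarrow> (*v) (matrix (lift p q w')) = lift p q w'"
  by (simp add: fun_eq_iff matrix_works linear_lift)

text \<open>A permutation that moves an index outside \<open>{p, q}\<close> picks a zero in that
  row. Only the identity and the transposition of \<open>p\<close> and \<open>q\<close> survive in
  the Leibniz sum.\<close>

lemma det_two_rows:
  fixes A :: "real^'n^'n"
  assumes pq: "p \<noteq> q" and A: "\<And>i j. i \<noteq> p \<Longrightarrow> i \<noteq> q \<Longrightarrow> A $ i $ j = (if i = j then 1 else 0)"
  shows "det A = A $ p $ p * A $ q $ q - A $ p $ q * A $ q $ p"
proof -
  let ?t = "Transposition.transpose p q"
  let ?f = "\<lambda>\<sigma>. of_int (sign \<sigma>) * (\<Prod>i\<in>UNIV. A $ i $ \<sigma> i)"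
  have "det A = sum ?f {id, ?t}" unfolding det_def
  proof (rule sum.mono_neutral_right)
    show "{id, ?t} \<subseteq> {\<sigma>. \<sigma> permutes UNIV}"
      by (auto simp: permutes_id permutes_swap_id)
    show "\<forall>\<sigma>\<in>{\<sigma>. \<sigma> permutes UNIV} - {id, ?t}. ?f \<sigma> = 0"
    proof
      fix \<sigma> assume \<sigma>: "\<sigma> \<in> {\<sigma>. \<sigma> permutes UNIV} - {id, ?t}"
      have "\<exists>i. i \<notin> {p, q} \<and> \<sigma> i \<noteq> i"
      proof (rule ccontr)
        assume "\<not> ?thesis"
        then have "\<sigma> permutes {p, q}" using \<sigma> by (auto intro: permutes_superset[where S = UNIV])
        then show False using \<sigma> by (simp add: permutes_doubleton_iff)
      qed
      then obtain i where "i \<noteq> p" "i \<noteq> q" "\<sigma> i \<noteq> i" by auto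
      then have "A $ i $ \<sigma> i = 0" using A by metis
      then show "?f \<sigma> = 0" by (auto intro!: prod_zero)
    qed
  qed simp
  also have "\<dots> = ?f id + ?f ?t"
    using pq by (subst sum.insert) (auto simp: fun_eq_iff Transposition.transpose_def)
  also have "(\<Prod>i\<in>UNIV. A $ i $ id i) = (\<Prod>i\<in>{p,q}. A $ i $ id i)"
    by (rule prod.mono_neutral_right) (auto simp: A)
  also have "(\<Prod>i\<in>UNIV. A $ i $ ?t i) = (\<Prod>i\<in>{p,q}. A $ i $ ?t i)"
    by (rule prod.mono_neutral_right) (auto simp: A)
  finally show ?thesis using pq by (simp add: sign_swap_id)
qed

lemma plane_axis:
  "p \<noteq> q \<Longrightarrow> plane p q (axis p 1) = 1" "p \<noteq> q \<Longrightarrow> plane p q (axis q 1) = \<i>"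
  "i \<noteq> p \<Longrightarrow> i \<noteq> q \<Longrightarrow> plane p q (axis i 1) = 0"
  by (auto simp: complex_eq_iff axis_def)

lemma det_lift:
  assumes pq: "p \<noteq> q"
  shows "det (matrix (lift p q w' :: real^'n \<Rightarrow> real^'n)) = Re (w' 1) * Im (w' \<i>) - Re (w' \<i>) * Im (w' 1)"
proof -
  have "matrix (lift p q w' :: real^'n \<Rightarrow> real^'n) $ i $ j = (if i = j then 1 else 0)" if "i \<noteq> p" "i \<noteq> q" for i j
    using that by (auto simp: matrix_def axis_def)
  from det_two_rows[OF pq this] show ?thesis
    using pq by (simp add: matrix_def lift_nth plane_axis)
qed

text \<open>Pythagoras for the plane and its complement, on which \<open>lift\<close> does nothing.
  It is also applied to constant \<open>w\<close>, where it speaks about projections and about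
  differences of lifted points.\<close>

lemma norm_lift_sq:
  fixes v :: "real^'n"
  assumes pq: "p \<noteq> q"
  shows "(norm (lift p q w v))\<^sup>2 + (cmod (plane p q v))\<^sup>2 = (norm v)\<^sup>2 + (cmod (w (plane p q v)))\<^sup>2"
proof -
  have *: "(norm x)\<^sup>2 = (cmod (plane p q x))\<^sup>2 + (\<Sum>i\<in>-{p,q}. (x $ i)\<^sup>2)" for x :: "real^'n"
  proof -
    have "(norm x)\<^sup>2 = (\<Sum>i\<in>UNIV. (x $ i)\<^sup>2)"
      by (simp add: norm_vec_def L2_set_def sum_nonneg)
    also have "\<dots> = (\<Sum>i\<in>{p,q} \<union> - {p,q}. (x $ i)\<^sup>2)" by simp
    also have "\<dots> = (\<Sum>i\<in>{p,q}. (x $ i)\<^sup>2) + (\<Sum>i\<in>-{p,q}. (x $ i)\<^sup>2)"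
      by (rule sum.union_disjoint) auto
    finally show ?thesis using pq by (simp add: cmod_power2)
  qed
  show ?thesis using pq by (simp add: *[of v] *[of "lift p q w v"])
qed

lemma norm_plane_le: assumes "p \<noteq> q" shows "cmod (plane p q x) \<le> norm x"
proof (rule power2_le_imp_le)
  show "(cmod (plane p q x))\<^sup>2 \<le> (norm x)\<^sup>2"
    using norm_lift_sq[OF assms, of "\<lambda>_. 0" x] zero_le_power2[of "norm (lift p q (\<lambda>_. 0) x)"]
    unfolding norm_zero zero_power2 by linarith
qed simp

text \<open>The other coordinates are stretched by exactly 1, so the plane estimate passes to the
  whole space as soon as \<open>L \<ge> 1\<close>.\<close>

lemma bilip_lift:
  assumes pq: "p \<noteq> q" and lin: "linear w'" and L: "L \<ge> 1"
    and det: "Re (w' 1) * Im (w' \<i>) - Re (w' \<i>) * Im (w' 1) > 0"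
    and le: "\<And>z. cmod (w' z) \<le> L * cmod z" "\<And>z. cmod z \<le> L * cmod (w' z)"
  shows "bilip L (matrix (lift p q w' :: real^'n \<Rightarrow> real^'n))"
  unfolding bilip_def matrix_lift[OF lin] det_lift[OF pq]
proof (intro conjI allI det)
  fix v :: "real^'n"
  let ?z = "plane p q v" and ?w = "lift p q w' v"
  note eq = norm_lift_sq[OF pq, of w' v]
  have L2: "1 \<le> L\<^sup>2" using L by simp
  have z: "(cmod ?z)\<^sup>2 \<le> (norm v)\<^sup>2" "(cmod (w' ?z))\<^sup>2 \<le> (norm ?w)\<^sup>2"
    using norm_plane_le[OF pq, of v] norm_plane_le[OF pq, of ?w] pq by (simp_all add: power_mono)
  have sq: "(cmod (w' ?z))\<^sup>2 \<le> L\<^sup>2 * (cmod ?z)\<^sup>2" "(cmod ?z)\<^sup>2 \<le> L\<^sup>2 * (cmod (w' ?z))\<^sup>2"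
    using le[of ?z] by (metis power_mono norm_ge_zero power_mult_distrib)+
  \<comment> \<open>\<open>c\<close> is the share of the plane in the squared length
    \<open>y\<close>, and \<open>d\<close> is its image. Only this share can grow, and by at most
    the factor \<open>L\<^sup>2\<close>.\<close>
  have aux: "x \<le> L\<^sup>2 * y" if "x + c = y + d" "d \<le> L\<^sup>2 * c" "c \<le> y" for x y c d :: real
  proof -
    have "x \<le> y + (L\<^sup>2 - 1) * c" using that by (simp add: algebra_simps)
    also have "\<dots> \<le> y + (L\<^sup>2 - 1) * y" using that L2 by (intro add_left_mono mult_left_mono) auto
    finally show ?thesis by (simp add: algebra_simps)
  qed
  have "(norm ?w)\<^sup>2 \<le> (L * norm v)\<^sup>2"
    unfolding power_mult_distrib by (rule aux[OF eq sq(1) z(1)])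
  then show "norm ?w \<le> L * norm v" by (rule power2_le_imp_le) (use L in simp)
  have "(norm v)\<^sup>2 \<le> (L * norm ?w)\<^sup>2"
    unfolding power_mult_distrib by (rule aux[OF eq[symmetric] sq(2) z(2)])
  then show "norm v \<le> L * norm ?w" by (rule power2_le_imp_le) (use L in simp)
qed

text \<open>A real-linear map of the complex plane is determined by its values at 1 and
  \<open>\<i>\<close>. These supply the two columns of the matrix that vary, and the other columns
  are constant.\<close>

lemma C1_deriv_lift:
  fixes p q :: "'n::finite"
  assumes pq: "p \<noteq> q" and D: "open D"
    and w: "\<And>z. z \<in> D \<Longrightarrow> (w has_derivative w' z) (at z)"
    and cont: "continuous_on D (\<lambda>z. w' z 1)" "continuous_on D (\<lambda>z. w' z \<i>)"
  shows "C1_deriv (plane p q -` D) (lift p q w) (\<lambda>y. matrix (lift p q (w' (plane p q y))))"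
  unfolding C1_deriv_def
proof (intro conjI ballI)
  have pc: "continuous_on S (plane p q :: real^'n \<Rightarrow> _)" for S
    by (rule linear_continuous_on[OF bounded_linear_plane])
  show "open (plane p q -` D)" by (rule open_vimage[OF D pc])
  have lin: "linear (w' z)" if "z \<in> D" for z using w[OF that] has_derivative_linear by blast
  show "(lift p q w has_derivative (*v) (matrix (lift p q (w' (plane p q y))))) (at y)"
    if "y \<in> plane p q -` D" for y
    using that lift_has_derivative[OF w] by (simp add: matrix_lift lin)
  have c: "continuous_on (plane p q -` D) (\<lambda>y. w' (plane p q y) (plane p q (axis j 1)))" for j
  proof (cases "j = p \<or> j = q")
    case True
    have "continuous_on (plane p q -` D) (\<lambda>y. w' (plane p q y) 1)" "continuous_on (plane p q -` D) (\<lambda>y. w' (plane p q y) \<i>)"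
      using cont by (auto intro!: continuous_on_compose2[OF _ pc])
    then show ?thesis using True pq by (auto simp: plane_axis)
  next
    case False
    then have "w' (plane p q y) (plane p q (axis j 1)) = 0" if "y \<in> plane p q -` D" for y
      using that lin by (auto simp: plane_axis linear_0)
    then show ?thesis
      by (intro continuous_on_eq[OF continuous_on_const[of _ 0]]) auto
  qed
  have "continuous_on (plane p q -` D) (\<lambda>y. lift p q (w' (plane p q y)) (axis j 1) $ i)" for i j
    unfolding lift_def vec_lambda_beta using c[of j]
    by (cases "i = p"; cases "i = q") (auto intro: continuous_on_Re continuous_on_Im)
  then show "continuous_on (plane p q -` D) (\<lambda>y. matrix (lift p q (w' (plane p q y))))"
    unfolding matrix_def by (intro continuous_on_vec_lambda)
qed

section \<open>The winding map\<close>

text \<open>A cut-off with one continuous derivative. Its second derivative jumps at 0, which is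
  compatible with everything that is claimed about \<open>C1_deriv\<close> maps.\<close>

definition pos_square :: "real \<Rightarrow> real" where "pos_square x = (max 0 x)\<^sup>2"

lemma pos_square_has_derivative: "(pos_square has_real_derivative 2 * max 0 x) (at x)"
proof (cases "x = 0")
  case True
  have "((\<lambda>h. (pos_square (0 + h) - pos_square 0) / h) \<longlongrightarrow> 0) (at 0)"
  proof (rule Lim_null_comparison)
    have "\<bar>(pos_square (0 + h) - pos_square 0) / h\<bar> \<le> \<bar>h\<bar>" if "h \<noteq> 0" for h
      using that by (auto simp: pos_square_def max_def power2_eq_square)
    then show "\<forall>\<^sub>F h in at 0. norm ((pos_square (0 + h) - pos_square 0) / h) \<le> \<bar>h\<bar>"
      by (auto simp: eventually_at_filter)
    show "((\<lambda>h::real. \<bar>h\<bar>) \<longlongrightarrow> 0) (at 0)" by (rule tendsto_eq_intros) (auto intro: tendsto_eq_intros)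
  qed
  then show ?thesis using True by (simp add: DERIV_def)
next
  case False
  show ?thesis
  proof (cases "x > 0")
    case True
    have "((\<lambda>x. x\<^sup>2) has_real_derivative 2 * max 0 x) (at x)"
      using True by (auto intro!: derivative_eq_intros)
    then show ?thesis
      by (rule has_field_derivative_transform_within_open[where S = "{0<..}"]) (use True in \<open>auto simp: pos_square_def\<close>)
  next
    case neg: False
    have "((\<lambda>x. 0) has_real_derivative 2 * max 0 x) (at x)"
      using neg by auto
    then show ?thesis
      by (rule has_field_derivative_transform_within_open[where S = "{..<0}"]) (use False neg in \<open>auto simp: pos_square_def\<close>)
  qed
qed

text \<open>The factor 4 makes the inner term reach 1 exactly at \<open>r = 1\<close>, where the
  distance to 1/2 is 1/2. From there on the outer cut-off gives 0.\<close>

definition twist :: "real \<Rightarrow> real" where "twist r = pos_square (1 - 4 * pos_square (r - 1/2))"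

definition twist' :: "real \<Rightarrow> real" where
  "twist' r = - 16 * max 0 (1 - 4 * pos_square (r - 1/2)) * max 0 (r - 1/2)"

lemma twist_has_derivative: "(twist has_real_derivative twist' r) (at r)"
proof -
  have "((\<lambda>r. pos_square (r - 1/2)) has_real_derivative 2 * max 0 (r - 1/2) * 1) (at r)"
    by (rule DERIV_chain2[OF pos_square_has_derivative]) (auto intro!: derivative_eq_intros)
  then have "((\<lambda>r. 1 - 4 * pos_square (r - 1/2)) has_real_derivative - 8 * max 0 (r - 1/2)) (at r)"
    by (auto intro!: derivative_eq_intros)
  from DERIV_chain2[OF pos_square_has_derivative this] show ?thesis
    by (simp add: twist_def[abs_def] twist'_def mult_ac)
qed

lemma continuous_on_pos_square: "continuous_on A f \<Longrightarrow> continuous_on A (\<lambda>x. pos_square (f x))"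
  unfolding pos_square_def by (intro continuous_intros)

lemma twist_le_half: "r \<le> 1/2 \<Longrightarrow> twist r = 1" "r \<le> 1/2 \<Longrightarrow> twist' r = 0"
  by (auto simp: twist_def twist'_def pos_square_def)

lemma twist_ge_one: assumes "r \<ge> 1" shows "twist r = 0" "twist' r = 0"
proof -
  have "(1/2)\<^sup>2 \<le> (r - 1/2)\<^sup>2" using assms by (intro power_mono) auto
  then have "4 * pos_square (r - 1/2) \<ge> 1" using assms by (simp add: pos_square_def power2_eq_square)
  then show "twist r = 0" "twist' r = 0" by (auto simp: twist_def twist'_def pos_square_def[of "1 - _"])
qed

lemma twist_nonneg: "twist r \<ge> 0" by (simp add: twist_def pos_square_def)

lemma twist_le_1: "twist r \<le> 1"
proof -
  have "max 0 (1 - 4 * pos_square (r - 1/2)) \<le> 1" by (simp add: pos_square_def)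
  then have "(max 0 (1 - 4 * pos_square (r - 1/2)))\<^sup>2 \<le> 1\<^sup>2" by (intro power_mono) auto
  then show ?thesis by (simp add: twist_def pos_square_def[of "1 - _"])
qed

text \<open>\<open>r * twist' r\<close> is the rate of change of the twist in \<open>ln r\<close>,
  the quantity that appears in logarithmic coordinates. The bound is 16 * 1 * (1/2), because
  \<open>r - 1/2 < 1/2\<close> wherever the derivative can be non-zero.\<close>

lemma abs_twist'_le: assumes "r \<ge> 0" shows "r * \<bar>twist' r\<bar> \<le> 8"
proof (cases "r \<ge> 1")
  case False
  have "max 0 (1 - 4 * pos_square (r - 1/2)) \<le> 1" by (simp add: pos_square_def)
  then have "16 * max 0 (1 - 4 * pos_square (r - 1/2)) * max 0 (r - 1/2) \<le> 16 * 1 * (1/2)"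
    using False by (intro mult_mono) (auto simp: max_def)
  then have "\<bar>twist' r\<bar> \<le> 8" by (simp add: twist'_def abs_mult)
  then have "r * \<bar>twist' r\<bar> \<le> 1 * 8" using False assms by (intro mult_mono) auto
  then show ?thesis by simp
qed (simp add: twist_ge_one)

definition winding :: "complex \<Rightarrow> complex" where
  "winding z = z * cis (twist (cmod z) * Arg z)"

definition winding_shear :: "complex \<Rightarrow> real" where
  "winding_shear z = cmod z * twist' (cmod z) * Arg z"

text \<open>In the coordinate \<open>ln z\<close>, with real part \<open>ln r\<close> and imaginary
  part \<theta>, the map sends \<theta> to \<open>(1 + twist r) * \<theta>\<close> and keeps
  \<open>ln r\<close>. Its derivative is triangular with diagonal 1, \<open>1 + twist r\<close> and
  corner \<open>winding_shear z\<close>. The quotient \<open>v / z\<close> is the tangent vector in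
  this coordinate; the factor \<open>winding z\<close> leads back.\<close>

definition winding' :: "complex \<Rightarrow> complex \<Rightarrow> complex" where
  "winding' z v = winding z * Complex (Re (v / z)) ((1 + twist (cmod z)) * Im (v / z) + winding_shear z * Re (v / z))"

text \<open>The slit does harm only from radius 1/2 on, since nearer the centre the doubled angle
  agrees on both sides of it. The centre is left out because \<open>z * sgn z\<close> is not
  differentiable there.\<close>

definition winding_dom :: "complex set" where
  "winding_dom = - \<real>\<^sub>\<le>\<^sub>0 \<union> (ball 0 (1/2) - {0})"

lemma norm_winding [simp]: "cmod (winding z) = cmod z"
  by (simp add: winding_def norm_mult)

lemma winding_0 [simp]: "winding 0 = 0" by (simp add: winding_def)

lemma winding_eq_0_iff [simp]: "winding z = 0 \<longleftrightarrow> z = 0"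
  using norm_winding[of z] by (metis norm_eq_zero)

lemma winding_ge_one: "cmod z \<ge> 1 \<Longrightarrow> winding z = z"
  by (simp add: winding_def twist_ge_one)

lemma winding_le_half: assumes "cmod z \<le> 1/2" shows "winding z = z * sgn z"
  using assms by (cases "z = 0") (simp_all add: winding_def twist_le_half cis_Arg)

text \<open>Near the centre the map is z^2 / |z|, an even function. This symmetry carries
  differentiability across the slit, and it is also what makes injectivity fail at branch
  points.\<close>

lemma winding_minus: "cmod z \<le> 1/2 \<Longrightarrow> winding (- z) = winding z"
  by (simp add: winding_le_half sgn_minus)

lemma open_winding_dom: "open winding_dom"
  unfolding winding_dom_def by (intro open_Un open_Diff) (auto simp: open_Compl)

lemma Arg_has_derivative:
  assumes "z \<notin> \<real>\<^sub>\<le>\<^sub>0"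
  shows "(Arg has_derivative (\<lambda>v. Im (v / z))) (at z)"
proof -
  have "(Ln has_derivative (\<lambda>v. v * inverse z)) (at z)"
    using has_field_derivative_Ln[OF assms] by (simp add: has_field_derivative_def mult_commute_abs)
  then have "((\<lambda>z. Im (Ln z)) has_derivative (\<lambda>v. Im (v / z))) (at z)"
    using bounded_linear.has_derivative[OF bounded_linear_Im] by (fastforce simp: divide_inverse)
  then show ?thesis
  proof (rule has_derivative_transform_within_open[of _ _ _ _ "- \<real>\<^sub>\<le>\<^sub>0"])
    show "open (- \<real>\<^sub>\<le>\<^sub>0 :: complex set)" by (simp add: open_Compl)
    show "z \<in> - \<real>\<^sub>\<le>\<^sub>0" using assms by simp
    show "Im (Ln x) = Arg x" if "x \<in> - \<real>\<^sub>\<le>\<^sub>0" for x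
      using that Arg_eq_Im_Ln[of x] by (cases "x = 0") auto
  qed
qed

lemma winding_has_derivative_slit:
  assumes z: "z \<notin> \<real>\<^sub>\<le>\<^sub>0"
  shows "(winding has_derivative winding' z) (at z)"
proof -
  have z0: "z \<noteq> 0" using z by auto
  let ?r = "cmod z"
  have r: "(cmod has_derivative (\<lambda>v. ?r * Re (v / z))) (at z)"
  proof -
    have "(cmod has_derivative (\<lambda>v. v \<bullet> sgn z)) (at z)"
      using z0 by (rule has_derivative_norm)
    moreover have "v \<bullet> sgn z = ?r * Re (v / z)" for v
      using z0 by (simp add: inner_complex_def Re_divide sgn_div_norm flip: cmod_power2)
        (simp add: power2_eq_square field_simps)
    ultimately show ?thesis by simp
  qed
  have lamc: "((\<lambda>z. twist (cmod z)) has_derivative (\<lambda>v. twist' ?r * (?r * Re (v / z)))) (at z)"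
    using diff_chain_at[OF r, of twist "(*) (twist' ?r)"] twist_has_derivative[of ?r]
    by (simp add: o_def has_field_derivative_def)
  have ph: "((\<lambda>z. twist (cmod z) * Arg z) has_derivative
      (\<lambda>v. twist ?r * Im (v / z) + twist' ?r * (?r * Re (v / z)) * Arg z)) (at z)"
    by (rule has_derivative_mult[OF lamc Arg_has_derivative[OF z]])
  have "((\<lambda>z. z * exp (\<i> * of_real (twist (cmod z) * Arg z))) has_derivative winding' z) (at z)"
  proof (rule has_derivative_eq_rhs)
    let ?d = "\<lambda>v. twist ?r * Im (v / z) + twist' ?r * (?r * Re (v / z)) * Arg z"
    have e: "((\<lambda>z. exp (\<i> * of_real (twist (cmod z) * Arg z))) has_derivative
        (\<lambda>v. exp (\<i> * of_real (twist (cmod z) * Arg z)) * (\<i> * of_real (?d v)))) (at z)"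
    proof -
      have "((\<lambda>z. \<i> * of_real (twist (cmod z) * Arg z)) has_derivative (\<lambda>v. \<i> * of_real (?d v))) (at z)"
        using ph by (intro has_derivative_mult_right has_derivative_of_real)
      moreover have "(exp has_derivative (*) (exp (\<i> * of_real (twist (cmod z) * Arg z))))
          (at (\<i> * of_real (twist (cmod z) * Arg z)))"
        using DERIV_exp by (simp add: has_field_derivative_def)
      ultimately show ?thesis using diff_chain_at by (fastforce simp: o_def)
    qed
    show "((\<lambda>z. z * exp (\<i> * of_real (twist (cmod z) * Arg z))) has_derivative
      (\<lambda>v. z * (exp (\<i> * of_real (twist (cmod z) * Arg z)) * (\<i> * of_real (?d v)))
         + v * exp (\<i> * of_real (twist (cmod z) * Arg z)))) (at z)"
      by (rule has_derivative_mult[OF has_derivative_ident e])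
    show "(\<lambda>v. z * (exp (\<i> * of_real (twist (cmod z) * Arg z)) * (\<i> * of_real (?d v)))
         + v * exp (\<i> * of_real (twist (cmod z) * Arg z))) = winding' z"
    proof
      fix v
      have "Complex (Re (v / z)) ((1 + twist ?r) * Im (v / z) + winding_shear z * Re (v / z))
        = v / z + \<i> * of_real (?d v)"
        by (simp add: complex_eq_iff winding_shear_def algebra_simps)
      then have "winding' z v = z * exp (\<i> * of_real (twist ?r * Arg z)) * (v / z + \<i> * of_real (?d v))"
        unfolding winding'_def winding_def by (simp only: cis_conv_exp)
      then show "z * (exp (\<i> * of_real (twist ?r * Arg z)) * (\<i> * of_real (?d v)))
         + v * exp (\<i> * of_real (twist ?r * Arg z)) = winding' z v"
        using z0 by (simp add: distrib_left mult_ac)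
    qed
  qed
  then show ?thesis by (simp add: winding_def[abs_def] cis_conv_exp)
qed

text \<open>If \<open>z\<close> lies on the slit within the half disc, then \<open>- z\<close> does
  not. The derivative at \<open>- z\<close> is carried back by evenness.\<close>

lemma winding_has_derivative:
  assumes z: "z \<in> winding_dom"
  shows "(winding has_derivative winding' z) (at z)"
proof (cases "z \<in> \<real>\<^sub>\<le>\<^sub>0")
  case True
  then have h: "cmod z < 1/2" "z \<noteq> 0" using z by (auto simp: winding_dom_def)
  then have "- z \<notin> \<real>\<^sub>\<le>\<^sub>0" using True by (auto simp: complex_nonpos_Reals_iff complex_eq_iff)
  from winding_has_derivative_slit[OF this]
  have "((\<lambda>z. winding (- z)) has_derivative (\<lambda>v. winding' (- z) (- v))) (at z)"
    using diff_chain_at[of uminus uminus z winding "winding' (- z)"]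
    by (auto simp: o_def intro!: derivative_eq_intros)
  moreover have "(\<lambda>v. winding' (- z) (- v)) = winding' z"
    using h by (simp add: fun_eq_iff winding'_def winding_shear_def twist_le_half winding_minus)
  ultimately have "((\<lambda>z. winding (- z)) has_derivative winding' z) (at z)" by simp
  then show ?thesis
    by (rule has_derivative_transform_within_open[of _ _ _ _ "ball 0 (1/2)"]) (use h in \<open>auto simp: winding_minus\<close>)
qed (rule winding_has_derivative_slit)

text \<open>\<open>Arg\<close> jumps across the slit, but within the half disc it is multiplied by
  \<open>twist'\<close>, which vanishes there.\<close>

lemma continuous_on_winding_shear: "continuous_on winding_dom winding_shear"
  unfolding winding_dom_def
proof (rule continuous_on_open_Un)
  show "open (- \<real>\<^sub>\<le>\<^sub>0 :: complex set)" by (simp add: open_Compl)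
  show "open (ball 0 (1/2) - {0 :: complex})" by (intro open_Diff) auto
  have "continuous_on (- \<real>\<^sub>\<le>\<^sub>0) Arg"
    by (meson Arg_has_derivative ComplD continuous_at_imp_continuous_on has_derivative_continuous)
  then show "continuous_on (- \<real>\<^sub>\<le>\<^sub>0) winding_shear"
    unfolding winding_shear_def twist'_def by (intro continuous_intros continuous_on_pos_square) auto
  show "continuous_on (ball 0 (1/2) - {0}) winding_shear"
    by (rule continuous_on_eq[OF continuous_on_const[of _ 0]])
       (auto simp: winding_shear_def twist_le_half)
qed

lemma continuous_on_winding': "continuous_on winding_dom (\<lambda>z. winding' z v)"
proof -
  have "continuous_on winding_dom winding"
    by (meson continuous_at_imp_continuous_on has_derivative_continuous winding_has_derivative)
  moreover have "z \<noteq> 0" if "z \<in> winding_dom" for z using that by (auto simp: winding_dom_def)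
  moreover have "continuous_on winding_dom (\<lambda>z. twist (cmod z))"
    unfolding twist_def by (intro continuous_intros continuous_on_pos_square)
  ultimately show ?thesis
    unfolding winding'_def Complex_eq using continuous_on_winding_shear
    by (intro continuous_intros) auto
qed

text \<open>Multiplication by \<open>winding z\<close> and by \<open>1 / z\<close> are similarities
  whose scalings cancel, because the modulus is preserved. What remains is the determinant of the
  triangular matrix.\<close>

lemma winding'_det:
  assumes "z \<noteq> 0"
  shows "Re (winding' z 1) * Im (winding' z \<i>) - Re (winding' z \<i>) * Im (winding' z 1) = 1 + twist (cmod z)"
proof -
  define c d where "c = winding z" and "d = 1 / z"
  have "(cmod c)\<^sup>2 * (cmod d)\<^sup>2 = 1"
    using assms by (simp add: c_def d_def norm_divide power_divide)
  then have 1: "((Re c)\<^sup>2 + (Im c)\<^sup>2) * ((Re d)\<^sup>2 + (Im d)\<^sup>2) = 1"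
    by (simp add: cmod_power2)
  have "winding' z 1 = c * Complex (Re d) ((1 + twist (cmod z)) * Im d + winding_shear z * Re d)"
    "winding' z \<i> = c * Complex (- Im d) ((1 + twist (cmod z)) * Re d - winding_shear z * Im d)"
    by (simp_all add: winding'_def c_def d_def Re_divide Im_divide)
  then have "Re (winding' z 1) * Im (winding' z \<i>) - Re (winding' z \<i>) * Im (winding' z 1)
     = (1 + twist (cmod z)) * (((Re c)\<^sup>2 + (Im c)\<^sup>2) * ((Re d)\<^sup>2 + (Im d)\<^sup>2))"
    by (simp add: power2_eq_square algebra_simps)
  then show ?thesis using 1 by simp
qed

text \<open>The bound is composed of 1 for the radial part, 2 for the angular stretch
  \<open>1 + twist\<close> and \<open>8 * pi\<close> for the shear.\<close>

definition winding_bd :: real where "winding_bd = 3 + 8 * pi"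

lemma winding_bd_ge_1: "winding_bd \<ge> 1" using pi_gt_zero by (simp add: winding_bd_def)

text \<open>\<open>t\<close> and \<open>s\<close> are the tangent vector and its image in
  logarithmic coordinates. Passing to them divides both lengths by the same number
  \<open>cmod z\<close>, so it suffices to compare \<open>s\<close> with \<open>t\<close>.\<close>

lemma winding'_le:
  assumes "z \<noteq> 0"
  shows "cmod (winding' z v) \<le> winding_bd * cmod v" "cmod v \<le> winding_bd * cmod (winding' z v)"
proof -
  define t where "t = v / z"
  define m where "m = winding_shear z"
  define s where "s = Complex (Re t) ((1 + twist (cmod z)) * Im t + m * Re t)"
  have m: "\<bar>m\<bar> \<le> 8 * pi"
  proof -
    have "\<bar>m\<bar> = (cmod z * \<bar>twist' (cmod z)\<bar>) * \<bar>Arg z\<bar>" by (simp add: m_def winding_shear_def abs_mult)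
    also have "\<dots> \<le> 8 * pi"
      using abs_twist'_le[of "cmod z"] Arg_bounded[of z] by (intro mult_mono) auto
    finally show ?thesis .
  qed
  have l: "0 \<le> twist (cmod z)" "twist (cmod z) \<le> 1" by (rule twist_nonneg twist_le_1)+
  have nw: "cmod (winding' z v) = cmod z * cmod s" by (simp add: winding'_def s_def t_def m_def norm_mult)
  have nv: "cmod v = cmod z * cmod t" using assms by (simp add: t_def norm_divide)
  have "cmod s \<le> \<bar>Re s\<bar> + \<bar>Im s\<bar>" by (rule cmod_le)
  also have "\<bar>Im s\<bar> \<le> (1 + twist (cmod z)) * \<bar>Im t\<bar> + \<bar>m\<bar> * \<bar>Re t\<bar>"
    using l by (auto simp: s_def abs_mult intro!: order_trans[OF abs_triangle_ineq])
  also have "\<dots> \<le> 2 * \<bar>Im t\<bar> + 8 * pi * \<bar>Re t\<bar>"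
    using l m by (intro add_mono mult_right_mono) auto
  also have "\<dots> \<le> 2 * cmod t + 8 * pi * cmod t"
    using abs_Re_le_cmod[of t] abs_Im_le_cmod[of t] by (intro add_mono mult_left_mono) auto
  finally have "cmod s \<le> \<bar>Re t\<bar> + (2 * cmod t + 8 * pi * cmod t)" by (simp add: s_def)
  then have "cmod s \<le> winding_bd * cmod t"
    using abs_Re_le_cmod[of t] by (simp add: winding_bd_def algebra_simps)
  then show "cmod (winding' z v) \<le> winding_bd * cmod v"
    unfolding nw nv by (metis mult_left_mono norm_ge_zero mult.left_commute)
  \<comment> \<open>For the inverse bound the triangular system is solved for \<open>Im t\<close>:
    the shear is moved to the other side, and the angular stretch is at least 1.\<close>
  have "\<bar>Im t\<bar> \<le> (1 + twist (cmod z)) * \<bar>Im t\<bar>" using l by (simp add: algebra_simps)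
  also have "\<dots> = \<bar>(1 + twist (cmod z)) * Im t\<bar>" using l by (simp add: abs_mult)
  also have "\<dots> = \<bar>Im s - m * Re s\<bar>" by (simp add: s_def)
  also have "\<dots> \<le> \<bar>Im s\<bar> + \<bar>m\<bar> * \<bar>Re s\<bar>" by (metis abs_mult abs_triangle_ineq4)
  also have "\<dots> \<le> cmod s + 8 * pi * cmod s"
    using abs_Re_le_cmod[of s] abs_Im_le_cmod[of s] m by (intro add_mono mult_mono) auto
  finally have "\<bar>Im t\<bar> \<le> cmod s + 8 * pi * cmod s" .
  moreover have "\<bar>Re t\<bar> \<le> cmod s" using abs_Re_le_cmod[of s] by (simp add: s_def)
  ultimately have "cmod t \<le> winding_bd * cmod s"
    using cmod_le[of t] by (simp add: winding_bd_def algebra_simps)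
  then show "cmod v \<le> winding_bd * cmod (winding' z v)"
    unfolding nw nv by (metis mult_left_mono norm_ge_zero mult.left_commute)
qed

text \<open>There is no derivative at the centre to estimate, so the bound comes from algebra on
  \<open>z * sgn z\<close>. With the shorter point as \<open>y\<close>, the change of direction
  weighted by \<open>y\<close> costs at most twice the distance.\<close>

lemma winding_lipschitz:
  assumes "cmod x \<le> 1/2" "cmod y \<le> 1/2"
  shows "cmod (winding x - winding y) \<le> 3 * cmod (x - y)"
proof -
  have *: "cmod (x * sgn x - y * sgn y) \<le> 3 * cmod (x - y)" if "cmod y \<le> cmod x" for x y :: complex
  proof (cases "x = 0 \<or> y = 0")
    case True then show ?thesis using that by (auto simp: norm_mult norm_sgn)
  next
    case False
    have "x * sgn x - y * sgn y = (x - y) * sgn x + y * (sgn x - sgn y)" by (simp add: algebra_simps)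
    moreover have "y * (sgn x - sgn y) = sgn y * ((x - y) * of_real (cmod y) + y * of_real (cmod y - cmod x)) / of_real (cmod x)"
      using False by (simp add: sgn_eq field_simps)
    moreover have "cmod \<dots> \<le> 2 * cmod (x - y)"
    proof -
      have "cmod ((x - y) * of_real (cmod y) + y * of_real (cmod y - cmod x))
          \<le> cmod (x - y) * cmod y + cmod y * \<bar>cmod y - cmod x\<bar>"
        by (rule order_trans[OF norm_triangle_ineq]) (simp add: norm_mult flip: of_real_diff)
      also have "\<dots> \<le> cmod (x - y) * cmod x + cmod x * cmod (x - y)"
        using that norm_triangle_ineq3[of x y] by (intro add_mono mult_mono) auto
      finally have "cmod ((x - y) * of_real (cmod y) + y * of_real (cmod y - cmod x)) \<le> 2 * cmod (x - y) * cmod x"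
        by (simp add: mult_ac)
      then show ?thesis using False
        unfolding norm_mult norm_divide by (simp add: norm_sgn divide_le_eq)
    qed
    ultimately show ?thesis using norm_triangle_ineq[of "(x - y) * sgn x" "y * (sgn x - sgn y)"] False
      by (simp add: norm_mult norm_sgn)
  qed
  then show ?thesis using *[of x y] *[of y x] assms
    by (cases "cmod y \<le> cmod x") (auto simp: winding_le_half norm_minus_commute)
qed

text \<open>The preimage has half the angle and the same modulus: a square root of \<open>w\<close>,
  rescaled to the length of \<open>w\<close>.\<close>

lemma winding_half_surj:
  assumes "cmod w \<le> 1/2"
  obtains z where "winding z = w" "cmod z = cmod w"
proof -
  define z where "z = csqrt w * of_real (cmod (csqrt w))"
  have n: "cmod z = cmod w"
    by (simp add: z_def norm_mult flip: power2_eq_square norm_power)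
  have "w = 0 \<or> z * sgn z = w"
  proof (cases "w = 0")
    case False
    have "z * sgn z = (csqrt w)\<^sup>2 * of_real ((cmod (csqrt w))\<^sup>2) / of_real (cmod w)"
      unfolding sgn_eq n
      by (simp only: z_def power2_eq_square of_real_mult times_divide_eq_right mult_ac)
    also have "(cmod (csqrt w))\<^sup>2 = cmod w" by (metis norm_power power2_csqrt)
    finally show ?thesis using False by simp
  qed simp
  then have "winding z = w" using n assms by (auto simp: winding_le_half)
  then show thesis using n that by blast
qed

section \<open>Toroidal coordinates\<close>

text \<open>The modulus of the exponential recovers the coordinate \<open>p\<close> exactly, its
  direction recovers \<open>q\<close> up to whole turns. This is the induction step for injectivity
  up to periods.\<close>

lemma lift_exp_eq_iff:
  fixes x y :: "real^'n"
  assumes "p \<noteq> q"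
  shows "lift p q exp x $ p = lift p q exp y $ p \<and> lift p q exp x $ q = lift p q exp y $ q
     \<longleftrightarrow> x $ p = y $ p \<and> cis (x $ q) = cis (y $ q)"
proof -
  have "exp (plane p q x) = exp (plane p q y) \<longleftrightarrow> x $ p = y $ p \<and> cis (x $ q) = cis (y $ q)"
  proof
    assume eq: "exp (plane p q x) = exp (plane p q y)"
    then have "exp (x $ p) = exp (y $ p)" by (metis norm_exp_eq_Re plane_simps(1))
    with eq show "x $ p = y $ p \<and> cis (x $ q) = cis (y $ q)" by (simp add: exp_eq_polar)
  qed (simp add: exp_eq_polar)
  then show ?thesis using assms by (simp add: lift_nth complex_eq_iff)
qed

text \<open>Coordinate \<open>a\<close> carries the radius through all exponentials,
  \<open>e k\<close> is the k-th angle, and \<open>b\<close> is normal to the hyperplane that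
  contains the torus.\<close>

locale torus_coords =
  fixes e :: "nat \<Rightarrow> 'n::finite" and a b :: 'n and m :: nat
  assumes ab: "a \<noteq> b" and inj: "inj_on e {..<m}"
    and ea: "k < m \<Longrightarrow> e k \<noteq> a" and eb: "k < m \<Longrightarrow> e k \<noteq> b"
    and UNIV_eq: "(UNIV :: 'n set) = insert a (insert b (e ` {..<m}))"
begin

text \<open>An iterated surface of revolution: each step turns coordinate \<open>a\<close> into the
  positive radius \<open>exp\<close> of itself and rotates it by the angle \<open>e k\<close> in the
  plane of \<open>a\<close> and \<open>e k\<close>. Positivity of the radius keeps different points
  apart under the rotation.\<close>

primrec torus_map :: "nat \<Rightarrow> real^'n \<Rightarrow> real^'n" where
  "torus_map 0 y = y"
| "torus_map (Suc k) y = lift a (e k) exp (torus_map k y)"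

primrec torus_map' :: "nat \<Rightarrow> real^'n \<Rightarrow> real^'n^'n" where
  "torus_map' 0 y = mat 1"
| "torus_map' (Suc k) y = matrix (lift a (e k) ((*) (exp (plane a (e k) (torus_map k y))))) ** torus_map' k y"

lemma torus_map_C1: "k \<le> m \<Longrightarrow> C1_deriv UNIV (torus_map k) (torus_map' k)"
proof (induction k)
  case 0
  have "(*v) (mat 1 :: real^'n^'n) = (\<lambda>v. v)" by (simp add: fun_eq_iff)
  then show ?case by (simp add: C1_deriv_def)
next
  case (Suc k)
  have "C1_deriv (plane a (e k) -` UNIV) (lift a (e k) exp) (\<lambda>y. matrix (lift a (e k) ((*) (exp (plane a (e k) y)))))"
    by (rule C1_deriv_lift)
       (use Suc.prems ea[of k] in \<open>auto intro!: continuous_intros DERIV_exp simp flip: has_field_derivative_def\<close>)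
  from C1_deriv_compose[OF Suc.IH this] Suc.prems show ?case
    by (simp add: torus_map.simps(2)[abs_def] torus_map'.simps(2)[abs_def])
qed

lemma torus_map_other:
  "k \<le> m \<Longrightarrow> j \<noteq> a \<Longrightarrow> j \<notin> e ` {..<k} \<Longrightarrow> torus_map k y $ j = y $ j"
  by (induction k) (auto simp: lessThan_Suc)

lemma torus_map_b: "k \<le> m \<Longrightarrow> torus_map k y $ b = y $ b"
  using ab by (intro torus_map_other) (auto dest: eb[OF order_less_le_trans])

lemma torus_map_self: assumes "k < m" shows "torus_map k y $ e k = y $ e k"
proof (rule torus_map_other)
  show "e k \<notin> e ` {..<k}"
  proof
    assume "e k \<in> e ` {..<k}"
    then obtain i where "i < k" "e i = e k" by auto
    then show False using inj_onD[OF inj, of i k] assms by auto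
  qed
qed (use assms ea[OF assms] in auto)

text \<open>After k steps only \<open>a\<close> and the first k angle coordinates have been rolled
  up. The later ones are still raw angles, so each joins the comparison only at its own
  step.\<close>

lemma torus_map_eq_iff_aux:
  "k \<le> m \<Longrightarrow> (\<forall>j\<in>insert a (e ` {..<k}). torus_map k y $ j = torus_map k y' $ j) \<longleftrightarrow>
     y $ a = y' $ a \<and> (\<forall>i<k. cis (y $ e i) = cis (y' $ e i))"
proof (induction k)
  case (Suc k)
  have k: "k < m" using Suc by simp
  have ne: "e i \<noteq> e k" "e i \<noteq> a" if "i < k" for i
    using that k inj ea[of i] by (auto simp: inj_on_def)
  have "(\<forall>j\<in>insert a (e ` {..<Suc k}). torus_map (Suc k) y $ j = torus_map (Suc k) y' $ j) \<longleftrightarrow>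
     (lift a (e k) exp (torus_map k y) $ a = lift a (e k) exp (torus_map k y') $ a \<and>
      lift a (e k) exp (torus_map k y) $ e k = lift a (e k) exp (torus_map k y') $ e k) \<and>
     (\<forall>i<k. torus_map k y $ e i = torus_map k y' $ e i)"
    using ne by (auto simp: lessThan_Suc)
  also have "\<dots> \<longleftrightarrow> (\<forall>j\<in>insert a (e ` {..<k}). torus_map k y $ j = torus_map k y' $ j)
      \<and> cis (y $ e k) = cis (y' $ e k)"
    using lift_exp_eq_iff[of a "e k" "torus_map k y" "torus_map k y'"] ea[OF k]
    by (auto simp: torus_map_self[OF k])
  finally show ?case using Suc by (auto simp: less_Suc_eq)
qed auto

lemma torus_map_eq_iff:
  "torus_map m y = torus_map m y' \<longleftrightarrow>
     y $ a = y' $ a \<and> y $ b = y' $ b \<and> (\<forall>i<m. cis (y $ e i) = cis (y' $ e i))"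
proof -
  have "torus_map m y = torus_map m y' \<longleftrightarrow>
      (\<forall>j\<in>insert a (e ` {..<m}). torus_map m y $ j = torus_map m y' $ j) \<and> torus_map m y $ b = torus_map m y' $ b"
    unfolding vec_eq_iff using UNIV_eq by (metis UNIV_I insert_iff)
  then show ?thesis
    unfolding torus_map_eq_iff_aux[OF order_refl] torus_map_b[OF order_refl] by blast
qed

lemma torus_map_bounded:
  "\<exists>B'. \<forall>y. \<bar>y $ a\<bar> \<le> B \<longrightarrow> \<bar>torus_map k y $ a\<bar> \<le> B'"
  if "k \<le> m" using that
proof (induction k)
  case (Suc k)
  then obtain B' where B': "\<And>y. \<bar>y $ a\<bar> \<le> B \<Longrightarrow> \<bar>torus_map k y $ a\<bar> \<le> B'" by auto
  have "\<bar>torus_map (Suc k) y $ a\<bar> \<le> exp B'" if "\<bar>y $ a\<bar> \<le> B" for y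
  proof -
    have "\<bar>torus_map (Suc k) y $ a\<bar> \<le> cmod (exp (plane a (e k) (torus_map k y)))"
      using Suc.prems ea[of k] abs_Re_le_cmod[of "exp (plane a (e k) (torus_map k y))"] by (simp add: lift_nth)
    also have "\<dots> \<le> exp B'" using B'[OF that] by simp
    finally show ?thesis .
  qed
  then show ?case by blast
qed auto

text \<open>Each factor is multiplication by an exponential whose modulus depends only on the
  current value of \<open>a\<close>, and \<open>torus_map_bounded\<close> controls that value. The
  constant is therefore uniform in all angles and in \<open>b\<close>, although the slab is
  unbounded.\<close>

lemma torus_map'_bilip:
  "\<exists>L\<ge>1. \<forall>y. \<bar>y $ a\<bar> \<le> B \<longrightarrow> bilip L (torus_map' k y)" if "k \<le> m"
  using that
proof (induction k)
  case 0
  then show ?case using bilip_mat_1 by auto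
next
  case (Suc k)
  then obtain L where L: "L \<ge> 1" "\<And>y. \<bar>y $ a\<bar> \<le> B \<Longrightarrow> bilip L (torus_map' k y)" by auto
  obtain B' where B': "\<And>y. \<bar>y $ a\<bar> \<le> B \<Longrightarrow> \<bar>torus_map k y $ a\<bar> \<le> B'"
    using torus_map_bounded[of k B] Suc.prems by auto
  let ?K = "exp \<bar>B'\<bar>"
  have "bilip (?K * L) (torus_map' (Suc k) y)" if y: "\<bar>y $ a\<bar> \<le> B" for y
  proof -
    let ?z = "exp (plane a (e k) (torus_map k y))"
    have z: "cmod ?z \<le> ?K" "1 \<le> ?K * cmod ?z"
      using B'[OF y] by (auto simp flip: exp_add)
    have "bilip ?K (matrix (lift a (e k) ((*) ?z)))"
    proof (rule bilip_lift)
      show "linear ((*) ?z)" by (rule linear_times)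
      have "Re (?z * 1) * Im (?z * \<i>) - Re (?z * \<i>) * Im (?z * 1) = (cmod ?z)\<^sup>2"
        by (simp only: cmod_power2) (simp add: power2_eq_square)
      also have "\<dots> > 0" by simp
      finally show "Re (?z * 1) * Im (?z * \<i>) - Re (?z * \<i>) * Im (?z * 1) > 0" .
      show "cmod (?z * v) \<le> ?K * cmod v" for v
        unfolding norm_mult by (intro mult_right_mono z) simp
      show "cmod v \<le> ?K * cmod (?z * v)" for v
        using mult_right_mono[OF z(2), of "cmod v"] by (simp add: norm_mult mult_ac)
    qed (use Suc.prems ea[of k] in auto)
    then show ?thesis using bilip_mult[of ?K _ L "torus_map' k y"] L y by simp
  qed
  moreover have "?K * L \<ge> 1" using L(1) mult_mono[of 1 ?K 1 L] by simp
  ultimately show ?case by blast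
qed

section \<open>The torus and a chart of the tube around it\<close>

definition core :: "(real^'n) set" where
  "core = torus_map m ` {y. y $ a = 0 \<and> y $ b = 0}"

text \<open>It is lifted to the plane with \<open>b\<close> as real and \<open>a\<close> as
  imaginary part. The slit of \<open>winding\<close>, the negative real axis, then points in the
  direction of \<open>b\<close>, and this is the direction that is elongated.\<close>

definition stretch :: "real \<Rightarrow> complex \<Rightarrow> complex" where
  "stretch \<kappa> z = Complex (\<kappa> * Re z) (Im z)"

definition chart :: "real \<Rightarrow> real^'n \<Rightarrow> real^'n" where
  "chart \<kappa> y = torus_map m (lift b a (stretch \<kappa>) y)"

definition chart' :: "real \<Rightarrow> real^'n \<Rightarrow> real^'n^'n" where
  "chart' \<kappa> y = torus_map' m (lift b a (stretch \<kappa>) y) ** matrix (lift b a (stretch \<kappa>))"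

lemma linear_stretch: "linear (stretch \<kappa>)"
  by (rule linearI) (auto simp: stretch_def complex_eq_iff algebra_simps)

lemma stretch_nth:
  "lift b a (stretch \<kappa>) y $ b = \<kappa> * y $ b" "lift b a (stretch \<kappa>) y $ a = y $ a"
  "i < m \<Longrightarrow> lift b a (stretch \<kappa>) y $ e i = y $ e i"
  using ab ea[of i] eb[of i] by (auto simp: lift_nth stretch_def)

lemma chart_C1: "C1_deriv UNIV (chart \<kappa>) (chart' \<kappa>)"
proof -
  have "C1_deriv (plane b a -` UNIV) (lift b a (stretch \<kappa>)) (\<lambda>y. matrix (lift b a (stretch \<kappa>)))"
    using ab bounded_linear_imp_has_derivative[OF linear_conv_bounded_linear[THEN iffD1, OF linear_stretch]]
    by (intro C1_deriv_lift) auto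
  from C1_deriv_compose[OF this torus_map_C1[of m]] show ?thesis
    by (simp add: chart_def[abs_def] chart'_def[abs_def])
qed

lemma chart_b: "chart \<kappa> y $ b = \<kappa> * y $ b"
  by (simp add: chart_def torus_map_b stretch_nth)

lemma chart_eq_iff:
  "\<kappa> \<noteq> 0 \<Longrightarrow> chart \<kappa> y = chart \<kappa> y' \<longleftrightarrow>
     y $ a = y' $ a \<and> y $ b = y' $ b \<and> (\<forall>i<m. cis (y $ e i) = cis (y' $ e i))"
  by (simp add: chart_def torus_map_eq_iff stretch_nth)

lemma chart'_bilip:
  assumes "\<kappa> \<ge> 1"
  shows "\<exists>L\<ge>1. \<forall>y. \<bar>y $ a\<bar> \<le> B \<longrightarrow> bilip L (chart' \<kappa> y)"
proof -
  obtain L where L: "L \<ge> 1" "\<And>y. \<bar>y $ a\<bar> \<le> B \<Longrightarrow> bilip L (torus_map' m y)"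
    using torus_map'_bilip[of m B] by auto
  have "bilip \<kappa> (matrix (lift b a (stretch \<kappa>) :: real^'n \<Rightarrow> real^'n))"
  proof (rule bilip_lift)
    have 1: "cmod (stretch \<kappa> z) \<le> \<kappa> * cmod z" "cmod z \<le> cmod (stretch \<kappa> z)" for z
    proof -
      have k: "1 \<le> \<kappa>\<^sup>2" using assms by simp
      have "(cmod (stretch \<kappa> z))\<^sup>2 \<le> (\<kappa> * cmod z)\<^sup>2"
        using mult_right_mono[OF k, of "(Im z)\<^sup>2"]
        unfolding power_mult_distrib cmod_power2 by (simp add: stretch_def algebra_simps power_mult_distrib)
      then show "cmod (stretch \<kappa> z) \<le> \<kappa> * cmod z"
        by (rule power2_le_imp_le) (use assms in auto)
      have "(cmod z)\<^sup>2 \<le> (cmod (stretch \<kappa> z))\<^sup>2"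
        using mult_right_mono[OF k, of "(Re z)\<^sup>2"]
        unfolding cmod_power2 by (simp add: stretch_def power_mult_distrib)
      then show "cmod z \<le> cmod (stretch \<kappa> z)" by (rule power2_le_imp_le) auto
    qed
    show "cmod (stretch \<kappa> z) \<le> \<kappa> * cmod z" for z by (rule 1)
    show "cmod z \<le> \<kappa> * cmod (stretch \<kappa> z)" for z
      using 1(2)[of z] mult_right_mono[OF assms, of "cmod (stretch \<kappa> z)"] by simp
  qed (use ab assms in \<open>auto simp: linear_stretch stretch_def\<close>)
  then have "bilip (L * \<kappa>) (chart' \<kappa> y)" if "\<bar>y $ a\<bar> \<le> B" for y
    unfolding chart'_def using L that assms by (intro bilip_mult) (auto simp: stretch_nth)
  moreover have "L * \<kappa> \<ge> 1" using L(1) assms mult_mono[of 1 L 1 \<kappa>] by simp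
  ultimately show ?thesis by blast
qed

lemma chart_det: "\<kappa> \<ge> 1 \<Longrightarrow> det (chart' \<kappa> y) \<noteq> 0"
  using chart'_bilip[of \<kappa> "\<bar>y $ a\<bar>"] by (auto simp: bilip_def less_le)

text \<open>The stretch fixes all points with vanishing coordinate \<open>b\<close>, so every
  \<open>\<kappa>\<close> yields the same torus. This permits choosing the radius of the ball, and
  with it \<open>\<kappa>\<close>, after the size of the torus is known.\<close>

lemma core_eq: "core = chart \<kappa> ` {y. plane b a y = 0}"
proof -
  have "lift b a (stretch \<kappa>) y = y" if "y $ a = 0" "y $ b = 0" for y :: "real^'n"
    using that by (auto simp: lift_def vec_eq_iff stretch_def)
  then show ?thesis by (auto simp: core_def chart_def complex_eq_iff image_iff)
qed

lemma chart_reduce: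
  assumes "\<kappa> \<noteq> 0"
  obtains y' where "chart \<kappa> y' = chart \<kappa> y" "plane b a y' = plane b a y" "\<And>i. i < m \<Longrightarrow> \<bar>y' $ e i\<bar> \<le> pi"
proof -
  define y' :: "real^'n" where "y' = (\<chi> i. if i = a \<or> i = b then y $ i else Arg (cis (y $ i)))"
  have "chart \<kappa> y' = chart \<kappa> y"
    unfolding chart_eq_iff[OF assms] using ea eb by (auto simp: y'_def cis_Arg sgn_eq)
  moreover have "plane b a y' = plane b a y" by (simp add: complex_eq_iff y'_def)
  moreover have "\<bar>y' $ e i\<bar> \<le> pi" if "i < m" for i
    using Arg_bounded[of "cis (y $ e i)"] ea[OF that] eb[OF that] by (auto simp: y'_def)
  ultimately show thesis by (rule that)
qed

text \<open>The parameter set is unbounded in the angles. By periodicity its part in a box, a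
  compact set, already has the full image.\<close>

lemma compact_chart_image:
  assumes \<kappa>: "\<kappa> \<noteq> 0" and C: "compact C"
  shows "compact (chart \<kappa> ` {y. plane b a y \<in> C})"
proof -
  obtain B where B: "\<And>z. z \<in> C \<Longrightarrow> cmod z \<le> B"
    using compact_imp_bounded[OF C] by (auto simp: bounded_iff)
  let ?r = "max B pi"
  let ?S = "cbox (\<chi> i. - ?r) (\<chi> i. ?r) \<inter> {y :: real^'n. plane b a y \<in> C}"
  have "closed ((plane b a :: real^'n \<Rightarrow> complex) -` C)"
    by (rule closed_vimage[OF compact_imp_closed[OF C] linear_continuous_on[OF bounded_linear_plane]])
  then have "compact ?S" by (intro compact_Int_closed) (auto simp: vimage_def)
  then have "compact (chart \<kappa> ` ?S)"
    by (intro compact_continuous_image continuous_on_subset[OF C1_deriv_continuous_on[OF chart_C1]]) auto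
  moreover have "chart \<kappa> ` {y. plane b a y \<in> C} \<subseteq> chart \<kappa> ` ?S"
  proof clarify
    fix y :: "real^'n" assume y: "plane b a y \<in> C"
    obtain y' where y': "chart \<kappa> y' = chart \<kappa> y" "plane b a y' = plane b a y" "\<And>i. i < m \<Longrightarrow> \<bar>y' $ e i\<bar> \<le> pi"
      using chart_reduce[OF \<kappa>] by metis
    have "\<bar>y' $ i\<bar> \<le> ?r" for i
    proof -
      consider "i = a" | "i = b" | k where "i = e k" "k < m" using UNIV_eq by (metis UNIV_I imageE insert_iff lessThan_iff)
      then show ?thesis
      proof cases
        case 1
        have "\<bar>y' $ a\<bar> \<le> cmod (plane b a y')" using abs_Im_le_cmod[of "plane b a y'"] by simp
        then show ?thesis using 1 B[OF y] y'(2) by auto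
      next
        case 2
        have "\<bar>y' $ b\<bar> \<le> cmod (plane b a y')" using abs_Re_le_cmod[of "plane b a y'"] by simp
        then show ?thesis using 2 B[OF y] y'(2) by auto
      next
        case 3 then show ?thesis using y'(3)[of k] by auto
      qed
    qed
    then have "y' \<in> ?S" using y y'(2) by (auto simp: mem_box_cart abs_le_iff minus_le_iff)
    then show "chart \<kappa> y \<in> chart \<kappa> ` ?S" using y'(1) by (metis imageI)
  qed
  moreover have "chart \<kappa> ` ?S \<subseteq> chart \<kappa> ` {y. plane b a y \<in> C}" by auto
  ultimately show ?thesis by (metis subset_antisym)
qed

lemma compact_core: "compact core"
  using compact_chart_image[of 1 "{0}"] by (simp add: core_eq[of 1])

lemma core_b: "x \<in> core \<Longrightarrow> x $ b = 0"
  by (auto simp: core_def torus_map_b)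

section \<open>Winding around the torus\<close>

definition wrap :: "real \<Rightarrow> real^'n \<Rightarrow> real^'n" where
  "wrap \<kappa> x = (if x \<in> range (chart \<kappa>) then chart \<kappa> (lift b a winding (SOME y. chart \<kappa> y = x)) else x)"

text \<open>Two parameters of the same point differ by whole turns of the angles and agree in
  \<open>a\<close> and \<open>b\<close>, the coordinates on which the winding acts. So the choice
  made by \<open>SOME\<close> does not affect the value.\<close>

lemma wrap_chart: assumes "\<kappa> \<noteq> 0" shows "wrap \<kappa> (chart \<kappa> y) = chart \<kappa> (lift b a winding y)"
proof -
  define y' where "y' = (SOME y'. chart \<kappa> y' = chart \<kappa> y)"
  have "chart \<kappa> y' = chart \<kappa> y" unfolding y'_def by (rule someI_ex) blast
  then have *: "y' $ a = y $ a" "y' $ b = y $ b" "\<And>i. i < m \<Longrightarrow> cis (y' $ e i) = cis (y $ e i)"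
    by (simp_all add: chart_eq_iff[OF assms])
  then have "plane b a y' = plane b a y" by (simp add: complex_eq_iff)
  then have "chart \<kappa> (lift b a winding y') = chart \<kappa> (lift b a winding y)"
    unfolding chart_eq_iff[OF assms] using ab * ea eb by (auto simp: lift_nth)
  then show ?thesis by (simp add: wrap_def y'_def)
qed

lemma lift_winding_id: "cmod (plane b a y) \<ge> 1 \<Longrightarrow> lift b a winding y = y"
  by (auto simp: lift_def vec_eq_iff winding_ge_one)

lemma wrap_outside:
  assumes "\<kappa> \<noteq> 0" "x \<notin> chart \<kappa> ` {y. cmod (plane b a y) \<le> 1}"
  shows "wrap \<kappa> x = x"
proof (cases "x \<in> range (chart \<kappa>)")
  case True
  then obtain y where "x = chart \<kappa> y" by auto
  then show ?thesis using assms wrap_chart[OF assms(1), of y] lift_winding_id[of y] by force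
qed (simp add: wrap_def)

text \<open>One constant serves up to the torus itself: each of the factors chart, winding and
  inverse chart has bounds that do not depend on the distance to \<open>core\<close>.\<close>

lemma wrap_regular:
  assumes R: "2 * R \<ge> 1"
  obtains L where "L \<ge> 1" "\<And>x. x \<in> ball 0 R - core \<Longrightarrow>
     \<exists>U M. x \<in> U \<and> C1_deriv U (wrap (2 * R)) M \<and> (\<forall>z\<in>U. bilip L (M z))"
proof -
  let ?\<kappa> = "2 * R"
  have \<kappa>: "?\<kappa> \<ge> 1" "?\<kappa> \<noteq> 0" using R by auto
  obtain L where L: "L \<ge> 1" "\<And>y. \<bar>y $ a\<bar> \<le> 3 \<Longrightarrow> bilip L (chart' ?\<kappa> y)"
    using chart'_bilip[OF \<kappa>(1), of 3] by auto
  let ?L = "L * winding_bd * L"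
  have wb: "winding_bd \<ge> 1" by (rule winding_bd_ge_1)
  have L1: "L \<le> ?L" "1 \<le> ?L"
  proof -
    have "L * 1 * 1 \<le> ?L" using L(1) wb by (intro mult_mono) auto
    then show "L \<le> ?L" by simp
    then show "1 \<le> ?L" using L(1) by linarith
  qed
  let ?K = "chart ?\<kappa> ` {y. cmod (plane b a y) \<le> 1}"
  have "?K = chart ?\<kappa> ` {y. plane b a y \<in> cball 0 1}" by simp
  then have K: "closed ?K" using compact_chart_image[OF \<kappa>(2), of "cball 0 1"] by (simp add: compact_imp_closed)
  have "\<exists>U M. x \<in> U \<and> C1_deriv U (wrap ?\<kappa>) M \<and> (\<forall>z\<in>U. bilip ?L (M z))"
    if x: "x \<in> ball 0 R - core" for x
  proof (cases "x \<in> ?K")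
    case False
    have "(*v) (mat 1 :: real^'n^'n) = (\<lambda>v. v)" by (simp add: fun_eq_iff)
    then have "C1_deriv (- ?K) (\<lambda>x. x) (\<lambda>_. mat 1)"
      using K by (simp add: C1_deriv_def open_Compl)
    then have "C1_deriv (- ?K) (wrap ?\<kappa>) (\<lambda>_. mat 1)"
      by (rule C1_deriv_cong) (simp add: wrap_outside[OF \<kappa>(2)])
    moreover have "bilip ?L (mat 1)" using bilip_mono[OF bilip_mat_1] L1 by blast
    ultimately show ?thesis using False by blast
  next
    case True
    then obtain y where y: "x = chart ?\<kappa> y" "cmod (plane b a y) \<le> 1" by auto
    have "\<bar>x $ b\<bar> < R" using x component_le_norm_cart[of x b] by (auto simp: order_le_less_trans)
    \<comment> \<open>This is the reason for \<open>\<kappa> = 2 * R\<close>: a height below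
      \<open>R\<close> in the ball becomes a height below 1/2 in the parameters, too small for the
      slit, which starts at radius 1/2.\<close>
    then have yb: "\<bar>y $ b\<bar> < 1/2" unfolding y(1) chart_b using R by (simp add: abs_mult)
    have y0: "plane b a y \<noteq> 0" using x y core_eq by auto
    \<comment> \<open>\<open>D\<close> extends beyond the unit disc in the direction of
      \<open>a\<close>, so rim points of the tube that lie in the ball are interior to it. Moduli in
      \<open>D\<close> are below 3, and the winding preserves them, so parameter and image both stay
      in the slab where \<open>chart'\<close> is controlled.\<close>
    define D where "D = winding_dom \<inter> {z. \<bar>Im z\<bar> < 2} \<inter> {z. \<bar>Re z\<bar> < 1}"
    have D: "open D" unfolding D_def
      by (intro open_Int open_winding_dom open_Collect_less continuous_intros)
    have yD: "plane b a y \<in> D"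
    proof -
      have "\<bar>y $ a\<bar> \<le> 1" using abs_Im_le_cmod[of "plane b a y"] y(2) by simp
      moreover have "plane b a y \<in> winding_dom"
      proof (cases "plane b a y \<in> \<real>\<^sub>\<le>\<^sub>0")
        case True
        then have "cmod (plane b a y) < 1/2" using yb by (auto simp: complex_nonpos_Reals_iff cmod_eq_Re)
        then show ?thesis using y0 by (simp add: winding_dom_def)
      qed (simp add: winding_dom_def)
      ultimately show ?thesis using yb by (simp add: D_def)
    qed
    obtain U' V g where g: "open U'" "y \<in> U'" "open V" "homeomorphism U' V (chart ?\<kappa>) g"
      "C1_deriv V g (\<lambda>z. matrix_inv (chart' ?\<kappa> (g z)))"
      using C1_deriv_local_inverse[OF chart_C1, of y] chart_det[OF \<kappa>(1)] by (metis UNIV_I)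
    define U where "U = V \<inter> g -` (plane b a -` D)"
    have pD: "open ((plane b a :: real^'n \<Rightarrow> complex) -` D)"
      by (rule open_vimage[OF D linear_continuous_on[OF bounded_linear_plane]])
    have U: "open U" unfolding U_def
      by (rule continuous_open_preimage[OF homeomorphism_cont2[OF g(4)] g(3) pD])
    have gx: "x \<in> V" "g x = y"
      using g(2,4) y(1) by (auto simp: homeomorphism_def)
    have xU: "x \<in> U" using gx yD by (simp add: U_def)
    have w: "C1_deriv (plane b a -` D) (lift b a winding) (\<lambda>y. matrix (lift b a (winding' (plane b a y))))"
      using ab D winding_has_derivative
      by (intro C1_deriv_lift continuous_on_subset[OF continuous_on_winding']) (auto simp: D_def)
    have "C1_deriv U (\<lambda>z. lift b a winding (g z))
        (\<lambda>z. matrix (lift b a (winding' (plane b a (g z)))) ** matrix_inv (chart' ?\<kappa> (g z)))"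
      by (rule C1_deriv_compose[OF C1_deriv_subset[OF g(5) U] w]) (auto simp: U_def)
    from C1_deriv_compose[OF this chart_C1]
    have "C1_deriv U (\<lambda>z. chart ?\<kappa> (lift b a winding (g z)))
      (\<lambda>z. chart' ?\<kappa> (lift b a winding (g z)) ** (matrix (lift b a (winding' (plane b a (g z)))) ** matrix_inv (chart' ?\<kappa> (g z))))"
      (is "C1_deriv U _ ?M") by simp
    moreover have "chart ?\<kappa> (lift b a winding (g z)) = wrap ?\<kappa> z" if "z \<in> U" for z
      using that wrap_chart[OF \<kappa>(2), of "g z"] homeomorphism_apply2[OF g(4)] by (simp add: U_def)
    ultimately have "C1_deriv U (wrap ?\<kappa>) ?M" by (rule C1_deriv_cong)
    moreover have "bilip ?L (?M z)" if "z \<in> U" for z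
    proof -
      let ?z = "plane b a (g z)"
      have zD: "?z \<in> D" using that by (simp add: U_def)
      have z0: "?z \<noteq> 0" using zD by (auto simp: D_def winding_dom_def)
      have ga: "\<bar>g z $ a\<bar> \<le> 3" using zD by (simp add: D_def)
      have "\<bar>lift b a winding (g z) $ a\<bar> \<le> cmod (winding ?z)"
        using ab abs_Im_le_cmod[of "winding ?z"] by (simp add: lift_nth)
      also have "\<dots> \<le> \<bar>Re ?z\<bar> + \<bar>Im ?z\<bar>" unfolding norm_winding by (rule cmod_le)
      also have "\<dots> \<le> 3" using zD by (simp add: D_def)
      finally have wa: "\<bar>lift b a winding (g z) $ a\<bar> \<le> 3" .
      have lin: "linear (winding' ?z)" using zD winding_has_derivative has_derivative_linear by (auto simp: D_def)
      have "bilip winding_bd (matrix (lift b a (winding' ?z) :: real^'n \<Rightarrow> real^'n))"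
        using ab lin wb winding'_le[OF z0] winding'_det[OF z0] twist_nonneg[of "cmod ?z"]
        by (intro bilip_lift) auto
      from bilip_mult[OF L(2)[OF wa] bilip_mult[OF this bilip_matrix_inv[OF L(2)[OF ga]]]]
      show ?thesis using L(1) wb by (simp add: mult_ac)
    qed
    ultimately show ?thesis using xU by blast
  qed
  then show thesis using that L1 by blast
qed


section \<open>The torus as an embedded product of circles\<close>

primrec torus_height :: "nat \<Rightarrow> (nat \<Rightarrow> complex) \<Rightarrow> real" where
  "torus_height 0 w = 0"
| "torus_height (Suc k) w = exp (torus_height k w) * Re (w k)"

text \<open>\<open>torus_map m\<close> on the subspace \<open>a = b = 0\<close>, with the points
  \<open>cis\<close> of the angles as variables in place of the angles;
  \<open>torus_height k\<close> is the value of coordinate \<open>a\<close> after k steps.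
  Continuity on the product of circles then needs no continuous choice of angles.\<close>

definition torus_emb :: "(nat \<Rightarrow> complex) \<Rightarrow> real^'n" where
  "torus_emb w = (\<chi> i. if i = a then torus_height m w else if i = b then 0
     else exp (torus_height (the_inv_into {..<m} e i) w) * Im (w (the_inv_into {..<m} e i)))"

lemma torus_map_cis:
  assumes "y $ a = 0" "y $ b = 0" and w: "\<And>k. k < m \<Longrightarrow> w k = cis (y $ e k)"
  shows "torus_map m y = torus_emb w"
proof -
  have ht: "torus_map k y $ a = torus_height k w" if "k \<le> m" for k
    using that
  proof (induction k)
    case (Suc k)
    then have "torus_map (Suc k) y $ a = exp (torus_map k y $ a) * cos (torus_map k y $ e k)"
      using ea[of k] by (simp add: lift_nth Re_exp)
    then show ?case using Suc w[of k] by (simp add: torus_map_self)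
  qed (simp add: assms)
  \<comment> \<open>Coordinate \<open>e k\<close> is written in step k and left alone by all later
    steps.\<close>
  have co: "torus_map j y $ e k = exp (torus_height k w) * Im (w k)" if "k < j" "j \<le> m" for k j
    using that
  proof (induction j)
    case (Suc j)
    show ?case
    proof (cases "k = j")
      case True
      then have "torus_map (Suc j) y $ e k = exp (torus_map j y $ a) * sin (torus_map j y $ e j)"
        using Suc.prems ea[of j] by (simp add: lift_nth Im_exp)
      then show ?thesis using Suc.prems True ht[of j] w[of k] by (simp add: torus_map_self)
    next
      case False
      then have "e k \<noteq> e j" "e k \<noteq> a" using Suc.prems ea[of k] inj by (auto simp: inj_on_def)
      then show ?thesis using Suc False by simp
    qed
  qed auto
  have "torus_map m y $ i = torus_emb w $ i" for i
  proof -
    consider "i = a" | "i = b" | k where "i = e k" "k < m" using UNIV_eq by (metis UNIV_I imageE insert_iff lessThan_iff)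
    then show ?thesis
    proof cases
      case 1 then show ?thesis using ht[of m] by (simp add: torus_emb_def)
    next
      case 2 then show ?thesis using ab assms by (simp add: torus_emb_def torus_map_b)
    next
      case 3
      then show ?thesis using co[of k m] ea[of k] eb[of k] the_inv_into_f_f[OF inj, of k]
        by (simp add: torus_emb_def)
    qed
  qed
  then show ?thesis by (simp add: vec_eq_iff)
qed

abbreviation "circles \<equiv> product_topology (\<lambda>i. top_of_set (sphere (0::complex) 1)) {..<m}"

lemma torus_emb_continuous: "continuous_map circles euclidean torus_emb"
  unfolding continuous_map_atin limitin_canonical_iff
proof
  fix w assume w: "w \<in> topspace circles"
  have pr: "((\<lambda>v. v k) \<longlongrightarrow> w k) (atin circles w)" if "k < m" for k
  proof -
    have "continuous_map circles euclidean (\<lambda>v. v k)"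
      using continuous_map_product_projection[of k "{..<m}" "\<lambda>_. top_of_set (sphere (0::complex) 1)"] that
      by (auto intro: continuous_map_into_fulltopology)
    then show ?thesis using w by (simp add: continuous_map_atin limitin_canonical_iff)
  qed
  have ht: "(torus_height k \<longlongrightarrow> torus_height k w) (atin circles w)" if "k \<le> m" for k
    using that
  proof (induction k)
    case (Suc k)
    then show ?case
      unfolding torus_height.simps(2)[abs_def] by (intro tendsto_intros pr) auto
  qed (simp add: torus_height.simps(1)[abs_def])
  have "the_inv_into {..<m} e i < m" if "i \<noteq> a" "i \<noteq> b" for i
    using the_inv_into_into[OF inj, of i "{..<m}"] that UNIV_eq by auto
  then show "(torus_emb \<longlongrightarrow> torus_emb w) (atin circles w)"
    unfolding torus_emb_def[abs_def]
    by (intro tendsto_vec_lambda) (auto intro!: tendsto_intros ht pr less_imp_le)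
qed

lemma torus_angles:
  assumes "w \<in> topspace circles"
  obtains y where "y $ a = 0" "y $ b = 0" "\<And>k. k < m \<Longrightarrow> w k = cis (y $ e k)"
proof
  let ?y = "\<chi> i. if i = a \<or> i = b then 0 else Arg (w (the_inv_into {..<m} e i))"
  show "?y $ a = 0" "?y $ b = 0" by auto
  fix k assume k: "k < m"
  have "cmod (w k) = 1" using assms k by (auto simp: PiE_iff)
  then have "w k \<noteq> 0" "sgn (w k) = w k" by (auto simp: sgn_eq)
  then show "w k = cis (?y $ e k)"
    using ea[OF k] eb[OF k] the_inv_into_f_f[OF inj, of k] k by (simp add: cis_Arg)
qed

lemma torus_emb_inj: "inj_on torus_emb (topspace circles)"
proof
  fix w w' assume w: "w \<in> topspace circles" "w' \<in> topspace circles" and eq: "torus_emb w = torus_emb w'"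
  obtain y where y: "y $ a = 0" "y $ b = 0" "\<And>k. k < m \<Longrightarrow> w k = cis (y $ e k)"
    using torus_angles[OF w(1)] by blast
  obtain y' where y': "y' $ a = 0" "y' $ b = 0" "\<And>k. k < m \<Longrightarrow> w' k = cis (y' $ e k)"
    using torus_angles[OF w(2)] by blast
  have "torus_map m y = torus_map m y'"
    using eq torus_map_cis[OF y] torus_map_cis[OF y'] by simp
  then have "w k = w' k" if "k < m" for k using that y y' by (simp add: torus_map_eq_iff)
  then show "w = w'" using w by (auto intro!: PiE_ext[where k = "{..<m}"])
qed

lemma torus_emb_image: "torus_emb ` topspace circles = core"
proof
  show "torus_emb ` topspace circles \<subseteq> core"
  proof clarify
    fix w assume "w \<in> topspace circles"
    then obtain y where "y $ a = 0" "y $ b = 0" "\<And>k. k < m \<Longrightarrow> w k = cis (y $ e k)"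
      by (rule torus_angles) blast
    then show "torus_emb w \<in> core" using torus_map_cis[of y w] by (auto simp: core_def image_iff)
  qed
  show "core \<subseteq> torus_emb ` topspace circles"
  proof
    fix x assume "x \<in> core"
    then obtain y where y: "y $ a = 0" "y $ b = 0" "x = torus_map m y" by (auto simp: core_def)
    let ?w = "\<lambda>k\<in>{..<m}. cis (y $ e k)"
    have "torus_map m y = torus_emb ?w" by (rule torus_map_cis) (simp_all add: y)
    moreover have "?w \<in> topspace circles" by (auto simp: PiE_iff)
    ultimately show "x \<in> torus_emb ` topspace circles" using y(3) by blast
  qed
qed

text \<open>A continuous injection of a compact space into a Hausdorff space is an embedding, so no
  inverse has to be exhibited.\<close>

lemma core_homeomorphic_torus: "torus_topology m homeomorphic_space top_of_set core"
proof -
  let ?X = "torus_topology m"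
  have top: "topspace ?X = topspace circles \<times> {0}" by (simp add: torus_topology_def)
  have cont: "continuous_map ?X euclidean (\<lambda>p. torus_emb (fst p))"
    unfolding torus_topology_def
    using continuous_map_compose[OF continuous_map_fst torus_emb_continuous] by (simp add: o_def)
  have "compact_space ?X"
    unfolding torus_topology_def
    by (simp add: compact_space_prod_topology compact_space_product_topology compact_space_subtopology)
  moreover have "inj_on (\<lambda>p. torus_emb (fst p)) (topspace ?X)"
    using torus_emb_inj unfolding top inj_on_def by auto
  ultimately have "embedding_map ?X euclidean (\<lambda>p. torus_emb (fst p))"
    using cont by (intro continuous_imp_embedding_map) auto
  from embedding_map_imp_homeomorphic_space[OF this]
  have "?X homeomorphic_space top_of_set ((\<lambda>p. torus_emb (fst p)) ` topspace ?X)" .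
  also have "(\<lambda>p. torus_emb (fst p)) ` topspace ?X = core"
    unfolding top torus_emb_image[symmetric] by force
  finally show ?thesis .
qed

end

section \<open>The radial map onto a ball\<close>

text \<open>A multiple of the identity plus a multiple of x x^T. This is the shape of the derivative
  of a map that scales \<open>x\<close> by a function of \<open>x \<bullet> x\<close>.\<close>

definition rank_one :: "real \<Rightarrow> real \<Rightarrow> real^'n \<Rightarrow> real^'n^'n" where
  "rank_one \<alpha> \<beta> x = (\<chi> i j. (if i = j then \<alpha> else 0) + \<beta> * x $ i * x $ j)"

lemma rank_one_mult: "rank_one \<alpha> \<beta> x *v v = \<alpha> *\<^sub>R v + (\<beta> * (x \<bullet> v)) *\<^sub>R x"
proof -
  have "(rank_one \<alpha> \<beta> x *v v) $ i = \<alpha> * v $ i + \<beta> * (x \<bullet> v) * x $ i" for i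
    by (simp add: rank_one_def matrix_vector_mult_def inner_vec_def distrib_right sum.distrib
        sum_distrib_left sum_distrib_right if_distrib[of "\<lambda>t. t * _"] mult.assoc cong: if_cong)
      (simp add: mult_ac)
  then show ?thesis by (simp add: vec_eq_iff)
qed

text \<open>Conjugating by an orthogonal map that takes \<open>x\<close> to a coordinate axis makes the matrix diagonal.\<close>

lemma det_rank_one_aux: "det (rank_one 1 c x :: real^'n^'n) = 1 + c * (x \<bullet> x)"
proof -
  obtain k :: 'n where True by blast
  let ?y = "axis k (norm x) :: real^'n"
  have "?y = norm x *\<^sub>R axis k 1" by (simp add: vec_eq_iff axis_def)
  then have "norm ?y = norm x" by simp
  from orthogonal_transformation_exists[OF this]
  obtain f where f: "orthogonal_transformation f" "f ?y = x" by blast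
  have lin: "linear f" using f by (simp add: orthogonal_transformation_def)
  have mf: "matrix f *v v = f v" for v using lin by (simp add: matrix_works)
  have "rank_one 1 c x ** matrix f = matrix f ** rank_one 1 c ?y"
  proof -
    have "(rank_one 1 c x ** matrix f) *v v = (matrix f ** rank_one 1 c ?y) *v v" for v
    proof -
      have "x \<bullet> f v = ?y \<bullet> v" using f by (metis orthogonal_transformation_def)
      then show ?thesis
        by (simp add: rank_one_mult mf linear_add[OF lin] linear_scale[OF lin] f(2)
            flip: matrix_vector_mul_assoc)
    qed
    then show ?thesis by (simp add: matrix_eq)
  qed
  then have "det (rank_one 1 c x) * det (matrix f) = det (matrix f) * det (rank_one 1 c ?y)"
    by (metis det_mul)
  moreover have "det (matrix f) \<noteq> 0"
    using det_orthogonal_matrix[of "matrix f"] f(1) orthogonal_transformation_matrix[of f] by auto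
  ultimately have "det (rank_one 1 c x) = det (rank_one 1 c ?y)" by simp
  also have "\<dots> = (\<Prod>i\<in>UNIV. rank_one 1 c ?y $ i $ i)"
    by (rule det_diagonal) (auto simp: rank_one_def axis_def)
  also have "\<dots> = (\<Prod>i\<in>UNIV. if i = k then 1 + c * (x \<bullet> x) else 1)"
    by (intro prod.cong) (auto simp: rank_one_def axis_def power2_norm_eq_inner simp flip: power2_eq_square)
  finally show ?thesis by simp
qed

lemma det_rank_one:
  fixes x :: "real^'n"
  assumes "\<alpha> \<noteq> 0"
  shows "det (rank_one \<alpha> \<beta> x) = \<alpha> ^ CARD('n) * (1 + \<beta> / \<alpha> * (x \<bullet> x))"
proof -
  have "rank_one \<alpha> \<beta> x = (\<chi> i. \<alpha> *s rank_one 1 (\<beta> / \<alpha>) x $ i)"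
    using assms by (auto simp: rank_one_def vec_eq_iff field_simps)
  then have "det (rank_one \<alpha> \<beta> x) = det (\<chi> i. \<alpha> *s rank_one 1 (\<beta> / \<alpha>) x $ i)" by simp
  also have "\<dots> = (\<Prod>i\<in>(UNIV::'n set). \<alpha>) * det (\<chi> i. rank_one 1 (\<beta> / \<alpha>) x $ i)"
    by (rule det_rows_mul)
  finally show ?thesis by (simp add: det_rank_one_aux)
qed

text \<open>This is \<open>1 + ln (sqrt (1 + s))\<close>, of the order of \<open>ln r\<close> for
  \<open>s = r\<^sup>2\<close>. The variable \<open>s\<close> avoids the singularity of the norm at
  the origin, and the summand 1 keeps powers of the gauge bounded by 1 when the exponent is
  negative.\<close>

definition log_gauge :: "real \<Rightarrow> real" where "log_gauge s = 1 + ln (1 + s) / 2"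

text \<open>As a function of the gauge L, the term \<open>1 - L powr - \<epsilon> / 2\<close> is a
  bounded antiderivative of \<open>\<epsilon> / 2 * L powr (- 1 - \<epsilon>)\<close>. Dividing it
  by \<open>sqrt (1 + s)\<close> makes the resulting map behave like \<open>x / norm x\<close> far
  out while it stays smooth at the origin.\<close>

definition shrink :: "real \<Rightarrow> real \<Rightarrow> real" where
  "shrink \<epsilon> s = (2 - log_gauge s powr - \<epsilon>) / (2 * sqrt (1 + s))"

text \<open>The logarithmic derivative of the numerator of \<open>shrink\<close> with respect to the
  gauge. Far from the origin it is asymptotically the ratio of radial to tangential stretch.\<close>

definition shrink_slope :: "real \<Rightarrow> real \<Rightarrow> real" where
  "shrink_slope \<epsilon> s = \<epsilon> * log_gauge s powr (- 1 - \<epsilon>) / (2 - log_gauge s powr - \<epsilon>)"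

definition shrink' :: "real \<Rightarrow> real \<Rightarrow> real" where
  "shrink' \<epsilon> s = shrink \<epsilon> s * (shrink_slope \<epsilon> s - 1) / (2 * (1 + s))"

definition to_ball :: "real \<Rightarrow> real \<Rightarrow> real^'n \<Rightarrow> real^'n" where
  "to_ball \<epsilon> R x = (R * shrink \<epsilon> (x \<bullet> x)) *\<^sub>R x"

definition to_ball' :: "real \<Rightarrow> real \<Rightarrow> real^'n \<Rightarrow> real^'n^'n" where
  "to_ball' \<epsilon> R x = rank_one (R * shrink \<epsilon> (x \<bullet> x)) (2 * R * shrink' \<epsilon> (x \<bullet> x)) x"

locale shrinking =
  fixes \<epsilon> R :: real
  assumes \<epsilon>: "\<epsilon> > 0" and R: "R > 0"
begin

lemma log_gauge_ge_1: "s \<ge> 0 \<Longrightarrow> log_gauge s \<ge> 1" by (simp add: log_gauge_def)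

lemma log_gauge_powr: assumes "s \<ge> 0"
  shows "0 < log_gauge s powr - \<epsilon>" "log_gauge s powr - \<epsilon> \<le> 1"
proof -
  show "0 < log_gauge s powr - \<epsilon>" using log_gauge_ge_1[OF assms] by simp
  have "log_gauge s powr - \<epsilon> \<le> log_gauge s powr 0"
    using log_gauge_ge_1[OF assms] \<epsilon> by (intro powr_mono) auto
  then show "log_gauge s powr - \<epsilon> \<le> 1" using log_gauge_ge_1[OF assms] by simp
qed

lemma shrink_pos: "s \<ge> 0 \<Longrightarrow> shrink \<epsilon> s > 0"
  using log_gauge_powr(2)[of s] by (auto simp: shrink_def)

text \<open>The gauge and the logarithm of \<open>sqrt (1 + s)\<close> have the same derivative
  \<open>1 / (2 * (1 + s))\<close>. This gives the logarithmic derivative of \<open>shrink\<close>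
  its common denominator.\<close>

lemma shrink_has_derivative:
  assumes "s \<ge> 0"
  shows "(shrink \<epsilon> has_real_derivative shrink' \<epsilon> s) (at s)"
proof -
  have L: "log_gauge s > 0" using log_gauge_ge_1[OF assms] by simp
  have dL: "(log_gauge has_real_derivative 1 / (2 * (1 + s))) (at s)"
    unfolding log_gauge_def[abs_def] using assms by (auto intro!: derivative_eq_intros simp: field_simps)
  have dP: "((\<lambda>s. log_gauge s powr - \<epsilon>) has_real_derivative
      - \<epsilon> * log_gauge s powr (- \<epsilon> - 1) * (1 / (2 * (1 + s)))) (at s)"
    using DERIV_fun_powr[OF dL L, of "- \<epsilon>"] by simp
  have "((\<lambda>s. sqrt (1 + s)) has_real_derivative 1 / (2 * sqrt (1 + s))) (at s)"
    using assms by (auto intro!: derivative_eq_intros simp: field_simps)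
  from DERIV_cmult[OF this, of 2]
  have dQ: "((\<lambda>s. 2 * sqrt (1 + s)) has_real_derivative 1 / sqrt (1 + s)) (at s)" by simp
  let ?P = "log_gauge s powr - \<epsilon>" and ?P1 = "log_gauge s powr (- \<epsilon> - 1)" and ?r = "sqrt (1 + s)"
  have r: "?r > 0" "1 + s = ?r * ?r" using assms by auto
  have P: "2 - ?P > 0" using log_gauge_powr[OF assms] by simp
  have "((\<lambda>s. (2 - log_gauge s powr - \<epsilon>) / (2 * sqrt (1 + s))) has_real_derivative
     ((0 - - \<epsilon> * ?P1 * (1 / (2 * (1 + s)))) * (2 * ?r) - (2 - ?P) * (1 / ?r)) / ((2 * ?r) * (2 * ?r))) (at s)"
    by (intro DERIV_divide DERIV_diff dP dQ DERIV_const) (use r in auto)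
  moreover have "((0 - - \<epsilon> * ?P1 * (1 / (2 * (1 + s)))) * (2 * ?r) - (2 - ?P) * (1 / ?r)) / ((2 * ?r) * (2 * ?r))
      = shrink' \<epsilon> s"
  proof -
    have e: "shrink_slope \<epsilon> s = \<epsilon> * ?P1 / (2 - ?P)" 
      unfolding shrink_slope_def by (simp only: minus_diff_commute[of 1 \<epsilon>])
    have "((0 - - \<epsilon> * p * (1 / (2 * t))) * (2 * u) - Q * (1 / u)) / ((2 * u) * (2 * u))
        = Q / (2 * u) * (\<epsilon> * p / Q - 1) / (2 * t)" if "u > 0" "Q > 0" "t = u * u" for p u Q t :: real
      using that by (simp add: field_simps)
    from this[OF r(1) P r(2)] show ?thesis unfolding shrink'_def e shrink_def .
  qed
  ultimately show ?thesis by (simp add: shrink_def[abs_def])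
qed

lemma to_ball_C1: "C1_deriv UNIV (to_ball \<epsilon> R) (to_ball' \<epsilon> R :: real^'n \<Rightarrow> real^'n^'n)"
  unfolding C1_deriv_def
proof (intro conjI ballI)
  have c1: "continuous_on UNIV (\<lambda>x :: real^'n. log_gauge (x \<bullet> x))"
    unfolding log_gauge_def by (intro continuous_intros) (auto simp: add_nonneg_eq_0_iff)
  have L: "log_gauge (x \<bullet> x) > 0" "2 - log_gauge (x \<bullet> x) powr - \<epsilon> > 0" "1 + x \<bullet> x > 0" for x :: "real^'n"
    using log_gauge_ge_1[of "x \<bullet> x"] log_gauge_powr[of "x \<bullet> x"] by (auto simp: add_pos_nonneg)
  have c2: "continuous_on UNIV (\<lambda>x :: real^'n. shrink \<epsilon> (x \<bullet> x))"
    unfolding shrink_def using L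
    by (intro continuous_intros c1) (auto simp: less_imp_neq[symmetric])
  have c3: "continuous_on UNIV (\<lambda>x :: real^'n. shrink_slope \<epsilon> (x \<bullet> x))"
    unfolding shrink_slope_def using L
    by (intro continuous_intros c1) (auto simp: less_imp_neq[symmetric])
  have c4: "continuous_on UNIV (\<lambda>x :: real^'n. shrink' \<epsilon> (x \<bullet> x))"
    unfolding shrink'_def
    by (intro continuous_intros c2 c3) (metis L(3) less_irrefl mult_eq_0_iff zero_neq_numeral)
  have "continuous_on UNIV (\<lambda>x :: real^'n. if i = j then R * shrink \<epsilon> (x \<bullet> x) else 0)" for i j :: 'n
    by (cases "i = j") (auto intro!: continuous_intros c2)
  then show "continuous_on UNIV (to_ball' \<epsilon> R :: real^'n \<Rightarrow> real^'n^'n)"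
    unfolding to_ball'_def[abs_def] rank_one_def
    by (intro continuous_on_vec_lambda continuous_on_add continuous_on_mult continuous_on_const c4 continuous_on_component continuous_on_id)
  fix x :: "real^'n"
  have "((\<lambda>x. x \<bullet> x) has_derivative (\<lambda>v. 2 * (x \<bullet> v))) (at x)"
    by (auto intro!: derivative_eq_intros simp: inner_commute)
  from diff_chain_at[OF this shrink_has_derivative[of "x \<bullet> x", unfolded has_field_derivative_def]]
  have "((\<lambda>x. shrink \<epsilon> (x \<bullet> x)) has_derivative (\<lambda>v. shrink' \<epsilon> (x \<bullet> x) * (2 * (x \<bullet> v)))) (at x)"
    by (simp add: o_def)
  then have "((\<lambda>x. (R * shrink \<epsilon> (x \<bullet> x)) *\<^sub>R x) has_derivative
      (\<lambda>v. (R * shrink \<epsilon> (x \<bullet> x)) *\<^sub>R v + (R * (shrink' \<epsilon> (x \<bullet> x) * (2 * (x \<bullet> v)))) *\<^sub>R x)) (at x)"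
    by (auto intro!: derivative_eq_intros)
  then show "(to_ball \<epsilon> R has_derivative (*v) (to_ball' \<epsilon> R x)) (at x)"
    unfolding to_ball_def[abs_def] to_ball'_def by (simp add: rank_one_mult[abs_def] mult_ac)
qed simp

text \<open>The eigenvalues of \<open>to_ball' \<epsilon> R x\<close> are \<open>R * shrink \<epsilon> (x \<bullet> x)\<close> in the tangential directions and
  \<open>radial_factor (x \<bullet> x)\<close> times that in the radial one.\<close>

definition radial_factor :: "real \<Rightarrow> real" where
  "radial_factor s = (1 + s * shrink_slope \<epsilon> s) / (1 + s)"

text \<open>All estimates come from a denominator between 1 and 2 and a gauge that is at least
  1.\<close>

lemma slope_bounds:
  assumes "s \<ge> 0"
  shows "shrink_slope \<epsilon> s \<le> \<epsilon>" "\<epsilon> / 2 * log_gauge s powr (- 1 - \<epsilon>) \<le> shrink_slope \<epsilon> s" "0 < shrink_slope \<epsilon> s"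
    "log_gauge s powr (- 1 - \<epsilon>) \<le> 1"
proof -
  note L = log_gauge_ge_1[OF assms] and P = log_gauge_powr[OF assms]
  have "log_gauge s powr (- 1 - \<epsilon>) \<le> log_gauge s powr 0" using L \<epsilon> by (intro powr_mono) auto
  then show 1: "log_gauge s powr (- 1 - \<epsilon>) \<le> 1" using L by simp
  have "\<epsilon> * log_gauge s powr (- 1 - \<epsilon>) \<le> \<epsilon> * (2 - log_gauge s powr - \<epsilon>)"
    using 1 P \<epsilon> by (intro mult_left_mono) auto
  then show "shrink_slope \<epsilon> s \<le> \<epsilon>" using P by (simp add: shrink_slope_def divide_le_eq)
  have "0 < log_gauge s powr (- 1 - \<epsilon>)" using L by simp
  then show "0 < shrink_slope \<epsilon> s" using P \<epsilon> by (simp add: shrink_slope_def)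
  have "\<epsilon> * log_gauge s powr (- 1 - \<epsilon>) / 2 \<le> \<epsilon> * log_gauge s powr (- 1 - \<epsilon>) / (2 - log_gauge s powr - \<epsilon>)"
    using P \<epsilon> by (intro divide_left_mono) auto
  then show "\<epsilon> / 2 * log_gauge s powr (- 1 - \<epsilon>) \<le> shrink_slope \<epsilon> s" by (simp add: shrink_slope_def)
qed

lemma radial_factor_eq: "s \<ge> 0 \<Longrightarrow> radial_factor s = 1 + (shrink_slope \<epsilon> s - 1) * s / (1 + s)"
  by (simp add: radial_factor_def field_simps)

lemma radial_factor_pos: "s \<ge> 0 \<Longrightarrow> radial_factor s > 0"
  using slope_bounds(3)[of s] by (simp add: radial_factor_def add_pos_nonneg)

text \<open>\<open>radial_factor s\<close> is the mean of 1 and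
  \<open>shrink_slope \<epsilon> s\<close> with weights \<open>1 / (1 + s)\<close> and
  \<open>s / (1 + s)\<close>, so a common lower bound of the two is one for the mean.\<close>

lemma radial_factor_ge:
  assumes "s \<ge> 0"
  shows "min 1 (\<epsilon> / 2) * log_gauge s powr (- 1 - \<epsilon>) \<le> radial_factor s"
proof -
  let ?c = "min 1 (\<epsilon> / 2) * log_gauge s powr (- 1 - \<epsilon>)"
  note B = slope_bounds[OF assms]
  have c1: "?c \<le> 1" using B(4) \<epsilon> mult_mono[of "min 1 (\<epsilon>/2)" 1 "log_gauge s powr (- 1 - \<epsilon>)" 1] by simp
  have "?c \<le> \<epsilon> / 2 * log_gauge s powr (- 1 - \<epsilon>)" by (intro mult_right_mono) auto
  then have c2: "?c \<le> shrink_slope \<epsilon> s" using B(2) by simp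
  have "?c * (1 + s) \<le> 1 + s * shrink_slope \<epsilon> s"
    using add_mono[OF c1 mult_left_mono[OF c2 assms]] by (simp only: distrib_left mult_1_right mult.commute[of s])
  then show ?thesis using assms by (simp add: radial_factor_def le_divide_eq)
qed

text \<open>The link between the smooth gauge and \<open>log_growth\<close> with its convention
  inside the unit ball. The factor 3 is generous: outside that ball the gauge is at most
  \<open>3 / 2 + ln (norm x)\<close>.\<close>

lemma log_gauge_le:
  fixes x :: "real^'n"
  shows "log_gauge (x \<bullet> x) powr (1 + \<epsilon>) \<le> 3 powr (1 + \<epsilon>) * log_growth \<epsilon> x"
proof (cases "norm x \<le> 1")
  case True
  have "x \<bullet> x \<le> 1" using True by (simp add: power2_norm_eq_inner[symmetric] power_le_one)
  then have "ln (1 + x \<bullet> x) \<le> x \<bullet> x" by (intro ln_add_one_self_le_self) simp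
  then have "log_gauge (x \<bullet> x) \<le> 3" using \<open>x \<bullet> x \<le> 1\<close> by (simp add: log_gauge_def)
  then have "log_gauge (x \<bullet> x) powr (1 + \<epsilon>) \<le> 3 powr (1 + \<epsilon>)"
    using \<epsilon> log_gauge_ge_1[of "x \<bullet> x"] by (intro powr_mono2) auto
  then show ?thesis using True by (simp add: log_growth_def)
next
  case False
  let ?l = "ln (norm x)"
  have l: "?l > 0" using False by (intro ln_gt_zero) simp
  have n1: "1 \<le> (norm x)\<^sup>2" using False by (simp add: one_le_power)
  have x0: "x \<noteq> 0" using n1 by auto
  have "ln (1 + x \<bullet> x) \<le> ln (2 * (norm x)\<^sup>2)"
    using n1 x0 by (subst ln_le_cancel_iff) (auto simp: power2_norm_eq_inner add_pos_nonneg)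
  also have "\<dots> = ln 2 + 2 * ?l" using x0 by (simp add: ln_mult ln_realpow)
  also have "\<dots> \<le> 1 + 2 * ?l" using ln_2_less_1 by simp
  finally have "log_gauge (x \<bullet> x) \<le> 3 * max 1 ?l" by (simp add: log_gauge_def)
  then have "log_gauge (x \<bullet> x) powr (1 + \<epsilon>) \<le> (3 * max 1 ?l) powr (1 + \<epsilon>)"
    using \<epsilon> log_gauge_ge_1[of "x \<bullet> x"] by (intro powr_mono2) auto
  also have "\<dots> = 3 powr (1 + \<epsilon>) * (max 1 ?l) powr (1 + \<epsilon>)" by (simp add: powr_mult)
  also have "(max 1 ?l) powr (1 + \<epsilon>) = max 1 (?l powr (1 + \<epsilon>))"
  proof (cases "?l \<le> 1")
    case True
    then have "?l powr (1 + \<epsilon>) \<le> 1 powr (1 + \<epsilon>)" using \<epsilon> l by (intro powr_mono2) auto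
    then show ?thesis using True by simp
  next
    case False
    then have "1 powr (1 + \<epsilon>) \<le> ?l powr (1 + \<epsilon>)" using \<epsilon> l by (intro powr_mono2) auto
    then show ?thesis using False by simp
  qed
  finally show ?thesis using False by (simp add: log_growth_def)
qed

lemma radial_identity:
  fixes r q t d s :: real
  assumes "r > 0" "q > 0" "t > 0"
  shows "2 * r * (q * d / (2 * t)) / (r * q) * s = d * s / t"
    "\<bar>2 * r * (q * d / (2 * t))\<bar> * s = r * q * \<bar>d\<bar> * (s / t)"
  using assms by (simp_all add: abs_mult field_simps)

lemma det_to_ball':
  fixes x :: "real^'n"
  shows "det (to_ball' \<epsilon> R x) = (R * shrink \<epsilon> (x \<bullet> x)) ^ CARD('n) * radial_factor (x \<bullet> x)"
proof -
  let ?s = "x \<bullet> x"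
  have q: "shrink \<epsilon> ?s > 0" by (rule shrink_pos) simp
  have "2 * R * shrink' \<epsilon> ?s / (R * shrink \<epsilon> ?s) * ?s = (shrink_slope \<epsilon> ?s - 1) * ?s / (1 + ?s)"
    using radial_identity[of R "shrink \<epsilon> ?s" "1 + ?s"] q R by (simp add: shrink'_def add_pos_nonneg)
  then show ?thesis
    using q R by (simp add: to_ball'_def det_rank_one radial_factor_eq)
qed

lemma det_to_ball'_pos: "det (to_ball' \<epsilon> R x) > 0"
  using R shrink_pos[of "x \<bullet> x"] radial_factor_pos[of "x \<bullet> x"] by (simp add: det_to_ball')

text \<open>The operator norm is comparable to the tangential stretch: the rank-one part adds at
  most the factor \<open>1 + \<epsilon>\<close>, because the slope lies between 0 and
  \<epsilon>.\<close>

lemma norm_to_ball':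
  "norm (to_ball' \<epsilon> R x *v v) \<le> (2 + \<epsilon>) * (R * shrink \<epsilon> (x \<bullet> x)) * norm v"
proof -
  let ?s = "x \<bullet> x" and ?q = "R * shrink \<epsilon> (x \<bullet> x)"
  have q: "?q > 0" using R shrink_pos[of ?s] by simp
  have s: "0 \<le> ?s" by simp
  have "\<bar>2 * R * shrink' \<epsilon> ?s\<bar> * ?s = ?q * \<bar>shrink_slope \<epsilon> ?s - 1\<bar> * (?s / (1 + ?s))"
    using radial_identity(2)[OF R shrink_pos[OF s], of "1 + ?s"] by (simp add: shrink'_def add_pos_nonneg)
  also have "\<dots> \<le> ?q * (1 + \<epsilon>) * 1"
    using q \<epsilon> R less_imp_le[OF shrink_pos[OF s]] slope_bounds(1,3)[OF s] s by (intro mult_mono) (auto simp: divide_le_eq add_pos_nonneg)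
  finally have b: "\<bar>2 * R * shrink' \<epsilon> ?s\<bar> * ?s \<le> ?q * (1 + \<epsilon>)" by simp
  have "norm (to_ball' \<epsilon> R x *v v) \<le> norm (?q *\<^sub>R v) + norm ((2 * R * shrink' \<epsilon> ?s * (x \<bullet> v)) *\<^sub>R x)"
    unfolding to_ball'_def rank_one_mult by (rule norm_triangle_ineq)
  also have "\<dots> = ?q * norm v + \<bar>2 * R * shrink' \<epsilon> ?s\<bar> * (\<bar>x \<bullet> v\<bar> * norm x)"
    using R shrink_pos[of ?s] by (simp add: abs_mult)
  also have "\<bar>2 * R * shrink' \<epsilon> ?s\<bar> * (\<bar>x \<bullet> v\<bar> * norm x) \<le> \<bar>2 * R * shrink' \<epsilon> ?s\<bar> * ((norm x * norm v) * norm x)"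
    by (intro mult_left_mono mult_right_mono Cauchy_Schwarz_ineq2) auto
  also have "\<dots> = \<bar>2 * R * shrink' \<epsilon> ?s\<bar> * ?s * norm v" by (simp add: power2_norm_eq_inner[symmetric] power2_eq_square)
  also have "\<dots> \<le> ?q * (1 + \<epsilon>) * norm v" by (intro mult_right_mono b) auto
  finally show ?thesis by (simp add: algebra_simps)
qed

text \<open>The power of the norm and the determinant both contain the n-th power of the tangential
  stretch. Once it cancels, only the reciprocal of \<open>radial_factor\<close> remains, to the
  first power; this is the source of the exponent \<open>1 + \<epsilon>\<close>.\<close>

lemma to_ball'_distortion:
  obtains C where "C \<ge> 0"
    "\<And>x :: real^'n. onorm ((*v) (to_ball' \<epsilon> R x)) ^ CARD('n) \<le> C * log_growth \<epsilon> x * det (to_ball' \<epsilon> R x)"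
proof -
  let ?m = "min 1 (\<epsilon> / 2)"
  let ?C = "(2 + \<epsilon>) ^ CARD('n) * (3 powr (1 + \<epsilon>) / ?m)"
  have m: "?m > 0" using \<epsilon> by simp
  have "onorm ((*v) (to_ball' \<epsilon> R x)) ^ CARD('n) \<le> ?C * log_growth \<epsilon> x * det (to_ball' \<epsilon> R x)" for x :: "real^'n"
  proof -
    let ?s = "x \<bullet> x" and ?q = "R * shrink \<epsilon> (x \<bullet> x)"
    have q: "?q > 0" using R shrink_pos[of ?s] by simp
    have "onorm ((*v) (to_ball' \<epsilon> R x)) \<le> (2 + \<epsilon>) * ?q" by (rule onorm_bound) (use \<epsilon> q norm_to_ball' in auto)
    then have "onorm ((*v) (to_ball' \<epsilon> R x)) ^ CARD('n) \<le> ((2 + \<epsilon>) * ?q) ^ CARD('n)"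
      by (intro power_mono onorm_pos_le) auto
    also have "\<dots> = (2 + \<epsilon>) ^ CARD('n) * ?q ^ CARD('n) * 1" by (simp only: power_mult_distrib mult_1_right)
    also have "\<dots> \<le> (2 + \<epsilon>) ^ CARD('n) * ?q ^ CARD('n) * (3 powr (1 + \<epsilon>) / ?m * log_growth \<epsilon> x * radial_factor ?s)"
    proof (rule mult_left_mono)
      have L: "log_gauge ?s > 0" using log_gauge_ge_1[of ?s] by simp
      have "1 = log_gauge ?s powr (1 + \<epsilon>) / ?m * (?m * log_gauge ?s powr (- 1 - \<epsilon>))"
        using m L by (simp flip: powr_add)
      also have "\<dots> \<le> log_gauge ?s powr (1 + \<epsilon>) / ?m * radial_factor ?s"
        using m radial_factor_ge[of ?s] by (intro mult_left_mono) auto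
      also have "\<dots> \<le> (3 powr (1 + \<epsilon>) * log_growth \<epsilon> x) / ?m * radial_factor ?s"
        using m radial_factor_pos[of ?s] log_gauge_le[of x] by (intro mult_right_mono divide_right_mono) auto
      finally show "1 \<le> 3 powr (1 + \<epsilon>) / ?m * log_growth \<epsilon> x * radial_factor ?s" by simp
    qed (use \<epsilon> q in auto)
    finally show ?thesis by (simp add: det_to_ball' mult_ac)
  qed
  moreover have "?C \<ge> 0" using m \<epsilon> by simp
  ultimately show thesis using that by blast
qed

section \<open>The radial profile and its range\<close>

definition profile :: "real \<Rightarrow> real" where "profile r = shrink \<epsilon> (r\<^sup>2) * r"

lemma profile_has_derivative:
  "(profile has_real_derivative shrink \<epsilon> (r\<^sup>2) * radial_factor (r\<^sup>2)) (at r)"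
proof -
  have "((\<lambda>r. shrink \<epsilon> (r\<^sup>2)) has_real_derivative shrink' \<epsilon> (r\<^sup>2) * (2 * r)) (at r)"
    by (rule DERIV_chain2[OF shrink_has_derivative]) (auto intro!: derivative_eq_intros)
  from DERIV_mult[OF this DERIV_ident]
  have "(profile has_real_derivative shrink' \<epsilon> (r\<^sup>2) * (2 * r) * r + 1 * shrink \<epsilon> (r\<^sup>2)) (at r)"
    by (simp add: profile_def[abs_def])
  moreover have "shrink' \<epsilon> (r\<^sup>2) * (2 * r) * r + 1 * shrink \<epsilon> (r\<^sup>2) = shrink \<epsilon> (r\<^sup>2) * radial_factor (r\<^sup>2)"
  proof -
    have "q * d / (2 * t) * (2 * r) * r + 1 * q = q * (1 + d * r\<^sup>2 / t)" if "t > 0" for q d t :: real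
      using that by (simp add: field_simps power2_eq_square)
    from this[of "1 + r\<^sup>2"] show ?thesis
      by (simp only: radial_factor_eq[OF zero_le_power2] shrink'_def add_pos_nonneg[OF zero_less_one zero_le_power2])
  qed
  ultimately show ?thesis by simp
qed

lemma profile_strict_mono: "r < t \<Longrightarrow> profile r < profile t"
proof (rule DERIV_pos_imp_increasing[where f = profile])
  fix x :: real
  show "\<exists>y. (profile has_real_derivative y) (at x) \<and> y > 0"
    using profile_has_derivative[of x] shrink_pos[of "x\<^sup>2"] radial_factor_pos[of "x\<^sup>2"] by (auto intro!: exI)
qed

lemma profile_less_1: assumes "r \<ge> 0" shows "profile r < 1"
proof -
  let ?P = "log_gauge (r\<^sup>2) powr - \<epsilon>"
  have P: "0 < ?P" "?P \<le> 1" using log_gauge_powr[of "r\<^sup>2"] by auto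
  have r: "r < sqrt (1 + r\<^sup>2)" by (simp add: real_less_rsqrt)
  have "(2 - ?P) * r \<le> 2 * r" using P assms by (intro mult_right_mono) auto
  also have "\<dots> < 2 * sqrt (1 + r\<^sup>2)" using r by simp
  finally show ?thesis
    using r assms by (simp add: profile_def shrink_def divide_less_eq not_less add_nonneg_nonneg)
qed

text \<open>\<open>r / sqrt (1 + r\<^sup>2)\<close> is rewritten as a root whose limit is evident.
  The other factor tends to 1 because the gauge tends to infinity and \<epsilon> is
  positive.\<close>

lemma profile_tendsto: "(profile \<longlongrightarrow> 1) at_top"
proof -
  have sq: "filterlim (\<lambda>r::real. 1 + r\<^sup>2) at_top at_top"
    by (intro filterlim_tendsto_add_at_top[OF tendsto_const] filterlim_pow_at_top filterlim_ident) auto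
  have "filterlim (\<lambda>r::real. ln (1 + r\<^sup>2)) at_top at_top"
    by (rule filterlim_compose[OF ln_at_top sq])
  then have "filterlim (\<lambda>r::real. ln (1 + r\<^sup>2) * (1/2)) at_top at_top"
    by (rule filterlim_at_top_mult_tendsto_pos[OF tendsto_const, rotated]) auto
  then have "filterlim (\<lambda>r. log_gauge (r\<^sup>2)) at_top at_top"
    unfolding log_gauge_def by (intro filterlim_tendsto_add_at_top[OF tendsto_const]) simp
  then have 1: "((\<lambda>r. log_gauge (r\<^sup>2) powr - \<epsilon>) \<longlongrightarrow> 0) at_top"
    using \<epsilon> by (intro tendsto_neg_powr) auto
  have "((\<lambda>r::real. inverse (1 + r\<^sup>2)) \<longlongrightarrow> 0) at_top"
    by (rule filterlim_compose[OF tendsto_inverse_0_at_top[OF filterlim_ident] sq])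
  then have "((\<lambda>r::real. sqrt (1 - inverse (1 + r\<^sup>2))) \<longlongrightarrow> sqrt (1 - 0)) at_top"
    by (intro tendsto_intros)
  from tendsto_mult[OF this tendsto_divide[OF tendsto_diff[OF tendsto_const[of 2] 1] tendsto_const[of 2]]]
  have lim: "((\<lambda>r. sqrt (1 - inverse (1 + r\<^sup>2)) * ((2 - log_gauge (r\<^sup>2) powr - \<epsilon>) / 2)) \<longlongrightarrow> 1) at_top" by simp
  have "\<forall>\<^sub>F r in at_top. sqrt (1 - inverse (1 + r\<^sup>2)) * ((2 - log_gauge (r\<^sup>2) powr - \<epsilon>) / 2) = profile r"
    using eventually_ge_at_top[of 0]
  proof eventually_elim
    case (elim r)
    have "1 + r\<^sup>2 > 0" by (simp add: add_pos_nonneg)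
    then have "1 - inverse (1 + r\<^sup>2) = r\<^sup>2 / (1 + r\<^sup>2)" by (simp add: field_simps)
    then have "sqrt (1 - inverse (1 + r\<^sup>2)) = r / sqrt (1 + r\<^sup>2)" using elim by (simp add: real_sqrt_divide)
    then show ?case by (simp add: profile_def shrink_def mult_ac)
  qed
  then show ?thesis using lim by (rule Lim_transform_eventually[rotated])
qed

lemma norm_to_ball: "norm (to_ball \<epsilon> R x) = R * profile (norm x)"
  using R shrink_pos[of "x \<bullet> x"] by (simp add: to_ball_def profile_def power2_norm_eq_inner)

lemma to_ball_inj: "inj (to_ball \<epsilon> R)"
proof
  fix x y :: "real^'n" assume eq: "to_ball \<epsilon> R x = to_ball \<epsilon> R y"
  then have "R * profile (norm x) = R * profile (norm y)" by (metis norm_to_ball)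
  then have "norm x = norm y"
    using R profile_strict_mono by (metis less_irrefl linorder_neqE_linordered_idom mult_left_cancel)
  then have "x \<bullet> x = y \<bullet> y" by (simp add: power2_norm_eq_inner[symmetric])
  then show "x = y" using eq R shrink_pos[of "y \<bullet> y"] by (simp add: to_ball_def)
qed

lemma range_to_ball: "range (to_ball \<epsilon> R) = (ball 0 R :: (real^'n) set)"
proof
  show "range (to_ball \<epsilon> R) \<subseteq> (ball 0 R :: (real^'n) set)"
    using R profile_less_1 by (auto simp: norm_to_ball)
  show "ball 0 R \<subseteq> range (to_ball \<epsilon> R :: real^'n \<Rightarrow> real^'n)"
  proof
    fix y :: "real^'n" assume "y \<in> ball 0 R"
    then have y: "norm y / R < 1" using R by simp
    show "y \<in> range (to_ball \<epsilon> R)"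
    proof (cases "y = 0")
      case True then show ?thesis by (auto simp: to_ball_def intro!: image_eqI[of _ _ 0])
    next
      case False
      have "\<forall>\<^sub>F r in at_top. norm y / R < profile r \<and> r \<ge> 0"
        using order_tendstoD(1)[OF profile_tendsto y] eventually_ge_at_top[of 0] by eventually_elim auto
      then obtain t where t: "norm y / R < profile t" "t \<ge> 0"
        by (metis (mono_tags, lifting) eventually_at_top_linorder order_refl)
      have "\<exists>r\<ge>0. r \<le> t \<and> profile r = norm y / R"
      proof (rule IVT')
        show "profile 0 \<le> norm y / R" using R by (simp add: profile_def)
        show "continuous_on {0..t} profile"
          by (meson DERIV_isCont continuous_at_imp_continuous_on profile_has_derivative)
      qed (use t in auto)
      then obtain r where r: "r \<ge> 0" "profile r = norm y / R" by blast
      let ?x = "(r / norm y) *\<^sub>R y"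
      have "?x \<bullet> ?x = r\<^sup>2" using False by (simp add: power2_norm_eq_inner[symmetric] power_divide power2_eq_square)
      then have "to_ball \<epsilon> R ?x = (R * profile r / norm y) *\<^sub>R y" by (simp add: to_ball_def profile_def)
      also have "\<dots> = y" using r R False by simp
      finally show ?thesis by (metis rangeI)
    qed
  qed
qed

lemma to_ball_nth: "to_ball \<epsilon> R x $ b = 0 \<longleftrightarrow> x $ b = 0"
  using R shrink_pos[of "x \<bullet> x"] by (simp add: to_ball_def)

end

section \<open>Locally Lipschitz maps and weak differentials\<close>

text \<open>The regularity that survives on the branch set. It is stable under composition and, by
  compactness, yields a Lipschitz constant on every ball.\<close>

definition lipschitz_near :: "('a::metric_space \<Rightarrow> 'b::metric_space) \<Rightarrow> 'a \<Rightarrow> bool" where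
  "lipschitz_near f x \<longleftrightarrow> (\<exists>u>0. \<exists>L. L-lipschitz_on (cball x u) f)"

lemma lipschitz_near_cong:
  assumes "lipschitz_near f x" "open U" "x \<in> U" "\<And>z. z \<in> U \<Longrightarrow> f z = g z"
  shows "lipschitz_near g x"
proof -
  obtain u L where u: "u > 0" "L-lipschitz_on (cball x u) f" using assms(1) by (auto simp: lipschitz_near_def)
  obtain v where v: "v > 0" "cball x v \<subseteq> U" using assms(2,3) open_contains_cball by blast
  have "L-lipschitz_on (cball x (min u v)) f" using u(2) by (rule lipschitz_on_subset) auto
  then have "L-lipschitz_on (cball x (min u v)) g"
    by (rule lipschitz_on_transform) (use v assms(4) in auto)
  then show ?thesis using u(1) v(1) unfolding lipschitz_near_def by (metis min_less_iff_conj)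
qed

lemma lipschitz_near_compose:
  assumes f: "lipschitz_near f x" and g: "lipschitz_near g (f x)"
  shows "lipschitz_near (\<lambda>x. g (f x)) x"
proof -
  obtain u L where u: "u > 0" "L-lipschitz_on (cball x u) f" using f by (auto simp: lipschitz_near_def)
  obtain v K where v: "v > 0" "K-lipschitz_on (cball (f x) v) g" using g by (auto simp: lipschitz_near_def)
  \<comment> \<open>The denominator is \<open>L + 1\<close> because for \<open>L = 0\<close> a
    quotient by \<open>L\<close> would evaluate to 0 and leave no radius.\<close>
  define w where "w = min u (v / (L + 1))"
  have L: "L \<ge> 0" using u(2) lipschitz_on_nonneg by blast
  have w: "w > 0" "w \<le> u" "L * w \<le> v"
  proof -
    show "w > 0" "w \<le> u" using u(1) v(1) L by (auto simp: w_def)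
    have "L * w \<le> L * (v / (L + 1))" unfolding w_def using L by (intro mult_left_mono) auto
    also have "\<dots> \<le> v" using L v(1) by (simp add: field_simps)
    finally show "L * w \<le> v" .
  qed
  have 1: "L-lipschitz_on (cball x w) f" using u(2) by (rule lipschitz_on_subset) (use w in auto)
  have "f ` cball x w \<subseteq> cball (f x) v"
  proof clarify
    fix z assume z: "z \<in> cball x w"
    have "dist (f x) (f z) \<le> L * dist x z" using lipschitz_onD[OF 1, of x z] z w by auto
    also have "\<dots> \<le> L * w" using z L by (intro mult_left_mono) auto
    finally show "f z \<in> cball (f x) v" using w by simp
  qed
  then have "K-lipschitz_on (f ` cball x w) g" using v(2) by (rule lipschitz_on_subset[rotated])
  from lipschitz_on_compose[OF 1 this] show ?thesis
    using w(1) by (auto simp: lipschitz_near_def o_def)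
qed

text \<open>Local Lipschitz bounds combine on compact sets. The fact used is about families indexed
  by time, so the map is taken as a family over the single time 0.\<close>

lemma lipschitz_near_imp_lipschitz_on_cball:
  fixes f :: "'a::heine_borel \<Rightarrow> 'b::metric_space"
  assumes "\<And>x. lipschitz_near f x"
  shows "\<exists>L. L-lipschitz_on (cball c r) f"
proof -
  have "local_lipschitz {0::real} (cball c r) (\<lambda>_. f)"
  proof (rule local_lipschitzI)
    fix x
    obtain u L where "u > 0" "L-lipschitz_on (cball x u) f" using assms[of x] by (auto simp: lipschitz_near_def)
    then have "L-lipschitz_on (cball x u \<inter> cball c r) f" by (meson inf_le1 lipschitz_on_subset)
    then show "\<exists>u>0. \<exists>L. \<forall>t\<in>cball t u \<inter> {0}. L-lipschitz_on (cball x u \<inter> cball c r) f" for t :: real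
      using \<open>u > 0\<close> by blast
  qed
  from local_lipschitz_compact_implies_lipschitz[OF this] show ?thesis by auto
qed

lemma C1_deriv_lipschitz_near:
  assumes f: "C1_deriv U f M" and x: "x \<in> U"
  shows "lipschitz_near f x"
proof -
  have U: "open U" "continuous_on U M" "\<And>z. z \<in> U \<Longrightarrow> (f has_derivative (*v) (M z)) (at z)"
    using f by (auto simp: C1_deriv_def)
  obtain u where u: "u > 0" "cball x u \<subseteq> U" using U(1) x open_contains_cball by blast
  let ?S = "\<lambda>z. \<Sum>i\<in>UNIV. \<Sum>j\<in>UNIV. \<bar>M z $ i $ j\<bar>"
  have "continuous_on (cball x u) ?S"
    by (intro continuous_intros continuous_on_subset[OF U(2) u(2)])
  then have "bounded (?S ` cball x u)" by (intro compact_imp_bounded compact_continuous_image) auto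
  then obtain C where "\<forall>y\<in>?S ` cball x u. norm y \<le> C" unfolding bounded_iff by blast
  then have C: "\<bar>?S z\<bar> \<le> C" if "z \<in> cball x u" for z using that by (metis imageI real_norm_def)
  have "C-lipschitz_on (cball x u) f"
  proof (rule bounded_derivative_imp_lipschitz)
    show "(f has_derivative (*v) (M z)) (at z within cball x u)" if "z \<in> cball x u" for z
      using that u(2) U(3) has_derivative_at_withinI by blast
    show "onorm ((*v) (M z)) \<le> C" if "z \<in> cball x u" for z
      using onorm_le_matrix_component_sum[of "M z"] C[OF that] by linarith
    show "C \<ge> 0" using C[of x] u(1) by (meson abs_ge_zero centre_in_cball less_imp_le order_trans)
  qed simp
  then show ?thesis using u(1) by (auto simp: lipschitz_near_def)
qed

lemma locally_integrableI:
  fixes f :: "real^'n \<Rightarrow> 'b::euclidean_space"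
  assumes f: "f \<in> borel_measurable borel" and bd: "\<And>r. bounded (f ` cball 0 r)"
  shows "locally_integrable f"
  unfolding locally_integrable_def
proof (intro allI impI)
  fix K :: "(real^'n) set" assume K: "compact K"
  obtain r where "\<forall>x\<in>K. norm x \<le> r" using compact_imp_bounded[OF K] unfolding bounded_iff by blast
  then have r: "K \<subseteq> cball 0 r" by auto
  obtain B where "\<forall>y\<in>f ` cball 0 r. norm y \<le> B" using bd[of r] unfolding bounded_iff by blast
  then have B: "norm (f x) \<le> B" if "x \<in> cball 0 r" for x using that by blast
  have Kl: "K \<in> lmeasurable" using K by (rule lmeasurable_compact)
  show "f absolutely_integrable_on K"
  proof (rule measurable_bounded_by_integrable_imp_absolutely_integrable)
    show "f \<in> borel_measurable (lebesgue_on K)"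
      using f by (intro measurable_restrict_space1 measurable_completion) simp
    show "(\<lambda>_. B) integrable_on K" using Kl by (rule integrable_on_const)
  qed (use Kl B r in \<open>auto simp: fmeasurableD\<close>)
qed

section \<open>Integration by parts for Lipschitz maps\<close>

lemma difference_quotient_tendsto:
  fixes g :: "'a::real_normed_vector \<Rightarrow> real"
  assumes "(g has_derivative g') (at x)"
  shows "((\<lambda>t. (g (x + t *\<^sub>R v) - g x) / t) \<longlongrightarrow> g' v) (at 0)"
proof -
  have "((\<lambda>t::real. x + t *\<^sub>R v) has_derivative (\<lambda>t. t *\<^sub>R v)) (at 0)"
    by (auto intro!: derivative_eq_intros)
  from diff_chain_at[OF this, of g g'] assms
  have "((\<lambda>t. g (x + t *\<^sub>R v)) has_derivative (\<lambda>t. g' (t *\<^sub>R v))) (at 0)" by (simp add: o_def)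
  moreover have "g' (t *\<^sub>R v) = g' v * t" for t
    using has_derivative_linear[OF assms] by (simp add: linear_scale)
  ultimately have "((\<lambda>t. g (x + t *\<^sub>R v)) has_real_derivative g' v) (at 0)"
    by (simp add: has_field_derivative_def)
  then show ?thesis by (simp add: DERIV_def)
qed

lemma lipschitz_derivative_le:
  fixes g :: "'a::real_normed_vector \<Rightarrow> real"
  assumes d: "(g has_derivative g') (at x)" and U: "open U" "x \<in> U" and L: "L-lipschitz_on U g"
  shows "\<bar>g' v\<bar> \<le> L * norm v"
proof -
  obtain u where u: "u > 0" "ball x u \<subseteq> U" using U open_contains_ball by blast
  have "\<forall>\<^sub>F t in at 0. \<bar>t\<bar> * norm v < u"
    by (rule order_tendstoD) (auto intro!: tendsto_eq_intros u(1))
  then have "\<forall>\<^sub>F t in at (0::real). norm ((g (x + t *\<^sub>R v) - g x) / t) \<le> L * norm v"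
    using eventually_neq_at_within[of 0 0 UNIV]
  proof eventually_elim
    case (elim t)
    then have "x + t *\<^sub>R v \<in> ball x u" by (simp add: dist_norm)
    then have "dist (g (x + t *\<^sub>R v)) (g x) \<le> L * dist (x + t *\<^sub>R v) x"
      using lipschitz_onD[OF L] u(2) U(2) by blast
    then show ?case using elim by (simp add: dist_norm divide_le_eq mult_ac)
  qed
  then have "norm (g' v) \<le> L * norm v"
    by (rule tendsto_upperbound[OF tendsto_norm[OF difference_quotient_tendsto[OF d]]]) simp
  then show ?thesis by simp
qed

lemma lborel_integral_shift:
  fixes g :: "'a::euclidean_space \<Rightarrow> real"
  assumes "g \<in> borel_measurable borel"
  shows "integral\<^sup>L lborel (\<lambda>x. g (x + c)) = integral\<^sup>L lborel g"
proof -
  have "integral\<^sup>L lborel g = integral\<^sup>L (distr lborel borel ((+) c)) g" by (simp add: lborel_distr_plus)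
  also have "\<dots> = integral\<^sup>L lborel (\<lambda>x. g (c + x))" using assms by (intro integral_distr) auto
  finally show ?thesis by (simp add: add.commute)
qed

lemma lborel_integrable_indicator_cball:
  "integrable lborel (\<lambda>x::'a::euclidean_space. B * indicator (cball 0 r) x :: real)"
  using emeasure_bounded_finite[OF bounded_cball, of "0::'a" r]
  by (intro integrable_mult_right integrable_real_indicator) auto

lemma lborel_integrable_bounded_support:
  fixes g :: "'a::euclidean_space \<Rightarrow> real"
  assumes g: "g \<in> borel_measurable borel" and B: "\<And>x. \<bar>g x\<bar> \<le> B * indicator (cball 0 r) x"
  shows "integrable lborel g"
proof (rule Bochner_Integration.integrable_bound)
  show "integrable lborel (\<lambda>x. B * indicator (cball 0 r) x :: real)"
    by (rule lborel_integrable_indicator_cball)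
qed (use g order_trans[OF B abs_ge_self] in auto)

text \<open>Difference quotients have integral zero by translation invariance, and the Lipschitz
  constant dominates them on a fixed ball, so the integral passes to the limit. This takes the place
  of Fubini and absolute continuity on lines.\<close>

lemma lipschitz_integral_derivative_zero:
  fixes g :: "'a::euclidean_space \<Rightarrow> real"
  assumes lip: "L-lipschitz_on UNIV g" and supp: "\<And>x. x \<notin> cball 0 r \<Longrightarrow> g x = 0"
    and v: "norm v = 1" and D: "D \<in> borel_measurable borel"
    and lim: "AE x in lborel. ((\<lambda>t. (g (x + t *\<^sub>R v) - g x) / t) \<longlongrightarrow> D x) (at 0)"
  shows "integral\<^sup>L lborel D = 0"
proof -
  have cont: "continuous_on UNIV g" using lip by (rule lipschitz_on_continuous_on)
  then have gm: "g \<in> borel_measurable borel" by (rule borel_measurable_continuous_onI)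
  have "bounded (g ` cball 0 r)"
    by (intro compact_imp_bounded compact_continuous_image continuous_on_subset[OF cont]) auto
  then obtain B where "\<forall>y\<in>g ` cball 0 r. norm y \<le> B" unfolding bounded_iff by blast
  then have B: "\<bar>g x\<bar> \<le> B" if "x \<in> cball 0 r" for x using that by (metis imageI real_norm_def)
  have "\<bar>g x\<bar> \<le> B * indicator (cball 0 r) x" for x using B[of x] supp[of x] by (auto simp: indicator_def)
  from lborel_integrable_bounded_support[OF gm this] have gi: "integrable lborel g" .
  define t where "t k = inverse (real (Suc k))" for k
  have t: "t k > 0" "t k \<le> 1" for k by (auto simp: t_def field_simps)
  define q where "q k x = (g (x + t k *\<^sub>R v) - g x) / t k" for k x
  have shift: "(\<lambda>x. g (x + t k *\<^sub>R v)) \<in> borel_measurable borel" for k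
    by (intro borel_measurable_continuous_onI continuous_on_compose2[OF cont] continuous_intros) auto
  have qm: "q k \<in> borel_measurable borel" for k
    unfolding q_def using shift[of k] gm by measurable
  have "integral\<^sup>L lborel (q k) = 0" for k
  proof -
    have "integrable lborel (\<lambda>x. g (x + t k *\<^sub>R v))"
    proof (rule lborel_integrable_bounded_support[OF shift])
      show "\<bar>g (x + t k *\<^sub>R v)\<bar> \<le> \<bar>B\<bar> * indicator (cball 0 (r + 1)) x" for x
      proof (cases "x + t k *\<^sub>R v \<in> cball 0 r")
        case True
        have "norm x \<le> norm (x + t k *\<^sub>R v) + norm (t k *\<^sub>R v)" by (metis add_diff_cancel_right' norm_triangle_ineq4)
        also have "\<dots> \<le> r + 1" using True t[of k] v by (intro add_mono) auto
        finally show ?thesis using B[OF True] by simp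
      qed (simp add: supp)
    qed
    then show ?thesis
      unfolding q_def using gi lborel_integral_shift[OF gm, of "t k *\<^sub>R v"] by simp
  qed
  moreover have "(\<lambda>k. integral\<^sup>L lborel (q k)) \<longlonglongrightarrow> integral\<^sup>L lborel D"
  proof (rule integral_dominated_convergence)
    \<comment> \<open>The steps \<open>t k\<close> are at most 1, so all quotients vanish outside
      the ball of radius \<open>r + 1\<close>.\<close>
    show "integrable lborel (\<lambda>x. L * indicator (cball 0 (r + 1)) x :: real)"
      by (rule lborel_integrable_indicator_cball)
    have "t \<longlonglongrightarrow> 0" unfolding t_def by (rule LIMSEQ_inverse_real_of_nat)
    then have tf: "filterlim t (at 0) sequentially"
      using t by (auto simp: filterlim_at less_imp_neq[symmetric])
    show "AE x in lborel. (\<lambda>k. q k x) \<longlonglongrightarrow> D x"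
      using lim by eventually_elim (unfold q_def, erule filterlim_compose[OF _ tf])
    show "AE x in lborel. norm (q k x) \<le> L * indicator (cball 0 (r + 1)) x" for k
    proof (rule AE_I2)
      fix x
      have "\<bar>g (x + t k *\<^sub>R v) - g x\<bar> \<le> L * t k"
        using lipschitz_onD[OF lip, of "x + t k *\<^sub>R v" x] t[of k] v by (simp add: dist_norm)
      then have le: "norm (q k x) \<le> L" using t[of k] by (simp add: q_def divide_le_eq)
      show "norm (q k x) \<le> L * indicator (cball 0 (r + 1)) x"
      proof (cases "x \<in> cball 0 (r + 1)")
        case False
        have "norm x \<le> norm (x + t k *\<^sub>R v) + norm (t k *\<^sub>R v)" by (metis add_diff_cancel_right' norm_triangle_ineq4)
        then have "x \<notin> cball 0 r" "x + t k *\<^sub>R v \<notin> cball 0 r" using False t[of k] v by auto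
        then show ?thesis using supp False by (simp add: q_def)
      qed (use le in simp)
    qed
  qed (use qm D in auto)
  ultimately show ?thesis by (simp add: LIMSEQ_const_iff)
qed

text \<open>The gap of width 1 around the support separates two cases. Within it the local constant
  applies; across it the values differ by at most \<open>B\<close>, which is at most
  \<open>B\<close> times the distance.\<close>

lemma lipschitz_on_UNIV_of_support:
  fixes g :: "'a::real_normed_vector \<Rightarrow> real"
  assumes L: "L-lipschitz_on (cball 0 (r + 1)) g" and B: "\<And>x. \<bar>g x\<bar> \<le> B"
    and supp: "\<And>x. x \<notin> cball 0 r \<Longrightarrow> g x = 0"
  shows "(L + B)-lipschitz_on UNIV g"
proof (rule lipschitz_onI)
  have L0: "L \<ge> 0" using L lipschitz_on_nonneg by blast
  have B0: "B \<ge> 0" using B[of 0] by linarith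
  show "L + B \<ge> 0" using L0 B0 by simp
  have *: "dist (g x) (g y) \<le> (L + B) * dist x y" if "x \<in> cball 0 r" for x y
  proof (cases "y \<in> cball 0 (r + 1)")
    case True
    have "dist (g x) (g y) \<le> L * dist x y" using that True by (intro lipschitz_onD[OF L]) auto
    also have "\<dots> \<le> (L + B) * dist x y" using B0 by (intro mult_right_mono) auto
    finally show ?thesis .
  next
    case False
    have "norm y \<le> norm x + dist x y" by (metis dist_commute dist_norm norm_triangle_sub)
    then have 1: "1 \<le> dist x y" using False that by simp
    have "dist (g x) (g y) \<le> B" using B[of x] supp[of y] False by (simp add: dist_norm)
    also have "\<dots> \<le> B * dist x y" using mult_left_mono[OF 1 B0] by simp
    also have "\<dots> \<le> (L + B) * dist x y" using L0 by (intro mult_right_mono) auto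
    finally show ?thesis .
  qed
  show "dist (g x) (g y) \<le> (L + B) * dist x y" for x y
  proof (cases "x \<in> cball 0 r \<or> y \<in> cball 0 r")
    case True then show ?thesis using *[of x y] *[of y x] by (auto simp: dist_commute)
  next
    case False then show ?thesis using supp L0 B0 by simp
  qed
qed

lemma lipschitz_on_times:
  fixes f g :: "'a::metric_space \<Rightarrow> real"
  assumes f: "L-lipschitz_on S f" "\<And>x. x \<in> S \<Longrightarrow> \<bar>f x\<bar> \<le> B"
    and g: "K-lipschitz_on S g" "\<And>x. x \<in> S \<Longrightarrow> \<bar>g x\<bar> \<le> C" and BC: "B \<ge> 0" "C \<ge> 0"
  shows "(B * K + C * L)-lipschitz_on S (\<lambda>x. f x * g x)"
proof (rule lipschitz_onI)
  show "B * K + C * L \<ge> 0" using f g BC lipschitz_on_nonneg by (metis add_nonneg_nonneg mult_nonneg_nonneg)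
  fix x y assume xy: "x \<in> S" "y \<in> S"
  have "f x * g x - f y * g y = f x * (g x - g y) + g y * (f x - f y)" by (simp add: algebra_simps)
  then have "\<bar>f x * g x - f y * g y\<bar> \<le> \<bar>f x\<bar> * \<bar>g x - g y\<bar> + \<bar>g y\<bar> * \<bar>f x - f y\<bar>"
    by (metis abs_mult abs_triangle_ineq)
  also have "\<dots> \<le> B * (K * dist x y) + C * (L * dist x y)"
    using f(2)[OF xy(1)] g(2)[OF xy(2)] lipschitz_onD[OF f(1) xy] lipschitz_onD[OF g(1) xy] BC
    by (intro add_mono mult_mono) (auto simp: dist_norm)
  finally show "dist (f x * g x) (f y * g y) \<le> (B * K + C * L) * dist x y"
    by (simp add: dist_norm algebra_simps)
qed

lemma lipschitz_on_vec_nth: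
  fixes f :: "'a::metric_space \<Rightarrow> real^'n"
  assumes "L-lipschitz_on S f"
  shows "L-lipschitz_on S (\<lambda>x. f x $ i)"
proof (rule lipschitz_onI)
  fix x y assume "x \<in> S" "y \<in> S"
  have "dist (f x $ i) (f y $ i) \<le> dist (f x) (f y)" by (rule dist_vec_nth_le)
  also have "\<dots> \<le> L * dist x y" by (rule lipschitz_onD[OF assms]) fact+
  finally show "dist (f x $ i) (f y $ i) \<le> L * dist x y" .
qed (rule lipschitz_on_nonneg[OF assms])

lemma continuous_on_cball_abs_bound:
  fixes g :: "'a::heine_borel \<Rightarrow> real"
  assumes "continuous_on UNIV g"
  obtains B where "B \<ge> 0" "\<And>x. x \<in> cball c r \<Longrightarrow> \<bar>g x\<bar> \<le> B"
proof -
  have "bounded (g ` cball c r)"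
    by (intro compact_imp_bounded compact_continuous_image continuous_on_subset[OF assms]) auto
  then obtain B where "\<forall>y\<in>g ` cball c r. norm y \<le> B" unfolding bounded_iff by blast
  then have "\<bar>g x\<bar> \<le> \<bar>B\<bar>" if "x \<in> cball c r" for x
    using that by (metis abs_ge_self imageI order_trans real_norm_def)
  then show thesis using that[of "\<bar>B\<bar>"] by auto
qed

lemma C1_real_lipschitz_on_cball:
  fixes \<phi> :: "real^'n \<Rightarrow> real"
  assumes d: "\<phi> differentiable_on UNIV" and c: "\<And>v. continuous_on UNIV (\<lambda>x. frechet_derivative \<phi> (at x) v)"
  obtains L where "L-lipschitz_on (cball 0 r) \<phi>"
proof -
  let ?d = "\<lambda>x. frechet_derivative \<phi> (at x)"
  have der: "(\<phi> has_derivative ?d x) (at x)" for x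
    using d by (simp add: differentiable_on_def frechet_derivative_works)
  let ?S = "\<lambda>x. \<Sum>j\<in>UNIV. \<bar>?d x (axis j 1)\<bar>"
  have "continuous_on UNIV ?S" by (intro continuous_intros c)
  then obtain B where B: "B \<ge> 0" "\<And>x. x \<in> cball 0 r \<Longrightarrow> \<bar>?S x\<bar> \<le> B"
    by (rule continuous_on_cball_abs_bound) blast
  have "B-lipschitz_on (cball 0 r) \<phi>"
  proof (rule bounded_derivative_imp_lipschitz)
    show "(\<phi> has_derivative ?d x) (at x within cball 0 r)" for x using der has_derivative_at_withinI by blast
    show "onorm (?d x) \<le> B" if x: "x \<in> cball 0 r" for x
    proof (rule onorm_bound)
      fix v :: "real^'n"
      have lin: "linear (?d x)" using der has_derivative_linear by blast
      have "v = (\<Sum>j\<in>UNIV. v $ j *\<^sub>R axis j 1)" using basis_expansion[of v] by (simp add: scalar_mult_eq_scaleR)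
      then have "?d x v = ?d x (\<Sum>j\<in>UNIV. v $ j *\<^sub>R axis j 1)" by (rule arg_cong)
      also have "\<dots> = (\<Sum>j\<in>UNIV. v $ j * ?d x (axis j 1))"
        unfolding linear_sum[OF lin] by (simp add: linear_scale[OF lin])
      finally have "\<bar>?d x v\<bar> = \<bar>\<Sum>j\<in>UNIV. v $ j * ?d x (axis j 1)\<bar>" by simp
      also have "\<dots> \<le> (\<Sum>j\<in>UNIV. norm v * \<bar>?d x (axis j 1)\<bar>)"
        by (rule order_trans[OF sum_abs]) (auto intro!: sum_mono mult_right_mono simp: abs_mult component_le_norm_cart)
      also have "\<dots> = ?S x * norm v" by (simp add: sum_distrib_left mult.commute)
      also have "\<dots> \<le> B * norm v" using B(2)[OF x] by (intro mult_right_mono) auto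
      finally show "norm (?d x v) \<le> B * norm v" by simp
    qed (rule B)
  qed (use B in auto)
  then show thesis by (rule that)
qed

lemma AE_lborel_component_nonzero: "AE x :: real^'n in lborel. x $ b \<noteq> 0"
proof -
  have "negligible {x :: real^'n. x $ b = 0}" by (rule negligible_standard_hyperplane_cart)
  then have "AE x :: real^'n in lebesgue. x $ b \<noteq> 0"
    by (intro AE_I'[of "{x. x $ b = 0}"]) (auto simp: negligible_iff_null_sets)
  then show ?thesis by (simp add: AE_completion_iff)
qed

lemma norm_matrix_le:
  fixes A :: "real^'n^'m"
  assumes "\<And>i j. \<bar>A $ i $ j\<bar> \<le> L"
  shows "norm A \<le> real CARD('m) * (real CARD('n) * L)"
proof -
  have "norm A \<le> (\<Sum>i\<in>UNIV. norm (A $ i))" unfolding norm_vec_def by (rule L2_set_le_sum) simp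
  also have "\<dots> \<le> (\<Sum>i\<in>(UNIV::'m set). real CARD('n) * L)"
  proof (rule sum_mono)
    fix i
    have "norm (A $ i) \<le> (\<Sum>j\<in>UNIV. \<bar>A $ i $ j\<bar>)" by (rule norm_le_l1_cart)
    also have "\<dots> \<le> (\<Sum>j\<in>(UNIV::'n set). L)" by (rule sum_mono) (rule assms)
    finally show "norm (A $ i) \<le> real CARD('n) * L" by simp
  qed
  finally show ?thesis by simp
qed

text \<open>The setting of the final map: Lipschitz on every ball, differentiable off a hyperplane,
  which is a null set. The value 0 on the hyperplane keeps \<open>D\<close> bounded on
  balls.\<close>

context
  fixes f :: "real^'n \<Rightarrow> real^'n" and D :: "real^'n \<Rightarrow> real^'n^'n" and b :: 'n
  assumes lip: "\<And>r. \<exists>L. L-lipschitz_on (cball 0 r) f"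
    and Dm: "D \<in> borel_measurable borel"
    and der: "\<And>x. x $ b \<noteq> 0 \<Longrightarrow> (f has_derivative (*v) (D x)) (at x)"
    and D0: "\<And>x. x $ b = 0 \<Longrightarrow> D x = 0"
begin

lemma component_has_derivative:
  "x $ b \<noteq> 0 \<Longrightarrow> ((\<lambda>x. f x $ i) has_derivative (\<lambda>v. (D x *v v) $ i)) (at x)"
  by (rule bounded_linear.has_derivative[OF bounded_linear_vec_nth der])

lemma differential_entry_bound:
  obtains L where "L \<ge> 0" "\<And>x i j. x \<in> cball 0 r \<Longrightarrow> \<bar>D x $ i $ j\<bar> \<le> L"
proof -
  obtain L where L: "L-lipschitz_on (cball 0 (r + 1)) f" using lip by blast
  have L0: "L \<ge> 0" by (rule lipschitz_on_nonneg[OF L])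
  have "\<bar>D x $ i $ j\<bar> \<le> L" if x: "x \<in> cball 0 r" for x i j
  proof (cases "x $ b = 0")
    case False
    have "L-lipschitz_on (ball 0 (r + 1)) (\<lambda>x. f x $ i)"
      using lipschitz_on_vec_nth[OF L] by (rule lipschitz_on_subset) auto
    from lipschitz_derivative_le[OF component_has_derivative[OF False] open_ball _ this, of "axis j 1"]
    show ?thesis using x by (simp add: matrix_vector_mult_basis column_def)
  qed (use L0 D0 in simp)
  then show thesis using that L0 by blast
qed

lemma differential_bounded: "bounded (D ` cball 0 r)"
proof -
  obtain L where L: "L \<ge> 0" "\<And>x i j. x \<in> cball 0 r \<Longrightarrow> \<bar>D x $ i $ j\<bar> \<le> L"
    by (rule differential_entry_bound) blast
  show ?thesis unfolding bounded_iff using norm_matrix_le[OF L(2)] by blast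
qed

lemma locally_integrable_det: "locally_integrable (\<lambda>x. det (D x))"
proof (rule locally_integrableI)
  have "continuous_on UNIV (det :: real^'n^'n \<Rightarrow> real)" by (rule continuous_on_det[OF continuous_on_id])
  from borel_measurable_continuous_onI[OF this] Dm
  show "(\<lambda>x. det (D x)) \<in> borel_measurable borel" by measurable
  fix r
  have "compact (closure (D ` cball 0 r))" using differential_bounded by (simp add: compact_closure)
  then have "compact (det ` closure (D ` cball 0 r))"
    using continuous_on_det[OF continuous_on_id] by (intro compact_continuous_image)
  then have "bounded (det ` closure (D ` cball 0 r))" by (rule compact_imp_bounded)
  then show "bounded ((\<lambda>x. det (D x)) ` cball 0 r)"
    by (rule bounded_subset) (use closure_subset[of "D ` cball 0 r"] in auto)
qed

lemma map_continuous: "continuous_on UNIV f"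
proof (rule continuous_at_imp_continuous_on, rule ballI)
  fix x :: "real^'n"
  obtain L where "L-lipschitz_on (cball 0 (norm x + 1)) f" using lip by blast
  then have "continuous_on (cball 0 (norm x + 1)) f" by (rule lipschitz_on_continuous_on)
  then have "continuous_on (ball 0 (norm x + 1)) f" by (rule continuous_on_subset) auto
  then show "isCont f x" by (rule continuous_on_interior[of "ball 0 (norm x + 1)"]) auto
qed

text \<open>A component times a test function is globally Lipschitz with bounded support, so its
  partial derivative integrates to zero. The product rule splits that integral into the two
  sides.\<close>

lemma integration_by_parts:
  assumes \<phi>: "test_function \<phi>"
  shows "(LINT x|lebesgue. f x $ i * frechet_derivative \<phi> (at x) (axis j 1)) =
         - (LINT x|lebesgue. D x $ i $ j * \<phi> x)"
proof -
  let ?v = "axis j 1 :: real^'n" and ?d = "\<lambda>x. frechet_derivative \<phi> (at x)"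
  have "C_k (Suc 0) \<phi>" using \<phi> unfolding test_function_def by blast
  then have d: "\<phi> differentiable_on UNIV" and cd: "\<And>v. continuous_on UNIV (\<lambda>x. ?d x v)" by auto
  have der\<phi>: "(\<phi> has_derivative ?d x) (at x)" for x
    using d by (simp add: differentiable_on_def frechet_derivative_works)
  have c\<phi>: "continuous_on UNIV \<phi>" using d by (rule differentiable_imp_continuous_on)
  have "bounded (closure {x. \<phi> x \<noteq> 0})" using \<phi> unfolding test_function_def by (blast intro: compact_imp_bounded)
  then obtain r where "\<forall>x\<in>closure {x. \<phi> x \<noteq> 0}. norm x \<le> r" unfolding bounded_iff by blast
  then have supp: "\<phi> x = 0" if "x \<notin> cball 0 r" for x
    using that closure_subset[of "{x. \<phi> x \<noteq> 0}"] by fastforce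
  have dsupp: "?d x v = 0" if "x \<notin> cball 0 r" for x v
  proof -
    have "((\<lambda>_. 0) has_derivative (\<lambda>_. 0)) (at x)" by simp
    then have "(\<phi> has_derivative (\<lambda>_. 0)) (at x)"
      by (rule has_derivative_transform_within_open[of _ _ _ _ "- cball 0 r"]) (use that supp in auto)
    then show ?thesis using has_derivative_unique[OF der\<phi>] by metis
  qed
  have cf: "continuous_on UNIV (\<lambda>x. f x $ i)" by (intro continuous_intros map_continuous)
  obtain B where B: "B \<ge> 0" "\<And>x. x \<in> cball 0 (r + 1) \<Longrightarrow> \<bar>f x $ i\<bar> \<le> B"
    using cf by (rule continuous_on_cball_abs_bound) blast
  obtain C where C: "C \<ge> 0" "\<And>x. x \<in> cball 0 (r + 1) \<Longrightarrow> \<bar>\<phi> x\<bar> \<le> C"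
    using c\<phi> by (rule continuous_on_cball_abs_bound) blast
  obtain E where E: "E \<ge> 0" "\<And>x. x \<in> cball 0 (r + 1) \<Longrightarrow> \<bar>?d x ?v\<bar> \<le> E"
    using cd by (rule continuous_on_cball_abs_bound) blast
  obtain N where N: "N \<ge> 0" "\<And>x i j. x \<in> cball 0 r \<Longrightarrow> \<bar>D x $ i $ j\<bar> \<le> N"
    by (rule differential_entry_bound) blast
  define g where "g x = f x $ i * \<phi> x" for x
  define F1 F2 where "F1 x = f x $ i * ?d x ?v" and "F2 x = D x $ i $ j * \<phi> x" for x
  obtain L where L: "L-lipschitz_on (cball 0 (r + 1)) f" using lip by blast
  obtain K where K: "K-lipschitz_on (cball 0 (r + 1)) \<phi>" using d cd by (rule C1_real_lipschitz_on_cball) blast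
  have "(B * K + C * L)-lipschitz_on (cball 0 (r + 1)) g"
    unfolding g_def by (rule lipschitz_on_times[OF lipschitz_on_vec_nth[OF L] B(2) K C(2) B(1) C(1)])
  moreover have gb: "\<bar>g x\<bar> \<le> B * C" for x
  proof (cases "x \<in> cball 0 r")
    case True
    then have "x \<in> cball 0 (r + 1)" by auto
    then show ?thesis using B C unfolding g_def abs_mult by (intro mult_mono) auto
  qed (use B C supp in \<open>simp add: g_def\<close>)
  moreover have gs: "g x = 0" if "x \<notin> cball 0 r" for x using supp[OF that] by (simp add: g_def)
  ultimately have gl: "(B * K + C * L + B * C)-lipschitz_on UNIV g" by (rule lipschitz_on_UNIV_of_support)
  have m1: "F1 \<in> borel_measurable borel"
    unfolding F1_def by (intro borel_measurable_continuous_onI continuous_intros cf cd)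
  have "(\<lambda>A :: real^'n^'n. A $ i $ j) \<in> borel_measurable borel"
    by (intro borel_measurable_continuous_onI continuous_intros)
  then have m2: "F2 \<in> borel_measurable borel"
    unfolding F2_def using Dm borel_measurable_continuous_onI[OF c\<phi>] by measurable
  have i1: "integrable lborel F1"
  proof (rule lborel_integrable_bounded_support[OF m1])
    show "\<bar>F1 x\<bar> \<le> (B * E) * indicator (cball 0 r) x" for x
    proof (cases "x \<in> cball 0 r")
      case True
      then have "x \<in> cball 0 (r + 1)" by auto
      then have "\<bar>F1 x\<bar> \<le> B * E" using B E unfolding F1_def abs_mult by (intro mult_mono) auto
      then show ?thesis using True by simp
    qed (use dsupp in \<open>simp add: F1_def\<close>)
  qed
  have i2: "integrable lborel F2"
  proof (rule lborel_integrable_bounded_support[OF m2])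
    show "\<bar>F2 x\<bar> \<le> (N * C) * indicator (cball 0 r) x" for x
    proof (cases "x \<in> cball 0 r")
      case True
      then have "\<bar>F2 x\<bar> \<le> N * C"
        using N C(1) C(2)[of x] unfolding F2_def abs_mult by (intro mult_mono) auto
      then show ?thesis using True by simp
    qed (use supp in \<open>simp add: F2_def\<close>)
  qed
  have "AE x in lborel. ((\<lambda>t. (g (x + t *\<^sub>R ?v) - g x) / t) \<longlongrightarrow> F1 x + F2 x) (at 0)"
    using AE_lborel_component_nonzero[of b]
  proof eventually_elim
    case (elim x)
    have "(g has_derivative (\<lambda>v. f x $ i * ?d x v + (D x *v v) $ i * \<phi> x)) (at x)"
      unfolding g_def[abs_def] by (rule has_derivative_mult[OF component_has_derivative[OF elim] der\<phi>])
    from difference_quotient_tendsto[OF this, of ?v]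
    show ?case by (simp add: F1_def F2_def matrix_vector_mult_basis column_def)
  qed
  then have "integral\<^sup>L lborel (\<lambda>x. F1 x + F2 x) = 0"
    using m1 m2 by (intro lipschitz_integral_derivative_zero[OF gl gs]) auto
  then have "integral\<^sup>L lborel F1 = - integral\<^sup>L lborel F2" using i1 i2 by simp
  moreover have "integral\<^sup>L lebesgue F1 = integral\<^sup>L lborel F1" "integral\<^sup>L lebesgue F2 = integral\<^sup>L lborel F2"
    using m1 m2 by (auto intro!: integral_completion)
  ultimately have "integral\<^sup>L lebesgue F1 = - integral\<^sup>L lebesgue F2" by simp
  then show ?thesis unfolding F1_def[abs_def] F2_def[abs_def] .
qed

lemma weak_differential_of_lipschitz: "weak_differential f D"
  unfolding weak_differential_def
proof (intro conjI allI impI integration_by_parts)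
  show "locally_integrable f"
  proof (rule locally_integrableI)
    show "f \<in> borel_measurable borel" by (rule borel_measurable_continuous_onI[OF map_continuous])
    show "bounded (f ` cball 0 r)" for r
      by (intro compact_imp_bounded compact_continuous_image continuous_on_subset[OF map_continuous]) auto
  qed
  show "locally_integrable D" by (rule locally_integrableI[OF Dm differential_bounded])
qed

end

section \<open>The hyperplane as an exceptional set\<close>

lemma hyperplane_hypersurface:
  fixes b :: "'n::finite"
  assumes "c \<noteq> b"
  shows "hypersurface {x :: real^'n. x $ b = 0}"
  unfolding hypersurface_def
proof
  fix x :: "real^'n" assume x: "x \<in> {x. x $ b = 0}"
  let ?S = "{x :: real^'n. x $ b = 0}" and ?H = "{y :: real^'n. y $ b = 0 \<and> 0 \<le> y $ c}"
  \<comment> \<open>The translation gives the image of \<open>x\<close> the value 2 in coordinate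
    \<open>c\<close>, so the unit ball lands inside the half-space and avoids its boundary.\<close>
  let ?t = "axis c 2 - x"
  have "homeomorphism (?S \<inter> ball x 1) (?H \<inter> ball (axis c 2) 1) (\<lambda>y. y + ?t) (\<lambda>y. y - ?t)"
    unfolding homeomorphism_def
  proof (intro conjI)
    have *: "y + ?t \<in> ?H \<inter> ball (axis c 2) 1" if "y \<in> ?S \<inter> ball x 1" for y
    proof -
      have "\<bar>(y - x) $ c\<bar> \<le> norm (y - x)" by (rule component_le_norm_cart)
      moreover have "norm (y - x) < 1" using that by (simp add: dist_norm norm_minus_commute)
      ultimately show ?thesis using that x assms
        by (auto simp: axis_def dist_norm norm_minus_commute algebra_simps)
    qed
    have **: "y - ?t \<in> ?S \<inter> ball x 1" if "y \<in> ?H \<inter> ball (axis c 2) 1" for y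
      using that x assms by (auto simp: axis_def dist_norm norm_minus_commute algebra_simps)
    show "(\<lambda>y. y + ?t) ` (?S \<inter> ball x 1) = ?H \<inter> ball (axis c 2) 1"
    proof
      show "?H \<inter> ball (axis c 2) 1 \<subseteq> (\<lambda>y. y + ?t) ` (?S \<inter> ball x 1)"
      proof
        fix y assume "y \<in> ?H \<inter> ball (axis c 2) 1"
        from **[OF this] show "y \<in> (\<lambda>y. y + ?t) ` (?S \<inter> ball x 1)"
          by (intro image_eqI[of _ _ "y - ?t"]) auto
      qed
    qed (use * in blast)
    show "(\<lambda>y. y - ?t) ` (?H \<inter> ball (axis c 2) 1) = ?S \<inter> ball x 1"
    proof
      show "?S \<inter> ball x 1 \<subseteq> (\<lambda>y. y - ?t) ` (?H \<inter> ball (axis c 2) 1)"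
      proof
        fix y assume "y \<in> ?S \<inter> ball x 1"
        from *[OF this] show "y \<in> (\<lambda>y. y - ?t) ` (?H \<inter> ball (axis c 2) 1)"
          by (intro image_eqI[of _ _ "y + ?t"]) auto
      qed
    qed (use ** in blast)
  qed (auto intro!: continuous_intros)
  then have "(?S \<inter> ball x 1) homeomorphic (?H \<inter> ball (axis c 2) 1)" by (auto simp: homeomorphic_def)
  moreover have "openin (top_of_set ?S) (?S \<inter> ball x 1)" "openin (top_of_set ?H) (?H \<inter> ball (axis c 2) 1)"
    by (auto intro: openin_open_Int)
  ultimately have "b \<noteq> c \<and> x \<in> ?S \<inter> ball x 1 \<and> openin (top_of_set ?S) (?S \<inter> ball x 1) \<and>
      openin (top_of_set ?H) (?H \<inter> ball (axis c 2) 1) \<and> (?S \<inter> ball x 1) homeomorphic (?H \<inter> ball (axis c 2) 1)"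
    using assms x by auto
  then show "\<exists>U W a b. a \<noteq> b \<and> x \<in> U \<and> openin (top_of_set ?S) U \<and>
      openin (top_of_set {y :: real^'n. y $ a = 0 \<and> 0 \<le> y $ b}) W \<and> U homeomorphic W"
    by (intro exI)
qed

lemma hyperplane_locally_rectifiable: "locally_rectifiable {x :: real^'n. x $ b = 0}"
  unfolding locally_rectifiable_def
proof (intro allI impI)
  fix K :: "(real^'n) set" assume "compact K"
  then have "bounded ({x. x $ b = 0} \<inter> K)" by (simp add: bounded_Int compact_imp_bounded)
  moreover have "1-lipschitz_on ({x. x $ b = 0} \<inter> K) (\<lambda>x. x)" by (intro lipschitz_onI) auto
  ultimately show "\<exists>a A g L. bounded A \<and> A \<subseteq> {y :: real^'n. y $ a = 0} \<and> L-lipschitz_on A g \<and> {x. x $ b = 0} \<inter> K = g ` A"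
    by (intro exI[of _ b] exI[of _ "{x. x $ b = 0} \<inter> K"] exI[of _ "\<lambda>x. x"] exI[of _ 1]) auto
qed

lemma closed_hyperplane_cart: "closed {x :: real^'n. x $ b = 0}"
  by (intro closed_Collect_eq continuous_intros)

section \<open>The branching map\<close>

lemma C1_deriv_open_image:
  assumes f: "C1_deriv U f M" and det: "\<And>x. x \<in> U \<Longrightarrow> det (M x) \<noteq> 0" and S: "open S" "S \<subseteq> U"
  shows "open (f ` S)"
proof (subst open_subopen, clarify)
  fix x assume x: "x \<in> S"
  obtain U' V g where "U' \<subseteq> S" "x \<in> U'" "open V" "homeomorphism U' V f g"
    using C1_deriv_local_inverse[OF C1_deriv_subset[OF f S] x] det S(2) x by (metis subsetD)
  then show "\<exists>T. open T \<and> f x \<in> T \<and> T \<subseteq> f ` S"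
    by (intro exI[of _ V]) (auto simp: homeomorphism_def)
qed

lemma lipschitz_near_isCont: "lipschitz_near f x \<Longrightarrow> isCont f x"
proof -
  assume "lipschitz_near f x"
  then obtain u L where u: "u > 0" "L-lipschitz_on (cball x u) f" by (auto simp: lipschitz_near_def)
  then have "continuous_on (ball x u) f"
    by (meson ball_subset_cball continuous_on_subset lipschitz_on_continuous_on)
  then show ?thesis using u(1) by (simp add: continuous_on_eq_continuous_at)
qed

lemma plane_diff: "plane p q (x - y) = plane p q x - plane p q y"
  by (simp add: complex_eq_iff)

lemma lift_diff: "lift p q w x - lift p q w y = lift p q (\<lambda>_. w (plane p q x) - w (plane p q y)) (x - y)"
  by (simp add: vec_eq_iff lift_def)

lemma lift_winding_fix: "plane p q y = 0 \<Longrightarrow> p \<noteq> q \<Longrightarrow> lift p q winding y = y"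
  by (metis lift_nth lift_nth_other plane_simps vec_eq_iff winding_0)

text \<open>The winding preserves the modulus and leaves the other coordinates alone, so distances
  to a point of the axis are preserved.\<close>

lemma norm_lift_winding_diff:
  assumes pq: "p \<noteq> q" and y0: "plane p q y0 = 0"
  shows "norm (lift p q winding y - y0) = norm (y - y0)"
proof -
  have "lift p q winding y - y0 = lift p q (\<lambda>_. winding (plane p q y)) (y - y0)"
    using lift_diff[of p q winding y y0] by (simp add: lift_winding_fix[OF y0 pq] y0)
  moreover have "(norm (lift p q (\<lambda>_. winding (plane p q y)) (y - y0)))\<^sup>2 = (norm (y - y0))\<^sup>2"
    using norm_lift_sq[OF pq, of "\<lambda>_. winding (plane p q y)" "y - y0"] by (simp add: plane_diff y0)
  ultimately show ?thesis by simp
qed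

text \<open>The plane constant 3 and the untouched coordinates combine to 1 + 3^2 = 10, which is at
  most 4^2.\<close>

lemma lift_winding_lipschitz_near:
  assumes pq: "p \<noteq> q" and y0: "plane p q y0 = 0"
  shows "lipschitz_near (lift p q winding) y0"
proof -
  have "4-lipschitz_on (cball y0 (1/2)) (lift p q winding)"
  proof (rule lipschitz_onI)
    fix x y assume xy: "x \<in> cball y0 (1/2)" "y \<in> cball y0 (1/2)"
    have "cmod (plane p q z) \<le> 1/2" if "z \<in> cball y0 (1/2)" for z
      using that norm_plane_le[OF pq, of "z - y0"] y0 by (simp add: plane_diff dist_norm norm_minus_commute)
    then have "cmod (winding (plane p q x) - winding (plane p q y)) \<le> 3 * cmod (plane p q (x - y))"
      unfolding plane_diff using xy by (intro winding_lipschitz) auto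
    also have "\<dots> \<le> 3 * norm (x - y)" using norm_plane_le[OF pq] by (intro mult_left_mono) auto
    finally have "(cmod (winding (plane p q x) - winding (plane p q y)))\<^sup>2 \<le> (3 * norm (x - y))\<^sup>2"
      by (intro power_mono) auto
    then have "(cmod (winding (plane p q x) - winding (plane p q y)))\<^sup>2 \<le> 9 * (norm (x - y))\<^sup>2"
      by (simp add: power_mult_distrib)
    moreover have "(norm (lift p q winding x - lift p q winding y))\<^sup>2 + (cmod (plane p q (x - y)))\<^sup>2
        = (norm (x - y))\<^sup>2 + (cmod (winding (plane p q x) - winding (plane p q y)))\<^sup>2"
      unfolding lift_diff by (rule norm_lift_sq[OF pq])
    ultimately have "(norm (lift p q winding x - lift p q winding y))\<^sup>2 \<le> 10 * (norm (x - y))\<^sup>2"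
      using zero_le_power2[of "cmod (plane p q (x - y))"] by linarith
    also have "\<dots> \<le> (4 * norm (x - y))\<^sup>2" unfolding power_mult_distrib by (intro mult_right_mono) auto
    finally have "norm (lift p q winding x - lift p q winding y) \<le> 4 * norm (x - y)"
      by (rule power2_le_imp_le) simp
    then show "dist (lift p q winding x) (lift p q winding y) \<le> 4 * dist x y" by (simp add: dist_norm)
  qed simp
  then show ?thesis unfolding lipschitz_near_def by (intro exI[of _ "1/2"]) auto
qed

lemma lift_winding_ball:
  assumes pq: "p \<noteq> q" and y0: "plane p q y0 = 0" and \<delta>: "\<delta> \<le> 1/2"
  shows "lift p q winding ` ball y0 \<delta> = ball y0 \<delta>"
proof
  show "lift p q winding ` ball y0 \<delta> \<subseteq> ball y0 \<delta>"
    using norm_lift_winding_diff[OF pq y0] by (auto simp: dist_norm norm_minus_commute)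
  show "ball y0 \<delta> \<subseteq> lift p q winding ` ball y0 \<delta>"
  proof
    fix y assume y: "y \<in> ball y0 \<delta>"
    have "cmod (plane p q y) \<le> norm (y - y0)" using norm_plane_le[OF pq, of "y - y0"] y0 by (simp add: plane_diff)
    then have "cmod (plane p q y) \<le> 1/2" using y \<delta> by (simp add: dist_norm norm_minus_commute)
    then obtain z where z: "winding z = plane p q y" by (rule winding_half_surj) blast
    let ?y = "lift p q (\<lambda>_. z) y"
    have eq: "lift p q winding ?y = y" using pq z by (simp add: vec_eq_iff lift_def[of p q winding])
    then have "norm (?y - y0) = norm (y - y0)" using norm_lift_winding_diff[OF pq y0, of ?y] by simp
    then have "?y \<in> ball y0 \<delta>" using y by (simp add: dist_norm norm_minus_commute)
    then show "y \<in> lift p q winding ` ball y0 \<delta>" using eq by (metis imageI)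
  qed
qed

text \<open>On the segment through \<open>y0\<close> in direction \<open>q\<close>, reflection in
  \<open>y0\<close> changes the sign of the plane component, and near 0 the winding does not see
  that sign.\<close>

lemma lift_winding_even:
  assumes pq: "p \<noteq> q" and y0: "plane p q y0 = 0" and s: "\<bar>s\<bar> \<le> 1/2"
  shows "lift p q winding (y0 + s *\<^sub>R axis q 1) = lift p q winding (y0 + (- s) *\<^sub>R axis q 1)"
proof -
  have "plane p q (y0 + (- s) *\<^sub>R axis q 1) = - plane p q (y0 + s *\<^sub>R axis q 1)"
    "cmod (plane p q (y0 + s *\<^sub>R axis q 1)) \<le> 1/2"
    using pq y0 s by (auto simp: complex_eq_iff axis_def cmod_eq_Im)
  then have "winding (plane p q (y0 + (- s) *\<^sub>R axis q 1)) = winding (plane p q (y0 + s *\<^sub>R axis q 1))"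
    by (simp only: winding_minus)
  then show ?thesis unfolding vec_eq_iff lift_def by (auto simp: axis_def)
qed

text \<open>Reversing the parameter negates the velocity of an even curve but leaves the curve as it
  is. Applied to the image of a curve through a branch point, this forces every differential there
  to be singular.\<close>

lemma even_vector_derivative_zero:
  fixes F :: "real \<Rightarrow> 'a::real_normed_vector"
  assumes d: "(F has_vector_derivative w) (at 0)" and "\<delta> > 0" and even: "\<And>s. \<bar>s\<bar> < \<delta> \<Longrightarrow> F (- s) = F s"
  shows "w = 0"
proof -
  have "((\<lambda>s. F (- s)) has_vector_derivative (-1) *\<^sub>R w) (at 0)"
    using vector_diff_chain_at[of uminus "-1" 0 F w] d by (simp add: o_def has_vector_derivative_minus[OF has_vector_derivative_id])
  then have "(F has_vector_derivative (-1) *\<^sub>R w) (at 0)"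
    by (rule has_vector_derivative_transform_within_open[of _ _ _ "ball 0 \<delta>"]) (use assms(2) even in auto)
  with d have "w = (-1) *\<^sub>R w" by (rule vector_derivative_unique_at)
  then show ?thesis by (simp add: eq_neg_iff_add_eq_0 flip: scaleR_2)
qed

section \<open>The composed map near and away from its branch set\<close>

locale wrapped_ball = torus_coords e a b m + shrinking \<epsilon> R
  for e :: "nat \<Rightarrow> 'n::finite" and a b m \<epsilon> R +
  assumes R_ge: "2 * R \<ge> 1" and core_ball: "core \<subseteq> ball 0 R"
begin

definition branching_map :: "real^'n \<Rightarrow> real^'n" where
  "branching_map x = wrap (2 * R) (to_ball \<epsilon> R x)"

definition branching :: "(real^'n) set" where
  "branching = {x. to_ball \<epsilon> R x \<in> core}"

lemma to_ball_in_ball: "to_ball \<epsilon> R (x :: real^'n) \<in> ball 0 R"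
  using range_to_ball[where 'n = 'n] by blast

text \<open>The derivative is kept in factored form, since the factors enter the distortion
  differently: \<open>A\<close> through a constant, \<open>to_ball'\<close> through the
  logarithm.\<close>

lemma branching_map_regular:
  obtains L where "L \<ge> 1" "\<And>x. x \<notin> branching \<Longrightarrow>
     \<exists>U M. x \<in> U \<and> C1_deriv U branching_map M \<and> (\<forall>z\<in>U. \<exists>A. bilip L A \<and> M z = A ** to_ball' \<epsilon> R z)"
proof -
  obtain L where L: "L \<ge> 1" "\<And>x. x \<in> ball 0 R - core \<Longrightarrow>
     \<exists>U M. x \<in> U \<and> C1_deriv U (wrap (2 * R)) M \<and> (\<forall>z\<in>U. bilip L (M z))"
    using wrap_regular[OF R_ge] by metis
  have "\<exists>U M. x \<in> U \<and> C1_deriv U branching_map M \<and> (\<forall>z\<in>U. \<exists>A. bilip L A \<and> M z = A ** to_ball' \<epsilon> R z)"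
    if x: "x \<notin> branching" for x
  proof -
    have "to_ball \<epsilon> R x \<in> ball 0 R - core" using x to_ball_in_ball by (simp add: branching_def)
    then obtain V M where V: "to_ball \<epsilon> R x \<in> V" "C1_deriv V (wrap (2 * R)) M" "\<And>z. z \<in> V \<Longrightarrow> bilip L (M z)"
      using L(2) by metis
    let ?U = "to_ball \<epsilon> R -` V :: (real^'n) set"
    have "open ?U"
      using V(2) by (intro open_vimage C1_deriv_continuous_on[OF to_ball_C1]) (auto simp: C1_deriv_def)
    from C1_deriv_compose[OF C1_deriv_subset[OF to_ball_C1 this subset_UNIV] V(2)]
    have "C1_deriv ?U branching_map (\<lambda>z. M (to_ball \<epsilon> R z) ** to_ball' \<epsilon> R z)"
      by (simp add: branching_map_def[abs_def] image_vimage_subset)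
    then show ?thesis using V(1,3) by (intro exI[of _ ?U]) blast
  qed
  then show thesis using that L(1) by blast
qed

text \<open>Local normal form at a point over the torus: a diffeomorphism \<open>\<theta>\<close>,
  the winding in the plane of \<open>b\<close> and \<open>a\<close>, and the chart, which is
  injective on a neighbourhood \<open>U0\<close> of the fixed point \<open>y0\<close>. Openness,
  discreteness, Lipschitz continuity and branching at such points are all read off it.\<close>

lemma branching_chart:
  assumes x0: "x0 \<in> branching"
  obtains U V U0 \<theta> \<theta>' \<beta> y0 where
    "open U" "x0 \<in> U" "open V" "homeomorphism U V \<theta> \<beta>" "C1_deriv U \<theta> \<theta>'"
    "C1_deriv V \<beta> (\<lambda>y. matrix_inv (\<theta>' (\<beta> y)))" "det (\<theta>' x0) \<noteq> 0" "\<theta> x0 = y0" "plane b a y0 = 0"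
    "\<And>z. z \<in> U \<Longrightarrow> branching_map z = chart (2 * R) (lift b a winding (\<theta> z))"
    "open U0" "y0 \<in> U0" "inj_on (chart (2 * R)) U0"
proof -
  let ?\<kappa> = "2 * R"
  have \<kappa>: "?\<kappa> \<ge> 1" "?\<kappa> \<noteq> 0" using R_ge by auto
  obtain y0 where y0: "to_ball \<epsilon> R x0 = chart ?\<kappa> y0" "plane b a y0 = 0"
    using x0 core_eq[of ?\<kappa>] by (auto simp: branching_def)
  obtain U0 V0 g where g: "open U0" "y0 \<in> U0" "open V0" "homeomorphism U0 V0 (chart ?\<kappa>) g"
    "C1_deriv V0 g (\<lambda>z. matrix_inv (chart' ?\<kappa> (g z)))"
    using C1_deriv_local_inverse[OF chart_C1, of y0] chart_det[OF \<kappa>(1)] by (metis UNIV_I)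
  let ?W = "to_ball \<epsilon> R -` V0 :: (real^'n) set"
  have W: "open ?W"
    using g(3) by (intro open_vimage C1_deriv_continuous_on[OF to_ball_C1])
  have gx: "to_ball \<epsilon> R x0 \<in> V0" "g (to_ball \<epsilon> R x0) = y0"
    using g(2,4) y0(1) by (auto simp: homeomorphism_def)
  let ?\<theta> = "\<lambda>z. g (to_ball \<epsilon> R z)"
  let ?\<theta>' = "\<lambda>z. matrix_inv (chart' ?\<kappa> (g (to_ball \<epsilon> R z))) ** to_ball' \<epsilon> R z"
  have \<theta>: "C1_deriv ?W ?\<theta> ?\<theta>'"
    using C1_deriv_compose[OF C1_deriv_subset[OF to_ball_C1 W subset_UNIV] g(5)] by (simp add: image_vimage_subset)
  have "det (matrix_inv (chart' ?\<kappa> y)) \<noteq> 0" for y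
    using matrix_inv_det_nz(1)[OF chart_det[OF \<kappa>(1)], of y] by (metis det_I det_mul mult_zero_right zero_neq_one)
  then have det: "det (?\<theta>' x0) \<noteq> 0"
    using det_to_ball'_pos[of x0] by (simp add: det_mul)
  have xW: "x0 \<in> ?W" using gx by simp
  obtain U V \<beta> where U: "open U" "U \<subseteq> ?W" "x0 \<in> U" "open V" "homeomorphism U V ?\<theta> \<beta>"
    "C1_deriv V \<beta> (\<lambda>y. matrix_inv (?\<theta>' (\<beta> y)))"
    by (rule C1_deriv_local_inverse[OF \<theta> xW det]) blast
  have eq: "branching_map z = chart ?\<kappa> (lift b a winding (?\<theta> z))" if "z \<in> U" for z
    using that U(2) wrap_chart[OF \<kappa>(2), of "?\<theta> z"] homeomorphism_apply2[OF g(4)]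
    by (auto simp: branching_map_def)
  have inj: "inj_on (chart ?\<kappa>) U0"
    by (rule inj_on_inverseI[where g = g]) (simp add: homeomorphism_apply1[OF g(4)])
  show thesis
    by (rule that[OF U(1,3,4,5) C1_deriv_subset[OF \<theta> U(1,2)] U(6) det gx(2) y0(2) eq g(1,2) inj])
qed

lemma chart_open_image: "open S \<Longrightarrow> open (chart (2 * R) ` S)"
  using C1_deriv_open_image[OF chart_C1] chart_det R_ge by blast

lemma branching_lipschitz_near:
  assumes "x0 \<in> branching" shows "lipschitz_near branching_map x0"
proof -
  obtain U V U0 \<theta> \<theta>' \<beta> y0 where c: "open U" "x0 \<in> U" "C1_deriv U \<theta> \<theta>'" "\<theta> x0 = y0" "plane b a y0 = 0"
    "\<And>z. z \<in> U \<Longrightarrow> branching_map z = chart (2 * R) (lift b a winding (\<theta> z))"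
    by (rule branching_chart[OF assms]) blast
  have "lipschitz_near (\<lambda>z. lift b a winding (\<theta> z)) x0"
    using c(4,5) ab by (intro lipschitz_near_compose[OF C1_deriv_lipschitz_near[OF c(3,2)]] lift_winding_lipschitz_near) auto
  from lipschitz_near_compose[OF this C1_deriv_lipschitz_near[OF chart_C1]]
  have "lipschitz_near (\<lambda>z. chart (2 * R) (lift b a winding (\<theta> z))) x0" by simp
  then show ?thesis by (rule lipschitz_near_cong[OF _ c(1,2)]) (simp add: c(6))
qed

text \<open>The outer chart is injective near \<open>y0\<close>, and only 0 is wound to 0, so the
  fibre consists of \<open>x0\<close> alone in a neighbourhood.\<close>

lemma branching_isolated:
  assumes "x0 \<in> branching"
  shows "\<exists>W. open W \<and> x0 \<in> W \<and> (\<forall>z\<in>W. branching_map z = branching_map x0 \<longrightarrow> z = x0)"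
proof -
  obtain U V U0 \<theta> \<theta>' \<beta> y0 where c: "open U" "x0 \<in> U" "homeomorphism U V \<theta> \<beta>" "C1_deriv U \<theta> \<theta>'"
    "\<theta> x0 = y0" "plane b a y0 = 0"
    "\<And>z. z \<in> U \<Longrightarrow> branching_map z = chart (2 * R) (lift b a winding (\<theta> z))"
    "open U0" "y0 \<in> U0" "inj_on (chart (2 * R)) U0"
    by (rule branching_chart[OF assms]) blast
  have ba: "b \<noteq> a" using ab by simp
  note fix0 = lift_winding_fix[OF c(6) ba]
  have "lipschitz_near (\<lambda>z. lift b a winding (\<theta> z)) x0"
    using c(5,6) ab by (intro lipschitz_near_compose[OF C1_deriv_lipschitz_near[OF c(4,2)]] lift_winding_lipschitz_near) auto
  then have "isCont (\<lambda>z. lift b a winding (\<theta> z)) x0" by (rule lipschitz_near_isCont)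
  then have "((\<lambda>z. lift b a winding (\<theta> z)) \<longlongrightarrow> y0) (at x0)" using c(5) fix0 by (simp add: isCont_def)
  then have "\<forall>\<^sub>F z in at x0. lift b a winding (\<theta> z) \<in> U0" using c(8,9) by (rule topological_tendstoD)
  then obtain S where S: "open S" "x0 \<in> S" "\<And>z. z \<in> S \<Longrightarrow> z \<noteq> x0 \<Longrightarrow> lift b a winding (\<theta> z) \<in> U0"
    unfolding eventually_at_topological by blast
  have "z = x0" if z: "z \<in> S \<inter> U" "branching_map z = branching_map x0" for z
  proof (rule ccontr)
    assume ne: "z \<noteq> x0"
    have "chart (2 * R) (lift b a winding (\<theta> z)) = chart (2 * R) y0"
      using z c(2,5,7) fix0 by simp
    then have w: "lift b a winding (\<theta> z) = y0" using c(9,10) S(3) z(1) ne by (auto dest: inj_onD)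
    then have "winding (plane b a (\<theta> z)) = 0" using plane_lift[OF ba, of winding "\<theta> z"] c(6) by simp
    then have "\<theta> z = y0" using w lift_winding_fix[OF _ ba, of "\<theta> z"] by simp
    then show False using ne z(1) c(2,5) homeomorphism_apply1[OF c(3)] by (metis IntD2)
  qed
  then show ?thesis using S(1,2) c(1,2) by (intro exI[of _ "S \<inter> U"]) auto
qed

text \<open>Balls about \<open>y0\<close> of radius at most 1/2 are wound onto themselves, and the
  chart is an open map.\<close>

lemma branching_open_at:
  assumes x0: "x0 \<in> branching" and W: "open W" "x0 \<in> W"
  shows "\<exists>T. open T \<and> branching_map x0 \<in> T \<and> T \<subseteq> branching_map ` W"
proof -
  obtain U V U0 \<theta> \<theta>' \<beta> y0 where c: "open U" "x0 \<in> U" "open V" "homeomorphism U V \<theta> \<beta>"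
    "\<theta> x0 = y0" "plane b a y0 = 0"
    "\<And>z. z \<in> U \<Longrightarrow> branching_map z = chart (2 * R) (lift b a winding (\<theta> z))"
    by (rule branching_chart[OF x0]) blast
  have ba: "b \<noteq> a" using ab by simp
  have "open (V \<inter> \<beta> -` (W \<inter> U))"
    by (intro continuous_open_preimage[OF homeomorphism_cont2[OF c(4)] c(3)] open_Int W c)
  moreover have "y0 \<in> V \<inter> \<beta> -` (W \<inter> U)"
    using c(2,5) W(2) homeomorphism_apply1[OF c(4,2)] homeomorphism_image1[OF c(4)] by auto
  ultimately obtain d where d: "d > 0" "ball y0 d \<subseteq> V \<inter> \<beta> -` (W \<inter> U)"
    using open_contains_ball by metis
  let ?d = "min d (1/2)"
  let ?T = "chart (2 * R) ` ball y0 ?d"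
  have "?T \<subseteq> branching_map ` W"
  proof clarify
    fix y assume "y \<in> ball y0 ?d"
    then obtain y' where y': "y' \<in> ball y0 ?d" "y = lift b a winding y'"
      using lift_winding_ball[OF ba c(6), of ?d] by (metis imageE min.cobounded2)
    then have "y' \<in> V \<inter> \<beta> -` (W \<inter> U)" using d(2) by auto
    then have "branching_map (\<beta> y') = chart (2 * R) y" "\<beta> y' \<in> W"
      using c(7)[of "\<beta> y'"] homeomorphism_apply2[OF c(4)] y'(2) by auto
    then show "chart (2 * R) y \<in> branching_map ` W" by (metis imageI)
  qed
  moreover have "branching_map x0 \<in> ?T"
    using c(2,5,7) lift_winding_fix[OF c(6) ba] d(1) by auto
  moreover have "open ?T" by (intro chart_open_image open_ball)
  ultimately show ?thesis by blast
qed

text \<open>The preimage of the segment through \<open>y0\<close> in direction \<open>a\<close>,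
  along which the winding is even. That the curve is injective rules out local injectivity of the
  map; that its velocity is non-zero rules out an invertible differential.\<close>

lemma branching_curve:
  assumes x0: "x0 \<in> branching"
  obtains \<gamma> w \<delta> where "(\<gamma> has_vector_derivative w) (at (0::real))" "\<gamma> 0 = x0" "w \<noteq> 0" "\<delta> > 0"
    "\<And>s. \<bar>s\<bar> < \<delta> \<Longrightarrow> branching_map (\<gamma> (- s)) = branching_map (\<gamma> s)" "inj_on \<gamma> (ball 0 \<delta>)"
proof -
  obtain U V U0 \<theta> \<theta>' \<beta> y0 where c: "open U" "x0 \<in> U" "open V" "homeomorphism U V \<theta> \<beta>"
    "C1_deriv V \<beta> (\<lambda>y. matrix_inv (\<theta>' (\<beta> y)))" "det (\<theta>' x0) \<noteq> 0"
    "\<theta> x0 = y0" "plane b a y0 = 0"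
    "\<And>z. z \<in> U \<Longrightarrow> branching_map z = chart (2 * R) (lift b a winding (\<theta> z))"
    by (rule branching_chart[OF x0]) blast
  have ba: "b \<noteq> a" using ab by simp
  have y0V: "y0 \<in> V" "\<beta> y0 = x0"
    using c(2,4,7) by (auto simp: homeomorphism_def)
  obtain d where d: "d > 0" "ball y0 d \<subseteq> V" using c(3) y0V(1) open_contains_ball by metis
  let ?p = "\<lambda>s. y0 + s *\<^sub>R axis a (1::real)"
  define \<delta> where "\<delta> = min d (1/2)"
  have p: "?p s \<in> V" if "\<bar>s\<bar> < \<delta>" for s
    using that d(2) by (auto simp: \<delta>_def dist_norm)
  let ?w = "matrix_inv (\<theta>' x0) *v axis a 1"
  have "(\<beta> has_derivative (*v) (matrix_inv (\<theta>' x0))) (at (?p 0))"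
    using c(5) y0V by (auto simp: C1_deriv_def)
  moreover have "(?p has_derivative (\<lambda>s. s *\<^sub>R axis a 1)) (at 0)" by (auto intro!: derivative_eq_intros)
  ultimately have "((\<lambda>s. \<beta> (?p s)) has_derivative (\<lambda>s. matrix_inv (\<theta>' x0) *v (s *\<^sub>R axis a 1))) (at 0)"
    using diff_chain_at by (fastforce simp: o_def)
  then have "((\<lambda>s. \<beta> (?p s)) has_vector_derivative ?w) (at 0)"
    by (simp add: has_vector_derivative_def matrix_vector_mult_scaleR)
  moreover have "?w \<noteq> 0"
  proof
    assume "?w = 0"
    then have "\<theta>' x0 *v ?w = 0" by simp
    then show False using matrix_inv_det_nz[OF c(6)] by (simp add: matrix_vector_mul_assoc axis_eq_0_iff)
  qed
  moreover have "branching_map (\<beta> (?p (- s))) = branching_map (\<beta> (?p s))" if "\<bar>s\<bar> < \<delta>" for s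
  proof -
    have t: "branching_map (\<beta> (?p t)) = chart (2 * R) (lift b a winding (?p t))" if "\<bar>t\<bar> < \<delta>" for t
    proof -
      have "\<beta> (?p t) \<in> U" "\<theta> (\<beta> (?p t)) = ?p t" using p[OF that] c(4) by (auto simp: homeomorphism_def)
      then show ?thesis using c(9)[of "\<beta> (?p t)"] by simp
    qed
    have "\<bar>s\<bar> \<le> 1/2" "\<bar>- s\<bar> < \<delta>" using that by (simp_all add: \<delta>_def)
    then show ?thesis unfolding t[OF that] t[OF \<open>\<bar>- s\<bar> < \<delta>\<close>] by (simp only: lift_winding_even[OF ba c(8), of s])
  qed
  moreover have "inj_on (\<lambda>s. \<beta> (?p s)) (ball 0 \<delta>)"
  proof
    fix s t assume "s \<in> ball 0 \<delta>" "t \<in> ball 0 \<delta>" and eq: "\<beta> (?p s) = \<beta> (?p t)"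
    then have "?p s = ?p t" using p homeomorphism_apply2[OF c(4)] by (metis mem_ball_0 real_norm_def)
    then show "s = t" by (simp add: axis_eq_0_iff)
  qed
  moreover have "\<delta> > 0" using d(1) by (simp add: \<delta>_def)
  ultimately show thesis using that[of "\<lambda>s. \<beta> (?p s)" ?w \<delta>] y0V(2) by simp
qed


lemma regular_point:
  assumes "x \<notin> branching"
  obtains U M where "x \<in> U" "C1_deriv U branching_map M" "\<And>z. z \<in> U \<Longrightarrow> det (M z) > 0"
proof -
  obtain L where "\<And>x. x \<notin> branching \<Longrightarrow>
     \<exists>U M. x \<in> U \<and> C1_deriv U branching_map M \<and> (\<forall>z\<in>U. \<exists>A. bilip L A \<and> M z = A ** to_ball' \<epsilon> R z)"
    using branching_map_regular by metis
  from this[OF assms] obtain U M where U: "x \<in> U" "C1_deriv U branching_map M"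
    and M: "\<And>z. z \<in> U \<Longrightarrow> \<exists>A. bilip L A \<and> M z = A ** to_ball' \<epsilon> R z" by blast
  have "det (M z) > 0" if "z \<in> U" for z
    using M[OF that] det_to_ball'_pos[of z] by (auto simp: bilip_def det_mul)
  then show thesis using that U by blast
qed

lemma branching_map_continuous: "continuous_on UNIV branching_map"
proof (rule continuous_at_imp_continuous_on, rule ballI)
  fix x show "isCont branching_map x"
  proof (cases "x \<in> branching")
    case True then show ?thesis by (intro lipschitz_near_isCont branching_lipschitz_near)
  next
    case False
    then show ?thesis
      by (rule regular_point) (intro lipschitz_near_isCont C1_deriv_lipschitz_near)
  qed
qed

lemma regular_local_homeomorphism:
  assumes "x \<notin> branching" "open W" "x \<in> W"
  obtains U V g where "open U" "U \<subseteq> W" "x \<in> U" "open V" "homeomorphism U V branching_map g"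
proof -
  obtain U M where U: "x \<in> U" "C1_deriv U branching_map M" "\<And>z. z \<in> U \<Longrightarrow> det (M z) > 0"
    using regular_point[OF assms(1)] by blast
  have "open (U \<inter> W)" using U(2) assms(2) by (auto simp: C1_deriv_def)
  then have "C1_deriv (U \<inter> W) branching_map M" by (intro C1_deriv_subset[OF U(2)]) auto
  from C1_deriv_local_inverse[OF this, of x] U(1) U(3)[OF U(1)] assms(3) that
  show thesis by (metis Int_iff le_inf_iff less_irrefl)
qed

lemma branching_map_open:
  assumes W: "open W" shows "open (branching_map ` W)"
proof (subst open_subopen, clarify)
  fix x assume x: "x \<in> W"
  show "\<exists>T. open T \<and> branching_map x \<in> T \<and> T \<subseteq> branching_map ` W"
  proof (cases "x \<in> branching")
    case True then show ?thesis by (rule branching_open_at[OF _ W x])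
  next
    case False
    then obtain U V g where "U \<subseteq> W" "x \<in> U" "open V" "homeomorphism U V branching_map g"
      using regular_local_homeomorphism[OF _ W x] by metis
    then show ?thesis by (intro exI[of _ V]) (auto simp: homeomorphism_def)
  qed
qed

lemma branching_map_discrete: "discrete (branching_map -` {y})"
proof (rule discreteI)
  fix x assume x: "x \<in> branching_map -` {y}"
  have "\<exists>W. open W \<and> x \<in> W \<and> (\<forall>z\<in>W. branching_map z = branching_map x \<longrightarrow> z = x)"
  proof (cases "x \<in> branching")
    case True then show ?thesis by (rule branching_isolated)
  next
    case False
    then obtain U V g where "open U" "x \<in> U" "homeomorphism U V branching_map g"
      using regular_local_homeomorphism[OF _ open_UNIV UNIV_I] by metis
    then show ?thesis by (intro exI[of _ U]) (metis homeomorphism_apply1)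
  qed
  then obtain W where W: "open W" "x \<in> W" "\<forall>z\<in>W. branching_map z = branching_map x \<longrightarrow> z = x" by blast
  have "z = x" if "z \<in> W \<inter> branching_map -` {y}" for z
  proof -
    have "z \<in> W" "branching_map z = branching_map x" using that x by auto
    then show ?thesis using W(3) by blast
  qed
  then have "W \<inter> branching_map -` {y} = {x}" using W(2) x by blast
  then show "x isolated_in branching_map -` {y}"
    unfolding isolated_in_def using x W(1) by blast
qed

lemma branched_cover_branching_map: "branched_cover branching_map"
  using branching_map_continuous branching_map_open branching_map_discrete
  by (simp add: branched_cover_def)

text \<open>Off \<open>branching\<close> the inverse function theorem applies. On it, every
  neighbourhood contains two distinct points of \<open>branching_curve\<close>, with opposite
  parameters and the same image.\<close>

lemma branch_set_branching_map: "branch_set branching_map = branching"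
proof
  show "branch_set branching_map \<subseteq> branching"
  proof
    fix x assume x: "x \<in> branch_set branching_map"
    show "x \<in> branching"
    proof (rule ccontr)
      assume "x \<notin> branching"
      then obtain U V g where U: "open U" "x \<in> U" "homeomorphism U V branching_map g"
        using regular_local_homeomorphism[OF _ open_UNIV UNIV_I] by metis
      then have "V = branching_map ` U" by (simp add: homeomorphism_def)
      then show False using U x unfolding branch_set_def by blast
    qed
  qed
  show "branching \<subseteq> branch_set branching_map"
  proof
    fix x assume "x \<in> branching"
    then obtain \<gamma> w \<delta> where g: "(\<gamma> has_vector_derivative w) (at (0::real))" "\<gamma> 0 = x" "\<delta> > 0"
      "\<And>s. \<bar>s\<bar> < \<delta> \<Longrightarrow> branching_map (\<gamma> (- s)) = branching_map (\<gamma> s)" "inj_on \<gamma> (ball 0 \<delta>)"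
      by (rule branching_curve) blast
    have "\<not> homeomorphism U (branching_map ` U) branching_map h" if U: "open U" "x \<in> U" for U h
    proof
      assume h: "homeomorphism U (branching_map ` U) branching_map h"
      have "isCont \<gamma> 0" using g(1) by (rule has_vector_derivative_continuous)
      then have "(\<gamma> \<longlongrightarrow> x) (at 0)" using g(2) by (simp add: isCont_def)
      then have "\<forall>\<^sub>F s in at 0. \<gamma> s \<in> U" using U by (rule topological_tendstoD)
      then obtain d where d: "d > 0" "\<And>s. s \<noteq> 0 \<Longrightarrow> \<bar>s\<bar> < d \<Longrightarrow> \<gamma> s \<in> U"
        by (auto simp: eventually_at)
      define s where "s = min d \<delta> / 2"
      have s: "s > 0" "s < d" "s < \<delta>" using d(1) g(3) by (auto simp: s_def)
      have "\<gamma> s \<in> U" "\<gamma> (- s) \<in> U" using s d(2)[of s] d(2)[of "- s"] by auto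
      then have "\<gamma> s = \<gamma> (- s)"
        using g(4)[of s] s homeomorphism_apply1[OF h] by (metis abs_of_pos)
      then have "s = - s" using s g(5) by (auto dest: inj_onD)
      then show False using s by simp
    qed
    then show "x \<in> branch_set branching_map" unfolding branch_set_def by blast
  qed
qed

text \<open>Invariance of domain supplies the continuous inverse of the radial map. The torus lies
  in the range, so it can be pulled back.\<close>

lemma branching_homeomorphic: "top_of_set branching homeomorphic_space torus_topology m"
proof -
  obtain g where g: "homeomorphism UNIV (range (to_ball \<epsilon> R)) (to_ball \<epsilon> R :: real^'n \<Rightarrow> real^'n) g"
    using invariance_of_domain_homeomorphism[OF open_UNIV C1_deriv_continuous_on[OF to_ball_C1] order_refl to_ball_inj]
    by blast
  have "to_ball \<epsilon> R ` branching = core"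
    using core_ball range_to_ball[where 'n = 'n] by (auto simp: branching_def)
  from homeomorphism_of_subsets[OF g subset_UNIV order_refl this]
  have "homeomorphism branching core (to_ball \<epsilon> R) g" .
  then have "homeomorphic_maps (top_of_set branching) (top_of_set core) (to_ball \<epsilon> R) g"
    by (auto simp: homeomorphic_maps_def homeomorphism_def)
  then have "top_of_set branching homeomorphic_space top_of_set core" by (auto simp: homeomorphic_space_def)
  then show ?thesis using core_homeomorphic_torus homeomorphic_space_sym homeomorphic_space_trans by blast
qed

section \<open>Smoothness, weak differential and distortion of the composed map\<close>

lemma regular_jacobian:
  assumes "x \<notin> branching"
  shows "branching_map differentiable (at x)" "det (jacobian branching_map (at x)) > 0"
    "isCont (\<lambda>z. jacobian branching_map (at z)) x"
    "(branching_map has_derivative (*v) (jacobian branching_map (at x))) (at x)"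
proof -
  obtain U M where U: "x \<in> U" "C1_deriv U branching_map M" "\<And>z. z \<in> U \<Longrightarrow> det (M z) > 0"
    using regular_point[OF assms] by blast
  note J = C1_deriv_jacobian[OF U(2)]
  show "branching_map differentiable (at x)" "det (jacobian branching_map (at x)) > 0"
    using J[OF U(1)] U by auto
  show "(branching_map has_derivative (*v) (jacobian branching_map (at x))) (at x)"
    using J[OF U(1)] U by (simp add: C1_deriv_def)
  have "continuous_on U M" "open U" using U(2) by (auto simp: C1_deriv_def)
  then have "continuous_on U (\<lambda>z. jacobian branching_map (at z))"
    using J(3) by (simp cong: continuous_on_cong)
  then show "isCont (\<lambda>z. jacobian branching_map (at z)) x"
    using \<open>open U\<close> U(1) by (simp add: continuous_on_eq_continuous_at)
qed

lemma branching_b: "x \<in> branching \<Longrightarrow> x $ b = 0"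
  using core_b to_ball_nth unfolding branching_def by blast

text \<open>The derivative is continuous off a torus of codimension two, whereas the definition asks
  for hypersurfaces. The torus is therefore enlarged to the hyperplane \<open>x $ b = 0\<close>,
  which contains it because the radial map preserves that hyperplane.\<close>

lemma piecewise_smooth_branching_map: "piecewise_smooth branching_map"
  unfolding piecewise_smooth_def
proof (intro exI[of _ "{{x. x $ b = 0}}"] conjI)
  show "\<forall>S\<in>{{x :: real^'n. x $ b = 0}}. closed S \<and> hypersurface S \<and> locally_rectifiable S"
    using closed_hyperplane_cart hyperplane_hypersurface[OF ab] hyperplane_locally_rectifiable by auto
  have reg: "x \<notin> branching" if "x \<in> - \<Union> {{x. x $ b = 0}}" for x using that branching_b by auto
  show "branching_map differentiable_on - \<Union> {{x. x $ b = 0}}"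
    using regular_jacobian(1)[OF reg] by (auto intro!: differentiable_at_imp_differentiable_on)
  show "continuous_on (- \<Union> {{x. x $ b = 0}}) (\<lambda>x. jacobian branching_map (at x))"
    using regular_jacobian(3)[OF reg] by (auto intro!: continuous_at_imp_continuous_on)
qed simp

text \<open>The classical derivative off the hyperplane is the weak one, because the map is
  Lipschitz across the hyperplane; its determinant is positive there, hence almost
  everywhere.\<close>

lemma finite_distortion_branching_map: "finite_distortion branching_map"
proof -
  let ?H = "- {x :: real^'n. x $ b = 0}"
  define D where "D x = (if x $ b = 0 then 0 else jacobian branching_map (at x))" for x
  have reg: "x \<notin> branching" if "x $ b \<noteq> 0" for x using that branching_b by auto
  have near: "lipschitz_near branching_map x" for x
  proof (cases "x \<in> branching")
    case True then show ?thesis by (rule branching_lipschitz_near)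
  next
    case False then show ?thesis by (rule regular_point) (rule C1_deriv_lipschitz_near)
  qed
  note lip = lipschitz_near_imp_lipschitz_on_cball[OF near, of 0]
  have H: "open ?H" using closed_hyperplane_cart[of b] by (rule open_Compl)
  have "continuous_on ?H (\<lambda>x. jacobian branching_map (at x))"
    using regular_jacobian(3)[OF reg] by (auto intro!: continuous_at_imp_continuous_on)
  then have "(\<lambda>x. indicator ?H x *\<^sub>R jacobian branching_map (at x)) \<in> borel_measurable borel"
    using H by (intro borel_measurable_continuous_on_indicator) auto
  also have "(\<lambda>x. indicator ?H x *\<^sub>R jacobian branching_map (at x)) = D"
    by (auto simp: D_def fun_eq_iff indicator_def)
  finally have Dm: "D \<in> borel_measurable borel" .
  have der: "(branching_map has_derivative (*v) (D x)) (at x)" if "x $ b \<noteq> 0" for x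
    using regular_jacobian(4)[OF reg[OF that]] that by (simp add: D_def)
  have D0: "D x = 0" if "x $ b = 0" for x using that by (simp add: D_def)
  have "AE x :: real^'n in lebesgue. x $ b \<noteq> 0" by (intro AE_completion AE_lborel_component_nonzero)
  then have "AE x in lebesgue. onorm ((*v) (D x)) > 0 \<longrightarrow> det (D x) > 0"
    by eventually_elim (use regular_jacobian(2)[OF reg] in \<open>simp add: D_def\<close>)
  then show ?thesis
    unfolding finite_distortion_def
    using weak_differential_of_lipschitz[OF lip Dm der D0] locally_integrable_det[OF lip Dm der D0] by blast
qed

text \<open>The distortion bound is claimed at every point. A differential at a branch point would
  annihilate the velocity of \<open>branching_curve\<close>, so it is singular and the distortion
  takes its default value 1.\<close>

lemma det_jacobian_branching:
  assumes x: "x \<in> branching" and d: "branching_map differentiable (at x)"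
  shows "det (jacobian branching_map (at x)) = 0"
proof (rule ccontr)
  assume nz: "det (jacobian branching_map (at x)) \<noteq> 0"
  let ?A = "jacobian branching_map (at x)"
  obtain \<gamma> w \<delta> where g: "(\<gamma> has_vector_derivative w) (at (0::real))" "\<gamma> 0 = x" "w \<noteq> 0" "\<delta> > 0"
    "\<And>s. \<bar>s\<bar> < \<delta> \<Longrightarrow> branching_map (\<gamma> (- s)) = branching_map (\<gamma> s)"
    using x by (rule branching_curve) blast
  have "(branching_map has_derivative (*v) ?A) (at (\<gamma> 0))" using d g(2) by (simp add: jacobian_works)
  from diff_chain_at[OF g(1)[unfolded has_vector_derivative_def] this]
  have "((\<lambda>s. branching_map (\<gamma> s)) has_vector_derivative ?A *v w) (at 0)"
    by (simp add: has_vector_derivative_def o_def matrix_vector_mult_scaleR)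
  then have "?A *v w = 0" using g(4,5) by (rule even_vector_derivative_zero)
  then have "matrix_inv ?A *v (?A *v w) = 0" by simp
  then show False using g(3) matrix_inv_det_nz(2)[OF nz] by (simp add: matrix_vector_mul_assoc)
qed

text \<open>Operator norms are submultiplicative and determinants multiplicative, so the distortion
  of the composition is at most the product of the two distortions. The maximum with 1 covers the
  default value.\<close>

lemma outer_distortion_branching_map:
  "\<exists>C\<ge>1. \<forall>x. outer_distortion branching_map x \<le> C * log_growth \<epsilon> x"
proof -
  obtain L where L: "L \<ge> 1" "\<And>x. x \<notin> branching \<Longrightarrow>
     \<exists>U M. x \<in> U \<and> C1_deriv U branching_map M \<and> (\<forall>z\<in>U. \<exists>A. bilip L A \<and> M z = A ** to_ball' \<epsilon> R z)"
    using branching_map_regular by metis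
  obtain K where K: "K \<ge> 0"
    "\<And>x :: real^'n. onorm ((*v) (to_ball' \<epsilon> R x)) ^ CARD('n) \<le> K * log_growth \<epsilon> x * det (to_ball' \<epsilon> R x)"
    using to_ball'_distortion[where 'n = 'n] by metis
  let ?B = "fact CARD('n) * (L ^ CARD('n) * L ^ CARD('n)) :: real"
  have lg: "log_growth \<epsilon> x \<ge> 1" for x :: "real^'n" by (simp add: log_growth_def)
  have "outer_distortion branching_map x \<le> max 1 (?B * K) * log_growth \<epsilon> x" for x
  proof (cases "branching_map differentiable (at x) \<and> det (jacobian branching_map (at x)) > 0")
    case True
    then have "x \<notin> branching" using det_jacobian_branching by force
    from L(2)[OF this] obtain U M A where U: "x \<in> U" "C1_deriv U branching_map M"
      and A: "bilip L A" "M x = A ** to_ball' \<epsilon> R x" by blast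
    let ?T = "to_ball' \<epsilon> R x"
    note J = C1_deriv_jacobian[OF U(2,1)]
    have dA: "det A > 0" using A(1) by (simp add: bilip_def)
    have dT: "det ?T > 0" by (rule det_to_ball'_pos)
    have "onorm ((*v) (M x)) \<le> onorm ((*v) A) * onorm ((*v) ?T)"
      using onorm_compose[of "(*v) A" "(*v) ?T"] by (simp add: A(2) o_def matrix_vector_mul_assoc)
    then have "onorm ((*v) (M x)) ^ CARD('n) \<le> onorm ((*v) A) ^ CARD('n) * onorm ((*v) ?T) ^ CARD('n)"
      unfolding power_mult_distrib[symmetric] by (intro power_mono onorm_pos_le) auto
    also have "\<dots> \<le> (?B * det A) * (K * log_growth \<epsilon> x * det ?T)"
      using bilip_onorm_power_le[OF A(1)] K(2)[of x] L(1) dA by (intro mult_mono) (auto simp: onorm_pos_le)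
    also have "\<dots> = (?B * K) * log_growth \<epsilon> x * det (M x)" by (simp add: A(2) det_mul)
    finally have "onorm ((*v) (M x)) ^ CARD('n) / det (M x) \<le> (?B * K) * log_growth \<epsilon> x"
      using dA dT by (simp add: A(2) det_mul divide_le_eq)
    also have "\<dots> \<le> max 1 (?B * K) * log_growth \<epsilon> x" using lg[of x] by (intro mult_right_mono) auto
    finally show ?thesis using True J by (simp add: outer_distortion_def)
  next
    case False
    then have "outer_distortion branching_map x = 1" by (auto simp: outer_distortion_def)
    also have "\<dots> \<le> max 1 (?B * K) * log_growth \<epsilon> x" using lg[of x] mult_mono[of 1 "max 1 (?B * K)" 1 "log_growth \<epsilon> x"] by simp
    finally show ?thesis .
  qed
  then show ?thesis by (intro exI[of _ "max 1 (?B * K)"]) simp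
qed

end

theorem theorem1p3:
  fixes \<epsilon> :: real
  assumes "CARD('n::finite) \<ge> 3" and "\<epsilon> > 0"
  shows "\<exists>(f :: real^'n \<Rightarrow> real^'n) (C :: real).
           C \<ge> 1 \<and>
           piecewise_smooth f \<and> branched_cover f \<and> finite_distortion f \<and>
           (\<forall>x. outer_distortion f x \<le> C * log_growth \<epsilon> x) \<and>
           top_of_set (branch_set f) homeomorphic_space torus_topology (CARD('n) - 2)"
proof -
  define m where "m = CARD('n) - 2"
  obtain e where e: "bij_betw e {0..<CARD('n)} (UNIV :: 'n set)"
    using ex_bij_betw_nat_finite[OF finite_class.finite_UNIV] by blast
  have n: "CARD('n) = Suc (Suc m)" using assms(1) by (simp add: m_def)
  have inj: "i = j" if "e i = e j" "i < CARD('n)" "j < CARD('n)" for i j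
    using e that by (auto simp: bij_betw_def dest: inj_onD)
  \<comment> \<open>The first n - 2 coordinates in the enumeration are the angles; the last two play
    the roles of \<open>a\<close> and \<open>b\<close>.\<close>
  interpret torus_coords e "e m" "e (Suc m)" m
  proof
    show "e m \<noteq> e (Suc m)" using inj[of m "Suc m"] n by auto
    show "inj_on e {..<m}" using inj n by (auto intro!: inj_onI)
    show "e k \<noteq> e m" "e k \<noteq> e (Suc m)" if "k < m" for k
      using that inj[of k m] inj[of k "Suc m"] n by auto
    have "{0..<CARD('n)} = insert m (insert (Suc m) {..<m})" unfolding n by auto
    then show "UNIV = insert (e m) (insert (e (Suc m)) (e ` {..<m}))"
      using e by (simp add: bij_betw_def flip: image_insert)
  qed
  \<comment> \<open>The torus is fixed before the stretch factor, so the radius may depend on it.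
    The summand 1 in \<open>\<bar>B\<bar> + 1\<close> puts it inside the open ball and makes the
    stretch factor at least 1.\<close>
  obtain B where "\<forall>x\<in>core. norm x \<le> B"
    using compact_imp_bounded[OF compact_core] unfolding bounded_iff by blast
  then have B: "core \<subseteq> ball 0 (\<bar>B\<bar> + 1)" by force
  interpret wrapped_ball e "e m" "e (Suc m)" m \<epsilon> "\<bar>B\<bar> + 1"
    by unfold_locales (use assms(2) B in auto)
  obtain C where C: "C \<ge> 1" "\<forall>x. outer_distortion branching_map x \<le> C * log_growth \<epsilon> x"
    using outer_distortion_branching_map by blast
  have "top_of_set (branch_set branching_map) homeomorphic_space torus_topology m"
    by (simp only: branch_set_branching_map branching_homeomorphic)
  then show ?thesis
    using C piecewise_smooth_branching_map branched_cover_branching_map finite_distortion_branching_map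
    unfolding m_def by blast
qed

end
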